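(* Let $M,N$ be topological monoids with $M$ well-pointed, and let $G,H$ be topological semigroups. Then the maps $$\varepsilon(N)_\ast:\mathcal{M}on(WM,WN)\to\mathcal{M}on(WM,N),\qquad \overline{\varepsilon}(H)_\ast:\mathcal{S}gp(\overline{W}G,\overline{W}H)\to\mathcal{S}gp(\overline{W}G,H)$$ given by composition with $\varepsilon(N):WN\to N$ and $\overline{\varepsilon}(H):\overline{W}H\to H$ are homotopy equivalences.
   Context: All spaces are $k$-spaces, with products and function spaces formed in $k$-spaces. $\mathcal{M}on$ is the category of topological monoids and continuous (unit preserving) homomorphisms; $\mathcal{S}gp$ is the category of semigroups ($k$-spaces with continuous associative multiplication) and continuous homomorphisms. Hom-sets carry the subspace topology of the $k$-function spaces. A monoid is well-pointed if the inclusion of its unit $e$ is a closed cofibration. For a semigroup $G$, $\overline{W}G=\big(\coprod_{n\ge 0}G^{n+1}\times[0,1]^n\big)/\sim$, with points written $(x_0,t_1,x_1,\dots,t_n,x_n)$ and the relation (1): $(x_0,t_1,\dots,t_n,x_n)\sim(x_0,t_1,\dots,x_{i-1}x_i,\dots,t_n,x_n)$ if $t_i=0$ (dropping $t_i$). For a monoid $M$, $WM$ is the quotient of $\overline{W}M$ by the further relations (2): $(x_0,t_1,\dots,x_n)\sim(x_1,t_2,\dots,x_n)$ if $x_0=e$; $\sim(x_0,\dots,x_{i-1},\max(t_i,t_{i+1}),x_{i+1},\dots,x_n)$ if $x_i=e$, $0<i<n$; $\sim(x_0,t_1,\dots,x_{n-1})$ if $x_n=e$. Multiplication in both is $(x_0,t_1,\dots,x_k)\cdot(y_0,u_1,\dots,y_l)=(x_0,t_1,\dots,x_k,1,y_0,u_1,\dots,y_l)$.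 The natural homomorphisms $\overline{\varepsilon}(G):\overline{W}G\to G$ and $\varepsilon(M):WM\to M$ send $(x_0,t_1,\dots,x_n)$ to $x_0x_1\cdots x_n$. *)

theory Defs
  imports "HOL-Analysis.Analysis" "HOL-Library.Equipollence"
begin

section \<open>k-spaces\<close>

text \<open>
  A k-space is a topological space X in which a subset is open as soon as its preimage under every
  continuous map from a compact Hausdorff space to X is open. No separation axiom is imposed
  on X. (The constant k_space of HOL-Analysis is a different notion: it tests on the compact
  subsets of X, which need not be Hausdorff.)

  HOL cannot quantify over compact Hausdorff spaces of arbitrary type inside a definition, so the
  type carrying the test spaces is an explicit parameter T, in the role of a universe. On any given
  set-sized family of spaces all sufficiently large T give the same notions; results are stated for
  every T of cardinality at least that of the continuum. All spaces of one statement share the same T.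
\<close>

definition test_map :: "'c topology \<Rightarrow> 'a topology \<Rightarrow> ('c \<Rightarrow> 'a) \<Rightarrow> bool" where
  "test_map C X h \<longleftrightarrow> compact_space C \<and> Hausdorff_space C \<and> continuous_map C X h"

definition k_open :: "'c itself \<Rightarrow> 'a topology \<Rightarrow> 'a set \<Rightarrow> bool" where
  "k_open (T :: 'c itself) X U \<longleftrightarrow> U \<subseteq> topspace X \<and>
     (\<forall>(C :: 'c topology) h. test_map C X h \<longrightarrow> openin C {c \<in> topspace C. h c \<in> U})"

definition kspace :: "'c itself \<Rightarrow> 'a topology \<Rightarrow> bool" where
  "kspace T X \<longleftrightarrow> (\<forall>U. k_open T X U \<longrightarrow> openin X U)"

definition kify :: "'c itself \<Rightarrow> 'a topology \<Rightarrow> 'a topology" where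
  "kify T X = topology (k_open T X)"

lemma istopology_k_open: "istopology (k_open (T :: 'c itself) X)"
  unfolding istopology_def
proof (intro conjI allI impI)
  fix U V assume U: "k_open T X U" and V: "k_open T X V"
  show "k_open T X (U \<inter> V)"
    unfolding k_open_def
  proof (intro conjI allI impI)
    show "U \<inter> V \<subseteq> topspace X" using U by (auto simp: k_open_def)
    fix C :: "'c topology" and h assume h: "test_map C X h"
    have "{c \<in> topspace C. h c \<in> U \<inter> V} =
          {c \<in> topspace C. h c \<in> U} \<inter> {c \<in> topspace C. h c \<in> V}" by auto
    then show "openin C {c \<in> topspace C. h c \<in> U \<inter> V}"
      using U V h by (simp only: k_open_def) (blast intro: openin_Int)
  qed
next
  fix \<K> assume K: "\<forall>U\<in>\<K>. k_open T X U"
  show "k_open T X (\<Union>\<K>)"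
    unfolding k_open_def
  proof (intro conjI allI impI)
    show "\<Union>\<K> \<subseteq> topspace X" using K by (auto simp: k_open_def)
    fix C :: "'c topology" and h assume h: "test_map C X h"
    have "{c \<in> topspace C. h c \<in> \<Union>\<K>} = (\<Union>U\<in>\<K>. {c \<in> topspace C. h c \<in> U})" by auto
    then show "openin C {c \<in> topspace C. h c \<in> \<Union>\<K>}"
      using K h by (simp only: k_open_def) (blast intro: openin_Union)
  qed
qed

lemma openin_kify: "openin (kify T X) U \<longleftrightarrow> k_open T X U"
  by (simp add: kify_def istopology_k_open topology_inverse')

definition kprod :: "'c itself \<Rightarrow> 'a topology \<Rightarrow> 'b topology \<Rightarrow> ('a \<times> 'b) topology" where
  "kprod T X Y = kify T (prod_topology X Y)"

text \<open>
  Points of function spaces are extensional, so that they correspond to maps defined on the domain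
  only. The k-function space is the k-ification of the compact-open topology, whose subbasic sets
  are indexed by a test map h on C and an open set U (the empty C gives the whole set).
\<close>

definition maps :: "'a topology \<Rightarrow> 'b topology \<Rightarrow> ('a \<Rightarrow> 'b) set" where
  "maps X Y = {f \<in> extensional (topspace X). continuous_map X Y f}"

definition compact_open_topology ::
    "'c itself \<Rightarrow> 'a topology \<Rightarrow> 'b topology \<Rightarrow> ('a \<Rightarrow> 'b) topology" where
  "compact_open_topology (T :: 'c itself) X Y = topology_generated_by
     {{f \<in> maps X Y. f ` h ` topspace C \<subseteq> U} | (C :: 'c topology) h U.
        test_map C X h \<and> openin Y U}"

definition kfun :: "'c itself \<Rightarrow> 'a topology \<Rightarrow> 'b topology \<Rightarrow> ('a \<Rightarrow> 'b) topology" where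
  "kfun T X Y = kify T (compact_open_topology T X Y)"

text \<open>
  In the next two definitions the product with the compact interval is the ordinary one: for
  k-spaces it agrees with the k-product, the interval being compact Hausdorff and of cardinality at
  most that of T.
\<close>

definition homotopy_equivalence_map :: "'a topology \<Rightarrow> 'b topology \<Rightarrow> ('a \<Rightarrow> 'b) \<Rightarrow> bool" where
  "homotopy_equivalence_map X Y f \<longleftrightarrow> continuous_map X Y f \<and>
     (\<exists>g. continuous_map Y X g \<and>
          homotopic_with (\<lambda>_. True) X X (g \<circ> f) id \<and>
          homotopic_with (\<lambda>_. True) Y Y (f \<circ> g) id)"

text \<open>
  The inclusion of a closed subset A is a closed cofibration if it has the homotopy extension
  property for all k-spaces Y. The type of Y has to be fixed here; the universal test space, the
  mapping cylinder of the inclusion, is the subspace of the product of the interval and X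
  consisting of (0,x) and (t,a), so Y on the type of that product suffices for all Y.
\<close>

definition closed_cofibration :: "'c itself \<Rightarrow> 'a topology \<Rightarrow> 'a set \<Rightarrow> bool" where
  "closed_cofibration T X A \<longleftrightarrow> closedin X A \<and>
     (\<forall>(Y :: (real \<times> 'a) topology) f h.
        kspace T Y \<and> continuous_map X Y f \<and>
        continuous_map (prod_topology (top_of_set {0..1::real}) (subtopology X A)) Y h \<and>
        (\<forall>a\<in>A. h (0, a) = f a) \<longrightarrow>
        (\<exists>H. continuous_map (prod_topology (top_of_set {0..1::real}) X) Y H \<and>
             (\<forall>x\<in>topspace X. H (0, x) = f x) \<and>
             (\<forall>t\<in>{0..1}. \<forall>a\<in>A. H (t, a) = h (t, a))))"


section \<open>Topological semigroups and monoids\<close>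

record 'a top_sgp =
  space_of :: "'a topology"
  mul :: "'a \<Rightarrow> 'a \<Rightarrow> 'a"

record 'a top_mon = "'a top_sgp" +
  unit_of :: 'a

abbreviation points :: "('a, 'z) top_sgp_scheme \<Rightarrow> 'a set" where
  "points G \<equiv> topspace (space_of G)"

definition topological_semigroup :: "'c itself \<Rightarrow> ('a, 'z) top_sgp_scheme \<Rightarrow> bool" where
  "topological_semigroup T G \<longleftrightarrow>
     kspace T (space_of G) \<and>
     continuous_map (kprod T (space_of G) (space_of G)) (space_of G) (\<lambda>(x, y). mul G x y) \<and>
     (\<forall>x\<in>points G. \<forall>y\<in>points G. \<forall>z\<in>points G. mul G (mul G x y) z = mul G x (mul G y z))"

definition topological_monoid :: "'c itself \<Rightarrow> 'a top_mon \<Rightarrow> bool" where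
  "topological_monoid T M \<longleftrightarrow>
     topological_semigroup T M \<and> unit_of M \<in> points M \<and>
     (\<forall>x\<in>points M. mul M (unit_of M) x = x \<and> mul M x (unit_of M) = x)"

definition well_pointed :: "'c itself \<Rightarrow> 'a top_mon \<Rightarrow> bool" where
  "well_pointed T M \<longleftrightarrow> closed_cofibration T (space_of M) {unit_of M}"

definition sgp_homs :: "('a, 'y) top_sgp_scheme \<Rightarrow> ('b, 'z) top_sgp_scheme \<Rightarrow> ('a \<Rightarrow> 'b) set" where
  "sgp_homs G H = {f \<in> maps (space_of G) (space_of H).
     \<forall>x\<in>points G. \<forall>y\<in>points G. f (mul G x y) = mul H (f x) (f y)}"

definition mon_homs :: "'a top_mon \<Rightarrow> 'b top_mon \<Rightarrow> ('a \<Rightarrow> 'b) set" where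
  "mon_homs M N = {f \<in> sgp_homs M N. f (unit_of M) = unit_of N}"

text \<open>Subspaces, too, are formed in k-spaces, hence the outer k-ification.\<close>

definition Sgp :: "'c itself \<Rightarrow> 'a top_sgp \<Rightarrow> 'b top_sgp \<Rightarrow> ('a \<Rightarrow> 'b) topology" where
  "Sgp T G H = kify T (subtopology (kfun T (space_of G) (space_of H)) (sgp_homs G H))"

definition Mon :: "'c itself \<Rightarrow> 'a top_mon \<Rightarrow> 'b top_mon \<Rightarrow> ('a \<Rightarrow> 'b) topology" where
  "Mon T M N = kify T (subtopology (kfun T (space_of M) (space_of N)) (mon_homs M N))"


section \<open>Quotient spaces\<close>

text \<open>
  The quotient of X by the equivalence relation on its underlying set generated by r. Its points
  are the equivalence classes.
\<close>

definition eq_class :: "'a topology \<Rightarrow> ('a \<Rightarrow> 'a \<Rightarrow> bool) \<Rightarrow> 'a \<Rightarrow> 'a set" where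
  "eq_class X r x = {y. equivclp (\<lambda>u v. u \<in> topspace X \<and> v \<in> topspace X \<and> r u v) x y}"

definition quotient_space :: "'a topology \<Rightarrow> ('a \<Rightarrow> 'a \<Rightarrow> bool) \<Rightarrow> 'a set topology" where
  "quotient_space X r = topology (\<lambda>U. U \<subseteq> eq_class X r ` topspace X \<and>
     openin X {x \<in> topspace X. eq_class X r x \<in> U})"

lemma openin_quotient_space:
  "openin (quotient_space X r) U \<longleftrightarrow> U \<subseteq> eq_class X r ` topspace X \<and>
     openin X {x \<in> topspace X. eq_class X r x \<in> U}"
proof -
  let ?q = "eq_class X r"
  have "istopology (\<lambda>U. U \<subseteq> ?q ` topspace X \<and> openin X {x \<in> topspace X. ?q x \<in> U})"
    unfolding istopology_def
  proof (rule conjI; intro allI impI)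
    fix U V
    assume *: "U \<subseteq> ?q ` topspace X \<and> openin X {x \<in> topspace X. ?q x \<in> U}"
      "V \<subseteq> ?q ` topspace X \<and> openin X {x \<in> topspace X. ?q x \<in> V}"
    have "{x \<in> topspace X. ?q x \<in> U \<inter> V} =
          {x \<in> topspace X. ?q x \<in> U} \<inter> {x \<in> topspace X. ?q x \<in> V}" by auto
    with * show "U \<inter> V \<subseteq> ?q ` topspace X \<and> openin X {x \<in> topspace X. ?q x \<in> U \<inter> V}" by auto
  next
    fix \<K> assume *: "\<forall>U\<in>\<K>. U \<subseteq> ?q ` topspace X \<and> openin X {x \<in> topspace X. ?q x \<in> U}"
    have "{x \<in> topspace X. ?q x \<in> \<Union>\<K>} = (\<Union>U\<in>\<K>. {x \<in> topspace X. ?q x \<in> U})" by auto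
    with * show "\<Union>\<K> \<subseteq> ?q ` topspace X \<and> openin X {x \<in> topspace X. ?q x \<in> \<Union>\<K>}" by auto
  qed
  then show ?thesis by (simp add: quotient_space_def topology_inverse')
qed


section \<open>The constructions $\overline{W}$ and $W$\<close>

text \<open>
  The tuple $(x_0,t_1,x_1,\dots,t_n,x_n)$ is the pair of $x_0$ and the list of the pairs
  $(t_i,x_i)$, and the n-th summand of the coproduct is the set of words whose list has length n.
  It carries the topology of the k-product of n+1 copies of G and n copies of the interval, via the
  bijection that reads a list as a function on the indices below n.
\<close>

type_synonym 'a word = "'a \<times> (real \<times> 'a) list"

definition word_summand ::
    "'c itself \<Rightarrow> ('a, 'z) top_sgp_scheme \<Rightarrow> nat \<Rightarrow> 'a word topology" where
  "word_summand T G n = kify T (pullback_topology {w. length (snd w) = n}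
     (\<lambda>(x, p). (x, restrict (nth p) {..<n}))
     (prod_topology (space_of G)
        (product_topology (\<lambda>_. prod_topology (top_of_set {0..1::real}) (space_of G)) {..<n})))"

definition word_space :: "'c itself \<Rightarrow> ('a, 'z) top_sgp_scheme \<Rightarrow> 'a word topology" where
  "word_space T G = topology (\<lambda>U. \<forall>n. openin (word_summand T G n) {w \<in> U. length (snd w) = n})"

lemma openin_word_space:
  fixes G :: "('a, 'z) top_sgp_scheme"
  shows "openin (word_space T G) U \<longleftrightarrow> (\<forall>n. openin (word_summand T G n) {w \<in> U. length (snd w) = n})"
proof -
  have "istopology (\<lambda>U. \<forall>n. openin (word_summand T G n) {w \<in> U. length (snd w) = n})"
    unfolding istopology_def
  proof (rule conjI; intro allI impI)
    fix U V :: "'a word set" and n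
    assume *: "\<forall>n. openin (word_summand T G n) {w \<in> U. length (snd w) = n}"
      "\<forall>n. openin (word_summand T G n) {w \<in> V. length (snd w) = n}"
    have "{w \<in> U \<inter> V. length (snd w) = n} =
          {w \<in> U. length (snd w) = n} \<inter> {w \<in> V. length (snd w) = n}" by auto
    with * show "openin (word_summand T G n) {w \<in> U \<inter> V. length (snd w) = n}" by auto
  next
    fix \<K> :: "'a word set set" and n
    assume *: "\<forall>U\<in>\<K>. \<forall>n. openin (word_summand T G n) {w \<in> U. length (snd w) = n}"
    have "{w \<in> \<Union>\<K>. length (snd w) = n} = (\<Union>U\<in>\<K>. {w \<in> U. length (snd w) = n})" by auto
    with * show "openin (word_summand T G n) {w \<in> \<Union>\<K>. length (snd w) = n}" by auto
  qed
  then show ?thesis by (simp add: word_space_def topology_inverse')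
qed

text \<open>Relation (1), for $i = 1$ and for $i > 1$.\<close>

inductive rel1 :: "('a, 'z) top_sgp_scheme \<Rightarrow> 'a word \<Rightarrow> 'a word \<Rightarrow> bool" for G where
  first: "rel1 G (x, (0, y) # p) (mul G x y, p)"
| later: "rel1 G (z, p @ (t, x) # (0, y) # q) (z, p @ (t, mul G x y) # q)"

text \<open>Relation (2), for $i = 0$, for $0 < i < n$ and for $i = n$; here $n > 0$.\<close>

inductive rel2 :: "'a top_mon \<Rightarrow> 'a word \<Rightarrow> 'a word \<Rightarrow> bool" for M where
  first: "rel2 M (unit_of M, (t, x) # p) (x, p)"
| inner: "rel2 M (z, p @ (t, unit_of M) # (u, x) # q) (z, p @ (max t u, x) # q)"
| last: "rel2 M (z, p @ [(t, unit_of M)]) (z, p)"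

fun word_mul :: "'a word \<Rightarrow> 'a word \<Rightarrow> 'a word" where
  "word_mul (x, p) (y, q) = (x, p @ (1, y) # q)"

definition word_eval :: "('a, 'z) top_sgp_scheme \<Rightarrow> 'a word \<Rightarrow> 'a" where
  "word_eval G w = foldl (mul G) (fst w) (map snd (snd w))"

text \<open>
  The multiplication of classes is induced by that of representatives: the union below is over
  a family of equal classes.
\<close>

definition class_mul :: "'a word topology \<Rightarrow> ('a word \<Rightarrow> 'a word \<Rightarrow> bool) \<Rightarrow>
    'a word set \<Rightarrow> 'a word set \<Rightarrow> 'a word set" where
  "class_mul X r A B = (\<Union>a\<in>A. \<Union>b\<in>B. eq_class X r (word_mul a b))"

definition Wbar :: "'c itself \<Rightarrow> 'a top_sgp \<Rightarrow> 'a word set top_sgp" where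
  "Wbar T G =
     \<lparr>space_of = quotient_space (word_space T G) (rel1 G),
      mul = class_mul (word_space T G) (rel1 G)\<rparr>"

definition W :: "'c itself \<Rightarrow> 'a top_mon \<Rightarrow> 'a word set top_mon" where
  "W T M = (let r = (\<lambda>v w. rel1 M v w \<or> rel2 M v w) in
     \<lparr>space_of = quotient_space (word_space T M) r,
      mul = class_mul (word_space T M) r,
      unit_of = eq_class (word_space T M) r (unit_of M, [])\<rparr>)"

text \<open>The homomorphisms to G and M; the product is the same for all representatives of a class.\<close>

definition eps :: "('a, 'z) top_sgp_scheme \<Rightarrow> 'a word set \<Rightarrow> 'a" where
  "eps G A = the_elem (word_eval G ` A)"

text \<open>Composition with g, as a map between function spaces with source X.\<close>

definition postcomp :: "'a topology \<Rightarrow> ('b \<Rightarrow> 'd) \<Rightarrow> ('a \<Rightarrow> 'b) \<Rightarrow> ('a \<Rightarrow> 'd)" where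
  "postcomp X g f = compose (topspace X) g f"

end

(*
A homomorphism f from WG to H lifts to a homomorphism from WG to WH: cut a word at its joints
t >= 1/2, stretch the joints of the blocks from [0,1/2] to [0,1], evaluate f on each block, and let
2t - 1 be the joint at a cut. Composed with eps this is f precomposed with a retiming of the joints,
t |-> min 1 (2t), which is homotopic to the identity through the homomorphisms induced by
t |-> min 1 ((2 - l) t). Conversely, for a homomorphism g from WG to WH, the lift of eps g is
(W eps) applied to the lift of g into W(WH), and W eps is homotopic to the evaluation eps of WH
through homomorphisms: multiply the joints of the inner words by l and replace an outer joint s by
max s l. The evaluation composed with the lift of g is g precomposed with the same retiming.

All of this makes sense for a set E of two-sided units, which is empty for semigroups and the
singleton of the unit for monoids, so both statements have one proof. Continuity in the function
space variable is checked on test maps: a test map into a k-function space is the same as a family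
of maps that sends a test map of parameters and a test map of arguments to a continuous map, and
such families descend to quotients.
*)
theory Submission
  imports Defs
begin

section \<open>Test maps and k-spaces\<close>

text \<open>The factor 2 arises because one joint serves two purposes: [0,1/2] times the inside of a
  block and [1/2,1] times a cut. Continuity of the lift at t = 1/2 is where f has to be a
  homomorphism: without the cut, the joint inside the block is 1 and f turns it into a product in H;
  with the cut, the outer joint is 2t - 1 = 0 and relation (1) in WH gives the same product. A
  product of words inserts the joint 1, and 1 is fixed by 2t - 1, by min 1 ((2 - l) t) and by max s
  l. Hence lifts, retimings and flattenings respect products, and every stage of the homotopies is a
  homomorphism. The outer joints become max s l rather than staying s because of the units: deleting
  a unit at an end of an inner word deletes an inner joint as well, which after scaling is at most l
  and so is absorbed by the outer joint beside it. Classes of words admit no continuous choice of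
  representatives, so continuity on words of words needs an induction that resolves one class at a
  time.\<close>

lemma topspace_kify [simp]: "topspace (kify T X) = topspace X"
proof
  show "topspace (kify T X) \<subseteq> topspace X"
    using openin_topspace[of "kify T X"] unfolding openin_kify k_open_def by simp
  have "k_open T X (topspace X)"
    unfolding k_open_def test_map_def continuous_map_def by auto
  then show "topspace X \<subseteq> topspace (kify T X)"
    unfolding openin_kify[symmetric] by (rule openin_subset)
qed

text \<open>Preimages of k-open sets under test maps are open by definition. So k-ification may be
  dropped whenever the source is a test space, which is how all k-products and k-function spaces
  below are handled.\<close>

lemma test_map_kify:
  fixes C :: "'c topology"
  shows "test_map C (kify (T::'c itself) X) h \<longleftrightarrow> test_map C X h"
proof
  assume h: "test_map C (kify T X) h"
  have "k_open T X U" if "openin X U" for U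
    using that unfolding k_open_def test_map_def continuous_map_def by (auto dest: openin_subset)
  with h show "test_map C X h"
    unfolding test_map_def continuous_map_def openin_kify by auto
next
  assume "test_map C X h"
  then show "test_map C (kify T X) h"
    unfolding test_map_def continuous_map_def openin_kify
    by (auto simp: k_open_def test_map_def continuous_map_def)
qed

lemma kspace_kify: "kspace T (kify T X)"
  unfolding kspace_def
proof (intro allI impI)
  fix U assume "k_open T (kify T X) U"
  then show "openin (kify T X) U"
    unfolding openin_kify by (simp add: k_open_def test_map_kify)
qed

lemma continuous_map_from_kspace:
  fixes T :: "'c itself" and f :: "'a \<Rightarrow> 'b"
  assumes X: "kspace T X"
    and f: "\<And>(C :: 'c topology) h. test_map C X h \<Longrightarrow> continuous_map C Y (\<lambda>c. f (h c))"
  shows "continuous_map X Y f"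
  unfolding continuous_map_def
proof (intro conjI allI impI)
  show "f \<in> topspace X \<rightarrow> topspace Y"
  proof
    fix x assume x: "x \<in> topspace X"
    \<comment> \<open>The conditions on open sets do not say that \<open>f\<close> maps points to
      points of \<open>Y\<close>; a constant test map on a one-point space does.\<close>
    have "test_map (discrete_topology {undefined :: 'c}) X (\<lambda>c. x)"
      using x by (simp add: test_map_def compact_space_discrete_topology)
    from f[OF this] have "(\<lambda>_. f x) \<in> {undefined :: 'c} \<rightarrow> topspace Y"
      unfolding continuous_map_def topspace_discrete_topology by (rule conjunct1)
    then show "f x \<in> topspace Y" by auto
  qed
  fix U assume U: "openin Y U"
  have "k_open T X {x \<in> topspace X. f x \<in> U}"
    unfolding k_open_def
  proof (intro conjI allI impI)
    fix C :: "'c topology" and h assume h: "test_map C X h"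
    have "{c \<in> topspace C. h c \<in> {x \<in> topspace X. f x \<in> U}} = {c \<in> topspace C. f (h c) \<in> U}"
      using h by (auto simp: test_map_def continuous_map_def)
    then show "openin C {c \<in> topspace C. h c \<in> {x \<in> topspace X. f x \<in> U}}"
      using f[OF h] U by (simp add: continuous_map_def)
  qed auto
  then show "openin X {x \<in> topspace X. f x \<in> U}"
    using X by (simp add: kspace_def)
qed

text \<open>Test spaces must have the type \<open>'c\<close>. A compact Hausdorff space of another
  type that is small enough is copied into \<open>'c\<close> along an injection \<open>i\<close>,
  with the topology pulled back along the inverse \<open>j\<close>.\<close>

lemma obtain_homeomorphic_test_space:
  fixes D :: "'d topology"
  assumes D: "compact_space D" "Hausdorff_space D" and le: "topspace D \<lesssim> (UNIV :: 'c set)"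
  obtains C :: "'c topology" and i j where "compact_space C" "Hausdorff_space C"
    "continuous_map D C i" "continuous_map C D j" "\<And>d. d \<in> topspace D \<Longrightarrow> j (i d) = d"
proof -
  obtain i :: "'d \<Rightarrow> 'c" where i: "inj_on i (topspace D)"
    using le by (auto simp: lepoll_def)
  define j where "j = inv_into (topspace D) i"
  have ji: "j (i d) = d" if "d \<in> topspace D" for d using i that by (simp add: j_def)
  define C where "C = pullback_topology (i ` topspace D) j D"
  have top: "topspace C = i ` topspace D"
    using ji by (auto simp: C_def topspace_pullback_topology)
  have j: "continuous_map C D j"
    using continuous_map_pullback[of D D id "i ` topspace D" j] by (simp add: C_def)
  have "continuous_map D D (j \<circ> i)"
    using continuous_map_eq[of D D id "j \<circ> i"] ji by simp
  then have ci: "continuous_map D C i"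
    unfolding C_def by (intro continuous_map_pullback') auto
  have "homeomorphic_maps D C i j"
    unfolding homeomorphic_maps_def using ci j ji top by auto
  then have "D homeomorphic_space C" by (auto simp: homeomorphic_space_def)
  then have "compact_space C" "Hausdorff_space C"
    using D by (simp_all flip: homeomorphic_compact_space homeomorphic_Hausdorff_space)
  from that[OF this ci j ji] show ?thesis .
qed

lemma openin_kspace_test:
  fixes T :: "'c itself" and D :: "'d topology"
  assumes U: "k_open T X U" and D: "compact_space D" "Hausdorff_space D"
    and le: "topspace D \<lesssim> (UNIV :: 'c set)" and h: "continuous_map D X h"
  shows "openin D {d \<in> topspace D. h d \<in> U}"
proof -
  obtain C :: "'c topology" and i j where C: "compact_space C" "Hausdorff_space C"
    and i: "continuous_map D C i" and j: "continuous_map C D j"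
    and ji: "\<And>d. d \<in> topspace D \<Longrightarrow> j (i d) = d"
    using obtain_homeomorphic_test_space[OF D le] by metis
  have "test_map C X (h \<circ> j)"
    using C continuous_map_compose[OF j h] by (simp add: test_map_def)
  with U have "openin C {c \<in> topspace C. (h \<circ> j) c \<in> U}" unfolding k_open_def by blast
  with i have "openin D {d \<in> topspace D. i d \<in> {c \<in> topspace C. (h \<circ> j) c \<in> U}}"
    by (auto simp: continuous_map_def)
  moreover have "{d \<in> topspace D. i d \<in> {c \<in> topspace C. (h \<circ> j) c \<in> U}} = {d \<in> topspace D. h d \<in> U}"
    using ji i by (auto simp: continuous_map_def)
  ultimately show ?thesis by simp
qed

text \<open>An infinite cardinal equals its square. Thus a product of two test spaces is again a
  test space up to homeomorphism.\<close>

lemma Times_lepoll_UNIV: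
  fixes A :: "'a set" and B :: "'b set"
  assumes inf: "infinite (UNIV :: 'c set)" and A: "A \<lesssim> (UNIV :: 'c set)" and B: "B \<lesssim> (UNIV :: 'c set)"
  shows "A \<times> B \<lesssim> (UNIV :: 'c set)"
proof -
  obtain f :: "'c \<times> 'c \<Rightarrow> 'c" where f: "bij_betw f (UNIV \<times> UNIV) UNIV"
    using iffD2[OF card_of_ordIso card_of_Times_same_infinite[OF inf]] by auto
  then have "(UNIV :: ('c \<times> 'c) set) \<lesssim> (UNIV :: 'c set)"
    by (auto simp: lepoll_def bij_betw_def)
  moreover have "A \<times> B \<lesssim> (UNIV :: ('c \<times> 'c) set)"
    using times_lepoll_mono[OF A B] by simp
  ultimately show ?thesis using lepoll_trans by blast
qed

text \<open>Given a point (t, x) of a k-open \<open>U\<close>, the slice of \<open>U\<close> over x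
  is open in \<open>K\<close>, hence contains a compact neighbourhood \<open>L\<close> of t. The set
  \<open>B\<close> of all y with \<open>L \<times> {y} \<subseteq> U\<close> is k-open: along a test
  map this is the tube lemma. So \<open>N \<times> B\<close> is an open box around (t, x) inside
  \<open>U\<close>.\<close>

lemma kspace_prod_compact:
  fixes T :: "'c itself" and K :: "'k topology"
  assumes inf: "infinite (UNIV :: 'c set)"
    and K: "compact_space K" "Hausdorff_space K" "topspace K \<lesssim> (UNIV :: 'c set)"
    and X: "kspace T X"
  shows "kspace T (prod_topology K X)"
  unfolding kspace_def
proof (intro allI impI)
  fix U assume U: "k_open T (prod_topology K X) U"
  then have UX: "U \<subseteq> topspace K \<times> topspace X" by (simp add: k_open_def)
  have reg: "neighbourhood_base_of (closedin K) K"
    using compact_Hausdorff_imp_regular_space[OF K(1,2)] by (simp add: neighbourhood_base_of_closedin)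
  show "openin (prod_topology K X) U"
  proof (subst openin_prod_topology_alt, intro allI impI)
    fix t x assume tx: "(t, x) \<in> U"
    then have t: "t \<in> topspace K" and x: "x \<in> topspace X" using UX by auto
    have cx: "continuous_map K (prod_topology K X) (\<lambda>s. (s, x))"
      using x by (simp add: continuous_map_pairwise o_def)
    have V: "openin K {s \<in> topspace K. (s, x) \<in> U}"
      by (rule openin_kspace_test[OF U K cx])
    obtain N L where N: "openin K N" "t \<in> N" "N \<subseteq> L" "closedin K L" "L \<subseteq> {s \<in> topspace K. (s, x) \<in> U}"
      using reg V tx t unfolding neighbourhood_base_of by (metis (no_types, lifting) mem_Collect_eq)
    have L: "compactin K L" using N(4) K(1) closedin_compact_space by blast
    define B where "B = {y \<in> topspace X. L \<times> {y} \<subseteq> U}"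
    have "k_open T X B"
      unfolding k_open_def
    proof (intro conjI allI impI)
      show "B \<subseteq> topspace X" by (auto simp: B_def)
      fix C :: "'c topology" and h assume h: "test_map C X h"
      then have C: "compact_space C" "Hausdorff_space C" "continuous_map C X h"
        by (auto simp: test_map_def)
      let ?W = "{p \<in> topspace (prod_topology K C). (fst p, h (snd p)) \<in> U}"
      have "openin (prod_topology K C) ?W"
      proof (rule openin_kspace_test[OF U])
        show "topspace (prod_topology K C) \<lesssim> (UNIV :: 'c set)"
          using Times_lepoll_UNIV[OF inf K(3), of "topspace C"] subset_imp_lepoll[of "topspace C" UNIV] by simp
        have "continuous_map (prod_topology K C) X (h \<circ> snd)"
          by (rule continuous_map_compose[OF continuous_map_snd C(3)])
        then show "continuous_map (prod_topology K C) (prod_topology K X) (\<lambda>p. (fst p, h (snd p)))"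
          by (simp add: continuous_map_pairwise o_def continuous_map_fst)
      qed (use K C in \<open>simp_all add: compact_space_prod_topology Hausdorff_space_prod_topology\<close>)
      note W = this
      show "openin C {c \<in> topspace C. h c \<in> B}"
      proof (subst openin_subopen, intro ballI)
        fix c assume c: "c \<in> {c \<in> topspace C. h c \<in> B}"
        have "L \<times> {c} \<subseteq> ?W" using c N(5) by (auto simp: B_def)
        then obtain P Q where PQ: "openin C Q" "L \<subseteq> P" "c \<in> Q" "P \<times> Q \<subseteq> ?W"
          using tube_lemma_left[OF W L, of c] c by auto
        have "Q \<subseteq> {c \<in> topspace C. h c \<in> B}"
        proof
          fix d assume d: "d \<in> Q"
          then have "d \<in> topspace C" using PQ(1) openin_subset by blast
          moreover have "h d \<in> topspace X"
            using \<open>d \<in> topspace C\<close> C(3) by (auto simp: continuous_map_def)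
          moreover have "(s, h d) \<in> U" if "s \<in> L" for s
            using subsetD[OF PQ(4), of "(s, d)"] PQ(2) d that by auto
          ultimately show "d \<in> {c \<in> topspace C. h c \<in> B}" by (auto simp: B_def)
        qed
        then show "\<exists>Q. openin C Q \<and> c \<in> Q \<and> Q \<subseteq> {c \<in> topspace C. h c \<in> B}"
          using PQ by blast
      qed
    qed
    then have "openin X B" using X by (simp add: kspace_def)
    moreover have "x \<in> B" using x N(5) by (auto simp: B_def)
    moreover have "N \<times> B \<subseteq> U" using N(3) by (auto simp: B_def)
    ultimately show "\<exists>P Q. openin K P \<and> openin X Q \<and> t \<in> P \<and> x \<in> Q \<and> P \<times> Q \<subseteq> U"
      using N by blast
  qed
qed

section \<open>Families of maps\<close>

text \<open>Joint continuity of (c, x) \<mapsto> \<open>\<Phi> c x\<close> on the k-product of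
  \<open>C\<close> and \<open>X\<close>, tested on pairs of maps from a common compact Hausdorff
  space. In this form no topology on the product is needed.\<close>

definition test_family :: "'c topology \<Rightarrow> 'a topology \<Rightarrow> 'b topology \<Rightarrow> ('c \<Rightarrow> 'a \<Rightarrow> 'b) \<Rightarrow> bool" where
  "test_family C X Y \<Phi> \<longleftrightarrow> (\<forall>(D :: 'c topology) a p.
     compact_space D \<longrightarrow> Hausdorff_space D \<longrightarrow> continuous_map D C a \<longrightarrow> continuous_map D X p \<longrightarrow>
     continuous_map D Y (\<lambda>d. \<Phi> (a d) (p d)))"

lemma test_familyD:
  fixes C D :: "'c topology"
  assumes "test_family C X Y \<Phi>" "compact_space D" "Hausdorff_space D"
    "continuous_map D C a" "continuous_map D X p"
  shows "continuous_map D Y (\<lambda>d. \<Phi> (a d) (p d))"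
  using assms unfolding test_family_def by blast

lemma continuous_map_compact_open:
  fixes T :: "'c itself" and C :: "'c topology" and \<phi> :: "'c \<Rightarrow> 'a \<Rightarrow> 'b"
  assumes inf: "infinite (UNIV :: 'c set)"
    and C: "compact_space C" "Hausdorff_space C"
    and maps: "\<And>c. c \<in> topspace C \<Longrightarrow> \<phi> c \<in> maps X Y"
  shows "continuous_map C (compact_open_topology T X Y) \<phi> \<longleftrightarrow> test_family C X Y \<phi>"
proof
  assume L: "continuous_map C (compact_open_topology T X Y) \<phi>"
  show "test_family C X Y \<phi>"
    unfolding test_family_def
  proof (intro allI impI)
    fix D :: "'c topology" and a p
    assume D: "compact_space D" "Hausdorff_space D" and a: "continuous_map D C a" and p: "continuous_map D X p"
    show "continuous_map D Y (\<lambda>d. \<phi> (a d) (p d))"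
      unfolding continuous_map_def
    proof (intro conjI allI impI)
      show "(\<lambda>d. \<phi> (a d) (p d)) \<in> topspace D \<rightarrow> topspace Y"
        using a p maps by (force simp: continuous_map_def maps_def)
      fix V assume V: "openin Y V"
      show "openin D {d \<in> topspace D. \<phi> (a d) (p d) \<in> V}"
      proof (subst openin_subopen, intro ballI)
        fix d assume d: "d \<in> {d \<in> topspace D. \<phi> (a d) (p d) \<in> V}"
        then have ad: "a d \<in> topspace C" using a by (auto simp: continuous_map_def)
        have "continuous_map D Y (\<lambda>e. \<phi> (a d) (p e))"
          using continuous_map_compose[OF p, of Y "\<phi> (a d)"] maps[OF ad] by (simp add: maps_def o_def)
        then have ope: "openin D {e \<in> topspace D. \<phi> (a d) (p e) \<in> V}"
          using V by (auto simp: continuous_map_def)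
        have reg: "neighbourhood_base_of (closedin D) D"
          using compact_Hausdorff_imp_regular_space[OF D] by (simp add: neighbourhood_base_of_closedin)
        obtain N L where N: "openin D N" "d \<in> N" "N \<subseteq> L" "closedin D L"
          "L \<subseteq> {e \<in> topspace D. \<phi> (a d) (p e) \<in> V}"
          using reg ope d unfolding neighbourhood_base_of by (metis (no_types, lifting) mem_Collect_eq)
        have Ltop: "L \<subseteq> topspace D" using N(5) by auto
        have tL: "test_map (subtopology D L) X p"
          using N(4) D p by (simp add: test_map_def Hausdorff_space_subtopology
              continuous_map_from_subtopology closedin_compact_space compact_space_subtopology)
        let ?S = "{f \<in> maps X Y. f ` p ` topspace (subtopology D L) \<subseteq> V}"
        have "openin (compact_open_topology T X Y) ?S"
          unfolding compact_open_topology_def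
          by (rule topology_generated_by_Basis) (use tL V in blast)
        then have "openin C {c \<in> topspace C. \<phi> c \<in> ?S}"
          using L by (auto simp: continuous_map_def)
        then have "openin D {e \<in> topspace D. a e \<in> {c \<in> topspace C. \<phi> c \<in> ?S}}"
          using a by (auto simp: continuous_map_def)
        then have "openin D (N \<inter> {e \<in> topspace D. a e \<in> {c \<in> topspace C. \<phi> c \<in> ?S}})"
          using N(1) by blast
        moreover have "d \<in> N \<inter> {e \<in> topspace D. a e \<in> {c \<in> topspace C. \<phi> c \<in> ?S}}"
          using N d ad maps[OF ad] by auto
        moreover have "N \<inter> {e \<in> topspace D. a e \<in> {c \<in> topspace C. \<phi> c \<in> ?S}} \<subseteq> {d \<in> topspace D. \<phi> (a d) (p d) \<in> V}"
        proof
          fix e assume e: "e \<in> N \<inter> {e \<in> topspace D. a e \<in> {c \<in> topspace C. \<phi> c \<in> ?S}}"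
          then have "\<phi> (a e) ` p ` topspace (subtopology D L) \<subseteq> V" "e \<in> L" "e \<in> topspace D"
            using N(3) by auto
          moreover from this have "e \<in> topspace (subtopology D L)" by simp
          ultimately show "e \<in> {d \<in> topspace D. \<phi> (a d) (p d) \<in> V}" by blast
        qed
        ultimately show "\<exists>S. openin D S \<and> d \<in> S \<and> S \<subseteq> {d \<in> topspace D. \<phi> (a d) (p d) \<in> V}"
          by blast
      qed
    qed
  qed
next
  assume R: "test_family C X Y \<phi>"
  let ?B = "{{f \<in> maps X Y. f ` h ` topspace C \<subseteq> U} | (C :: 'c topology) h U. test_map C X h \<and> openin Y U}"
  show "continuous_map C (compact_open_topology T X Y) \<phi>"
    unfolding compact_open_topology_def
  proof (rule continuous_on_generated_topo)
    have tr: "test_map (discrete_topology ({} :: 'c set)) X (\<lambda>c. undefined)"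
      by (simp add: test_map_def compact_space_discrete_topology)
    have "maps X Y = {f \<in> maps X Y. f ` (\<lambda>c. undefined) ` topspace (discrete_topology ({} :: 'c set)) \<subseteq> {}}"
      by auto
    then have "maps X Y \<in> ?B" using tr openin_empty[of Y] by blast
    then show "\<phi> ` topspace C \<subseteq> \<Union>?B" using maps by blast
    fix S assume "S \<in> ?B"
    then obtain D :: "'c topology" and h U where S: "S = {f \<in> maps X Y. f ` h ` topspace D \<subseteq> U}"
      and h: "test_map D X h" and U: "openin Y U" by blast
    have D: "compact_space D" "Hausdorff_space D" "continuous_map D X h"
      using h by (auto simp: test_map_def)
    have CD: "compact_space (prod_topology C D)" "Hausdorff_space (prod_topology C D)"
      using C D by (simp_all add: compact_space_prod_topology Hausdorff_space_prod_topology)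
    have le: "topspace (prod_topology C D) \<lesssim> (UNIV :: 'c set)"
      using Times_lepoll_UNIV[OF inf, of "topspace C" "topspace D"] by (simp add: subset_imp_lepoll)
    obtain P :: "'c topology" and i j where P: "compact_space P" "Hausdorff_space P"
      and i: "continuous_map (prod_topology C D) P i" and j: "continuous_map P (prod_topology C D) j"
      and ji: "\<And>d. d \<in> topspace (prod_topology C D) \<Longrightarrow> j (i d) = d"
      using obtain_homeomorphic_test_space[OF CD le] by metis
    \<comment> \<open>The family is applied to the two projections, on the copy \<open>P\<close> of
      the product of \<open>C\<close> and \<open>D\<close> that has type \<open>'c\<close>.\<close>
    have "continuous_map P Y (\<lambda>d. \<phi> (fst (j d)) (h (snd (j d))))"
      using test_familyD[OF R P continuous_map_fst_of[OF j]
          continuous_map_compose[OF continuous_map_snd_of[OF j] D(3)]]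
      by simp
    from continuous_map_compose[OF i this]
    have "continuous_map (prod_topology C D) Y (\<lambda>d. \<phi> (fst d) (h (snd d)))"
      by (rule continuous_map_eq) (use ji in auto)
    then have W: "openin (prod_topology C D) {d \<in> topspace (prod_topology C D). \<phi> (fst d) (h (snd d)) \<in> U}"
      (is "openin _ ?W") using U by (auto simp: continuous_map_def)
    have topD: "compactin D (topspace D)" using D by (simp add: compact_space_def)
    show "openin C (\<phi> -` S \<inter> topspace C)"
    proof (subst openin_subopen, intro ballI)
      fix c assume c: "c \<in> \<phi> -` S \<inter> topspace C"
      have "{c} \<times> topspace D \<subseteq> ?W" using c S by auto
      then obtain A B where AB: "openin C A" "c \<in> A" "topspace D \<subseteq> B" "A \<times> B \<subseteq> ?W"
        using tube_lemma_right[OF W topD, of c] c by auto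
      have "A \<subseteq> \<phi> -` S \<inter> topspace C"
      proof
        fix e assume e: "e \<in> A"
        then have "e \<in> topspace C" using AB(1) openin_subset by blast
        moreover have "\<phi> e (h d) \<in> U" if "d \<in> topspace D" for d
          using subsetD[OF AB(4), of "(e, d)"] AB(3) e that by auto
        then have "\<phi> e ` h ` topspace D \<subseteq> U" by auto
        ultimately show "e \<in> \<phi> -` S \<inter> topspace C" using maps S by auto
      qed
      then show "\<exists>A. openin C A \<and> c \<in> A \<and> A \<subseteq> \<phi> -` S \<inter> topspace C" using AB by blast
    qed
  qed
qed

section \<open>Quotients\<close>

lemma topspace_quotient_space: "topspace (quotient_space X r) = eq_class X r ` topspace X"
proof
  show "topspace (quotient_space X r) \<subseteq> eq_class X r ` topspace X"
    using openin_topspace[of "quotient_space X r"] unfolding openin_quotient_space by simp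
  have "{x \<in> topspace X. eq_class X r x \<in> eq_class X r ` topspace X} = topspace X" by auto
  then have "openin (quotient_space X r) (eq_class X r ` topspace X)"
    unfolding openin_quotient_space by simp
  then show "eq_class X r ` topspace X \<subseteq> topspace (quotient_space X r)" by (rule openin_subset)
qed

lemma quotient_map_eq_class: "quotient_map X (quotient_space X r) (eq_class X r)"
  unfolding quotient_map_def topspace_quotient_space openin_quotient_space by auto

lemma eq_class_eq_iff:
  "eq_class X r x = eq_class X r y \<longleftrightarrow> equivclp (\<lambda>u v. u \<in> topspace X \<and> v \<in> topspace X \<and> r u v) x y"
  (is "_ \<longleftrightarrow> equivclp ?r x y")
proof
  assume "eq_class X r x = eq_class X r y"
  then have "equivclp ?r x y \<longleftrightarrow> equivclp ?r y y" by (simp add: eq_class_def set_eq_iff)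
  then show "equivclp ?r x y" by simp
next
  assume "equivclp ?r x y"
  then have "equivclp ?r x z \<longleftrightarrow> equivclp ?r y z" for z
    by (meson equivclp_trans equivclp_sym)
  then show "eq_class X r x = eq_class X r y" by (simp add: eq_class_def)
qed

lemma eq_class_self: "x \<in> eq_class X r x"
  by (simp add: eq_class_def)

lemma eq_class_member: "y \<in> eq_class X r x \<Longrightarrow> eq_class X r y = eq_class X r x"
  unfolding eq_class_eq_iff by (simp add: eq_class_def equivclp_sym)

lemma eq_class_subset:
  assumes "x \<in> topspace X" shows "eq_class X r x \<subseteq> topspace X"
proof
  fix y assume "y \<in> eq_class X r x"
  then have "equivclp (\<lambda>u v. u \<in> topspace X \<and> v \<in> topspace X \<and> r u v) x y" by (simp add: eq_class_def)
  then show "y \<in> topspace X"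
    by (induction rule: equivclp_induct) (use assms in auto)
qed

lemma eq_class_rel:
  assumes "x \<in> topspace X" "y \<in> topspace X" "r x y"
  shows "eq_class X r x = eq_class X r y"
  unfolding eq_class_eq_iff using assms by (intro r_into_equivclp) auto

lemma eq_class_invariant:
  assumes eq: "eq_class X r x = eq_class X r y"
    and F: "\<And>u v. u \<in> topspace X \<Longrightarrow> v \<in> topspace X \<Longrightarrow> r u v \<Longrightarrow> F u = F v"
  shows "F x = F y"
proof -
  have "equivclp (\<lambda>u v. u \<in> topspace X \<and> v \<in> topspace X \<and> r u v) x y" using eq by (simp add: eq_class_eq_iff)
  then show ?thesis by (induction rule: equivclp_induct) (use F in auto)
qed

text \<open>A test map into \<open>X\<close> followed by the quotient map is a test map into the
  quotient, so preimages of k-open sets are k-open in \<open>X\<close>, hence open.\<close>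

lemma kspace_quotient_space:
  fixes T :: "'c itself"
  assumes X: "kspace T X" shows "kspace T (quotient_space X r)"
  unfolding kspace_def
proof (intro allI impI)
  let ?q = "eq_class X r"
  fix U assume U: "k_open T (quotient_space X r) U"
  have "k_open T X {x \<in> topspace X. ?q x \<in> U}"
    unfolding k_open_def
  proof (intro conjI allI impI)
    fix C :: "'c topology" and h assume h: "test_map C X h"
    then have "test_map C (quotient_space X r) (?q \<circ> h)"
      using quotient_imp_continuous_map[OF quotient_map_eq_class]
      by (auto simp: test_map_def intro: continuous_map_compose)
    then have "openin C {c \<in> topspace C. (?q \<circ> h) c \<in> U}" using U unfolding k_open_def by blast
    moreover have "{c \<in> topspace C. (?q \<circ> h) c \<in> U} = {c \<in> topspace C. h c \<in> {x \<in> topspace X. ?q x \<in> U}}"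
      using h by (auto simp: test_map_def continuous_map_def)
    ultimately show "openin C {c \<in> topspace C. h c \<in> {x \<in> topspace X. ?q x \<in> U}}" by simp
  qed auto
  then show "openin (quotient_space X r) U"
    using U X unfolding openin_quotient_space by (simp add: kspace_def k_open_def topspace_quotient_space)
qed

text \<open>
  Maps out of a quotient depending on a parameter in C: the product of C with a quotient map is a
  quotient map, and maps out of C \<times> X are tested on test maps.
\<close>

lemma test_family_quotient:
  fixes T :: "'c itself" and C :: "'c topology"
  assumes inf: "infinite (UNIV :: 'c set)"
    and X: "kspace T X" and C: "compact_space C" "Hausdorff_space C"
    and \<Phi>: "test_family C X Y \<Phi>"
    and \<Psi>: "\<And>c x. c \<in> topspace C \<Longrightarrow> x \<in> topspace X \<Longrightarrow> \<Psi> c (eq_class X r x) = \<Phi> c x"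
  shows "test_family C (quotient_space X r) Y \<Psi>"
  unfolding test_family_def
proof (intro allI impI)
  fix D :: "'c topology" and a p
  assume D: "compact_space D" "Hausdorff_space D" and a: "continuous_map D C a"
    and p: "continuous_map D (quotient_space X r) p"
  \<comment> \<open>The parameter space is taken to be \<open>D\<close> instead of \<open>C\<close>,
    so that the pair (a, p) is read off along the graph of \<open>p\<close>.\<close>
  have kX: "kspace T (prod_topology D X)"
    by (rule kspace_prod_compact[OF inf D _ X]) (simp add: subset_imp_lepoll)
  have "continuous_map (prod_topology D X) Y (\<lambda>z. \<Phi> (a (fst z)) (snd z))"
  proof (rule continuous_map_from_kspace[OF kX])
    fix B :: "'c topology" and h assume h: "test_map B (prod_topology D X) h"
    then show "continuous_map B Y (\<lambda>c. \<Phi> (a (fst (h c))) (snd (h c)))"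
      using test_familyD[OF \<Phi> _ _ continuous_map_compose[OF continuous_map_fst_of a] continuous_map_snd_of, of B X h D h]
      by (simp add: test_map_def)
  qed
  moreover have "a (fst z) \<in> topspace C" if "z \<in> topspace (prod_topology D X)" for z
    using a that by (auto simp: continuous_map_def)
  ultimately have "continuous_map (prod_topology D X) Y
      ((\<lambda>z. \<Psi> (a (fst z)) (snd z)) \<circ> (\<lambda>(d, x). (d, eq_class X r x)))"
    using \<Psi> by (elim continuous_map_eq) auto
  moreover have "quotient_map (prod_topology D X) (prod_topology D (quotient_space X r)) (\<lambda>(d, x). (d, eq_class X r x))"
    by (rule quotient_map_prod_right) (use D quotient_map_eq_class compact_imp_locally_compact_space in auto)
  ultimately have "continuous_map (prod_topology D (quotient_space X r)) Y (\<lambda>z. \<Psi> (a (fst z)) (snd z))"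
    by (meson continuous_compose_quotient_map)
  moreover have "continuous_map D (prod_topology D (quotient_space X r)) (\<lambda>d. (d, p d))"
    using p by (simp add: continuous_map_pairwise o_def)
  ultimately have "continuous_map D Y ((\<lambda>z. \<Psi> (a (fst z)) (snd z)) \<circ> (\<lambda>d. (d, p d)))"
    using continuous_map_compose by blast
  then show "continuous_map D Y (\<lambda>d. \<Psi> (a d) (p d))" by (simp add: o_def)
qed

section \<open>Words as lists\<close>

text \<open>
  A word is encoded by a nonempty list of pairs, the joint in the first pair being junk. This makes
  the first and the later instances of the relations uniform.
\<close>

definition word_of :: "(real \<times> 'a) list \<Rightarrow> 'a word" where
  "word_of L = (snd (hd L), tl L)"

definition list_of :: "'a word \<Rightarrow> (real \<times> 'a) list" where
  "list_of w = (1, fst w) # snd w"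

lemma word_of_list_of [simp]: "word_of (list_of w) = w"
  by (simp add: word_of_def list_of_def)

lemma list_of_not_Nil [simp]: "list_of w \<noteq> []"
  by (simp add: list_of_def)

inductive unit_rel :: "'a set \<Rightarrow> 'a word \<Rightarrow> 'a word \<Rightarrow> bool" for E where
  first: "e \<in> E \<Longrightarrow> unit_rel E (e, (t, x) # p) (x, p)"
| inner: "e \<in> E \<Longrightarrow> unit_rel E (z, p @ (t, e) # (u, x) # q) (z, p @ (max t u, x) # q)"
| last: "e \<in> E \<Longrightarrow> unit_rel E (z, p @ [(t, e)]) (z, p)"

definition word_rel :: "'a top_sgp \<Rightarrow> 'a set \<Rightarrow> 'a word \<Rightarrow> 'a word \<Rightarrow> bool" where
  "word_rel G E v w \<longleftrightarrow> rel1 G v w \<or> unit_rel E v w"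

definition word_sgp :: "'c itself \<Rightarrow> 'a top_sgp \<Rightarrow> 'a set \<Rightarrow> 'a word set top_sgp" where
  "word_sgp T G E = \<lparr>space_of = quotient_space (word_space T G) (word_rel G E),
     mul = class_mul (word_space T G) (word_rel G E)\<rparr>"

definition cls :: "'c itself \<Rightarrow> 'a top_sgp \<Rightarrow> 'a set \<Rightarrow> (real \<times> 'a) list \<Rightarrow> 'a word set" where
  "cls T G E L = eq_class (word_space T G) (word_rel G E) (word_of L)"

definition word_units :: "'c itself \<Rightarrow> 'a top_sgp \<Rightarrow> 'a set \<Rightarrow> 'a word set set" where
  "word_units T G E = (\<lambda>e. cls T G E [(1, e)]) ` E"

text \<open>Maps on classes are defined on this chosen representative and then shown not to depend
  on the choice. Its junk joint is 1, the joint that a product inserts before its right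
  factor.\<close>

definition rep :: "'a word set \<Rightarrow> (real \<times> 'a) list" where
  "rep A = list_of (SOME w. w \<in> A)"

abbreviation letters :: "('a, 'z) top_sgp_scheme \<Rightarrow> (real \<times> 'a) set" where
  "letters G \<equiv> {0..1} \<times> points G"

lemma topspace_word_summand:
  "topspace (word_summand T G n) = {w. fst w \<in> points G \<and> set (snd w) \<subseteq> letters G \<and> length (snd w) = n}"
proof -
  define P where "P = (\<Pi>\<^sub>E i\<in>{..<n}. letters G)"
  have top: "topspace (product_topology (\<lambda>_. prod_topology (top_of_set {0..1::real}) (space_of G)) {..<n}) = P"
    by (simp add: P_def)
  have "restrict (nth p) {..<n} \<in> P \<longleftrightarrow> set p \<subseteq> letters G"
    if "length p = n" for p :: "(real \<times> 'a) list"
  proof -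
    have "set p \<subseteq> letters G \<longleftrightarrow> (\<forall>i<n. p ! i \<in> letters G)"
      using that unfolding set_conv_nth by blast
    then show ?thesis by (simp add: PiE_iff P_def Pi_iff Ball_def)
  qed
  then show ?thesis
    unfolding word_summand_def topspace_kify topspace_pullback_topology
      topspace_prod_topology top by (force dest: subsetD)
qed

lemma topspace_word_space:
  "topspace (word_space T G) = {w. fst w \<in> points G \<and> set (snd w) \<subseteq> letters G}" (is "_ = ?S")
proof
  show "topspace (word_space T G) \<subseteq> ?S"
  proof
    fix w assume "w \<in> topspace (word_space T G)"
    then obtain U where U: "openin (word_space T G) U" "w \<in> U" unfolding topspace_def by blast
    then have "openin (word_summand T G (length (snd w))) {v \<in> U. length (snd v) = length (snd w)}"
      unfolding openin_word_space by blast
    from openin_subset[OF this] U(2) show "w \<in> ?S" unfolding topspace_word_summand by auto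
  qed
  have "{w \<in> ?S. length (snd w) = n} = topspace (word_summand T G n)" for n
    unfolding topspace_word_summand by auto
  then have "openin (word_space T G) ?S" unfolding openin_word_space by (metis openin_topspace)
  then show "?S \<subseteq> topspace (word_space T G)" by (rule openin_subset)
qed

lemma word_of_in_word_space:
  "L \<noteq> [] \<Longrightarrow> set L \<subseteq> letters G \<Longrightarrow> word_of L \<in> topspace (word_space T G)"
  by (cases L) (auto simp: word_of_def topspace_word_space)

lemma list_of_letters:
  "w \<in> topspace (word_space T G) \<Longrightarrow> set (list_of w) \<subseteq> letters G"
  by (auto simp: list_of_def topspace_word_space)

definition list_eval :: "'a top_sgp \<Rightarrow> (real \<times> 'a) list \<Rightarrow> 'a" where
  "list_eval G L = foldl (mul G) (snd (hd L)) (map snd (tl L))"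

lemma word_eval_word_of: "word_eval G (word_of L) = list_eval G L"
  by (simp add: word_eval_def word_of_def list_eval_def)

lemma list_eval_single [simp]: "list_eval G [(t, x)] = x"
  by (simp add: list_eval_def)

definition shrink :: "real \<Rightarrow> (real \<times> 'a) list \<Rightarrow> (real \<times> 'a) list" where
  "shrink l = map (\<lambda>(t, x). (l * t, x))"

lemma shrink_simps [simp]:
  "shrink l [] = []" "shrink l ((t, x) # p) = (l * t, x) # shrink l p"
  "shrink l (p @ q) = shrink l p @ shrink l q"
  by (simp_all add: shrink_def)

lemma shrink_1 [simp]: "shrink 1 p = p"
  by (induction p) auto

lemma set_shrink:
  assumes "0 \<le> l" "l \<le> 1" "set p \<subseteq> letters G"
  shows "set (shrink l p) \<subseteq> letters G"
proof
  fix z assume "z \<in> set (shrink l p)"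
  then obtain t x where "(t, x) \<in> set p" "z = (l * t, x)" by (auto simp: shrink_def)
  with assms show "z \<in> letters G" by (auto simp: mult_le_one)
qed

text \<open>Pure algebra: the multiplication is not asked to be continuous. The locale therefore
  applies to the semigroup of classes itself without any continuity proof for its
  multiplication.\<close>

locale unital_semigroup =
  fixes T :: "'c itself" and G :: "'a top_sgp" and E :: "'a set"
  assumes mul_closed: "x \<in> points G \<Longrightarrow> y \<in> points G \<Longrightarrow> mul G x y \<in> points G"
    and mul_assoc: "x \<in> points G \<Longrightarrow> y \<in> points G \<Longrightarrow> z \<in> points G \<Longrightarrow>
      mul G (mul G x y) z = mul G x (mul G y z)"
    and units_subset: "E \<subseteq> points G"
    and unit_left: "e \<in> E \<Longrightarrow> x \<in> points G \<Longrightarrow> mul G e x = x"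
    and unit_right: "e \<in> E \<Longrightarrow> x \<in> points G \<Longrightarrow> mul G x e = x"
begin

abbreviation "WG \<equiv> word_sgp T G E"
abbreviation "c \<equiv> cls T G E"

section \<open>Relations between classes, in list form\<close>

lemma unit_point: "e \<in> E \<Longrightarrow> e \<in> points G"
  using units_subset by blast

lemma cls_head: "c ((s, x) # p) = c ((s', x) # p)"
  by (simp add: cls_def word_of_def)

lemma cls_rel:
  assumes "L \<noteq> []" "set L \<subseteq> letters G" "L' \<noteq> []" "set L' \<subseteq> letters G"
    and "word_rel G E (word_of L) (word_of L')"
  shows "c L = c L'"
  unfolding cls_def
  by (rule eq_class_rel[where r = "word_rel G E", OF word_of_in_word_space[OF assms(1,2), of T]
        word_of_in_word_space[OF assms(3,4), of T] assms(5)])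

lemma cls_mul:
  assumes "set q \<subseteq> letters G" "s \<in> {0..1}" "x \<in> points G" "y \<in> points G" "set p \<subseteq> letters G"
  shows "c (q @ (s, x) # (0, y) # p) = c (q @ (s, mul G x y) # p)"
proof (rule cls_rel)
  show "word_rel G E (word_of (q @ (s, x) # (0, y) # p)) (word_of (q @ (s, mul G x y) # p))"
  proof (cases q)
    case Nil
    then show ?thesis by (auto simp: word_rel_def word_of_def intro: rel1.first)
  next
    case (Cons a q')
    then show ?thesis by (auto simp: word_rel_def word_of_def intro: rel1.later)
  qed
qed (use assms mul_closed in auto)

lemma cls_unit:
  assumes "set q \<subseteq> letters G" "s \<in> {0..1}" "e \<in> E" "t \<in> {0..1}" "x \<in> points G" "set p \<subseteq> letters G"
  shows "c (q @ (s, e) # (t, x) # p) = c (q @ (max s t, x) # p)"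
proof (rule cls_rel)
  show "word_rel G E (word_of (q @ (s, e) # (t, x) # p)) (word_of (q @ (max s t, x) # p))"
  proof (cases q)
    case Nil
    then show ?thesis using assms(3) by (auto simp: word_rel_def word_of_def intro: unit_rel.first)
  next
    case (Cons a q')
    then show ?thesis using assms(3) by (auto simp: word_rel_def word_of_def intro: unit_rel.inner)
  qed
qed (use assms unit_point in auto)

lemma cls_last:
  assumes "q \<noteq> []" "set q \<subseteq> letters G" "e \<in> E" "t \<in> {0..1}"
  shows "c (q @ [(t, e)]) = c q"
proof (rule cls_rel)
  show "word_rel G E (word_of (q @ [(t, e)])) (word_of q)"
    using assms(1,3) by (auto simp: word_rel_def word_of_def neq_Nil_conv intro: unit_rel.last)
qed (use assms unit_point in auto)

text \<open>\<open>F1\<close> to \<open>F3\<close> are the relations in list form; \<open>F4\<close>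
  says that \<open>F\<close> ignores the junk joint and so is a function of the word. Nearly every
  map on classes below is shown to be well defined by this rule.\<close>

lemma cls_invariant:
  assumes eq: "c L = c L'" and L: "L \<noteq> []" "set L \<subseteq> letters G" and L': "L' \<noteq> []" "set L' \<subseteq> letters G"
    and F1: "\<And>q s x y p. set q \<subseteq> letters G \<Longrightarrow> s \<in> {0..1} \<Longrightarrow> x \<in> points G \<Longrightarrow> y \<in> points G \<Longrightarrow>
      set p \<subseteq> letters G \<Longrightarrow> F (q @ (s, x) # (0, y) # p) = F (q @ (s, mul G x y) # p)"
    and F2: "\<And>q s e t x p. set q \<subseteq> letters G \<Longrightarrow> s \<in> {0..1} \<Longrightarrow> e \<in> E \<Longrightarrow> t \<in> {0..1} \<Longrightarrow>
      x \<in> points G \<Longrightarrow> set p \<subseteq> letters G \<Longrightarrow> F (q @ (s, e) # (t, x) # p) = F (q @ (max s t, x) # p)"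
    and F3: "\<And>q t e. q \<noteq> [] \<Longrightarrow> set q \<subseteq> letters G \<Longrightarrow> t \<in> {0..1} \<Longrightarrow> e \<in> E \<Longrightarrow> F (q @ [(t, e)]) = F q"
    and F4: "\<And>s s' x p. s \<in> {0..1} \<Longrightarrow> s' \<in> {0..1} \<Longrightarrow> x \<in> points G \<Longrightarrow> set p \<subseteq> letters G \<Longrightarrow>
      F ((s, x) # p) = F ((s', x) # p)"
  shows "F L = F L'"
proof -
  have head: "F (list_of (word_of M)) = F M" if M: "M \<noteq> []" "set M \<subseteq> letters G" for M
  proof -
    obtain s x p where Mp: "M = (s, x) # p" using M(1) by (metis neq_Nil_conv surj_pair)
    show ?thesis using F4[of 1 s x p] M(2) by (simp add: Mp list_of_def word_of_def)
  qed
  have "F (list_of (word_of L)) = F (list_of (word_of L'))"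
  proof (rule eq_class_invariant[OF eq[unfolded cls_def], where F = "\<lambda>w. F (list_of w)"])
    fix u v assume u: "u \<in> topspace (word_space T G)" and v: "v \<in> topspace (word_space T G)"
      and r: "word_rel G E u v"
    from r consider "rel1 G u v" | "unit_rel E u v" by (auto simp: word_rel_def)
    then show "F (list_of u) = F (list_of v)"
    proof cases
      case 1
      then show ?thesis
      proof cases
        case (first x y p)
        then show ?thesis using F1[of "[]" 1 x y p] u by (auto simp: list_of_def topspace_word_space)
      next
        case (later z q s x y p)
        then show ?thesis using F1[of "(1, z) # q" s x y p] u
          by (auto simp: list_of_def topspace_word_space)
      qed
    next
      case 2
      then show ?thesis
      proof cases
        case (first e t x p)
        \<comment> \<open>Since t is at most 1, the junk joint 1 absorbs the joint that disappears
          with a leading unit.\<close>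
        then show ?thesis using F2[of "[]" 1 e t x p] u
          by (auto simp: list_of_def topspace_word_space max_absorb1)
      next
        case (inner e z q s t x p)
        then show ?thesis using F2[of "(1, z) # q" s e t x p] u
          by (auto simp: list_of_def topspace_word_space)
      next
        case (last e z q t)
        then show ?thesis using F3[of "(1, z) # q" t e] u
          by (auto simp: list_of_def topspace_word_space)
      qed
    qed
  qed
  then show ?thesis using head L L' by simp
qed

text \<open>
  Shrinking the joints of a word by a factor l that does not exceed the neighbouring outer joints
  is compatible with the relations: the joint next to a unit at an end of the word is absorbed.
\<close>

lemma cls_context:
  assumes eq: "c L = c L'" and L: "L \<noteq> []" "set L \<subseteq> letters G" and L': "L' \<noteq> []" "set L' \<subseteq> letters G"
    and l: "0 \<le> l" "l \<le> s" "s \<le> 1"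
    and u: "set u \<subseteq> letters G" and v: "set v \<subseteq> letters G" "v \<noteq> [] \<Longrightarrow> l \<le> fst (hd v)"
  shows "c (u @ (s, snd (hd L)) # shrink l (tl L) @ v) = c (u @ (s, snd (hd L')) # shrink l (tl L') @ v)"
proof -
  define F where "F R = c (u @ (s, snd (hd R)) # shrink l (tl R) @ v)" for R
  have pre: "F (q @ R) = c ((u @ (s, snd (hd q)) # shrink l (tl q)) @ shrink l R @ v)" if "q \<noteq> []" for q R
    using that by (simp add: F_def)
  have preset: "set (u @ (s, snd (hd q)) # shrink l (tl q)) \<subseteq> letters G" if "q \<noteq> []" "set q \<subseteq> letters G" for q
    using that u l set_shrink[of l "tl q" G] by (cases q) auto
  have "F L = F L'"
  proof (rule cls_invariant[OF eq L L'])
    fix q p :: "(real \<times> 'a) list" and r :: real and x y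
    assume *: "set q \<subseteq> letters G" "r \<in> {0..1}" "x \<in> points G" "y \<in> points G" "set p \<subseteq> letters G"
    show "F (q @ (r, x) # (0, y) # p) = F (q @ (r, mul G x y) # p)"
    proof (cases "q = []")
      case True
      then show ?thesis
        using cls_mul[OF u, of s x y "shrink l p @ v"] * l v set_shrink[of l p G] by (simp add: F_def)
    next
      case False
      then show ?thesis
        using cls_mul[OF preset[OF False *(1)], of "l * r" x y "shrink l p @ v"] * l v set_shrink[of l p G]
        by (simp add: pre mult_le_one)
    qed
  next
    fix q p :: "(real \<times> 'a) list" and r t :: real and e x
    assume *: "set q \<subseteq> letters G" "r \<in> {0..1}" "e \<in> E" "t \<in> {0..1}" "x \<in> points G" "set p \<subseteq> letters G"
    show "F (q @ (r, e) # (t, x) # p) = F (q @ (max r t, x) # p)"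
    proof (cases "q = []")
      case True
      have "l * t \<le> s" using * l mult_left_le[of t l] by simp
      then have "max s (l * t) = s" by simp
      with True show ?thesis
        using cls_unit[OF u, of s e "l * t" x "shrink l p @ v"] * l v set_shrink[of l p G]
        by (simp add: F_def mult_le_one)
    next
      case False
      have "max (l * r) (l * t) = l * max r t"
        using l(1) by (metis max_mult_distrib_left not_less)
      with False show ?thesis
        using cls_unit[OF preset[OF False *(1)], of "l * r" e "l * t" x "shrink l p @ v"] * l v set_shrink[of l p G]
        by (simp add: pre mult_le_one)
    qed
  next
    fix q :: "(real \<times> 'a) list" and t :: real and e assume *: "q \<noteq> []" "set q \<subseteq> letters G" "t \<in> {0..1}" "e \<in> E"
    have lt: "l * t \<le> l" "0 \<le> l * t" "l \<le> 1" using * l mult_left_le[of t l] by auto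
    show "F (q @ [(t, e)]) = F q"
    proof (cases v)
      case Nil
      then show ?thesis
        using cls_last[OF _ preset[OF *(1,2)], of e "l * t"] * lt pre[OF *(1), of "[]"] by (simp add: pre)
    next
      case (Cons a v')
      obtain s' y where a: "a = (s', y)" by (cases a)
      have "max (l * t) s' = s'" using v(2) Cons a lt by simp
      then show ?thesis
        using cls_unit[OF preset[OF *(1,2)], of "l * t" e s' y v'] * lt v(1) Cons a pre[OF *(1), of "[]"]
        by (simp add: pre)
    qed
  next
    fix s s' :: real and x :: 'a and p :: "(real \<times> 'a) list"
    show "F ((s, x) # p) = F ((s', x) # p)" by (simp add: F_def)
  qed
  then show ?thesis by (simp add: F_def)
qed

section \<open>The semigroup of classes\<close>

lemma points_word_sgp: "points WG = c ` {L. L \<noteq> [] \<and> set L \<subseteq> letters G}"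
proof -
  have "topspace (word_space T G) = word_of ` {L. L \<noteq> [] \<and> set L \<subseteq> letters G}"
  proof
    show "topspace (word_space T G) \<subseteq> word_of ` {L. L \<noteq> [] \<and> set L \<subseteq> letters G}"
    proof
      fix w assume "w \<in> topspace (word_space T G)"
      then show "w \<in> word_of ` {L. L \<noteq> [] \<and> set L \<subseteq> letters G}"
        using list_of_letters[of w T G] by (intro image_eqI[of _ _ "list_of w"]) auto
    qed
  qed (auto intro: word_of_in_word_space[THEN subsetD[OF subset_refl]])
  then show ?thesis
    by (simp add: word_sgp_def topspace_quotient_space cls_def image_image)
qed

lemma cls_point: "L \<noteq> [] \<Longrightarrow> set L \<subseteq> letters G \<Longrightarrow> c L \<in> points WG"
  by (auto simp: points_word_sgp)

lemma rep:
  assumes "A \<in> points WG"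
  shows "set (rep A) \<subseteq> letters G" "c (rep A) = A" "rep A \<noteq> []" "rep A = (1, snd (hd (rep A))) # tl (rep A)"
proof -
  obtain w where w: "w \<in> topspace (word_space T G)" "A = eq_class (word_space T G) (word_rel G E) w"
    using assms by (auto simp: word_sgp_def topspace_quotient_space)
  define v where "v = (SOME w. w \<in> A)"
  have v: "v \<in> A" unfolding v_def using w(2) eq_class_self by (rule_tac someI[of _ w]) auto
  then have "v \<in> topspace (word_space T G)" using eq_class_subset[OF w(1)] w(2) by auto
  then show "set (rep A) \<subseteq> letters G" using list_of_letters[of v T G] by (simp add: rep_def v_def)
  show "c (rep A) = A"
    using v eq_class_member[of v "word_space T G" "word_rel G E" w] unfolding w(2)
    by (simp add: cls_def rep_def v_def w(2))
qed (simp_all add: rep_def list_of_def)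

lemma word_cases:
  assumes "A \<in> points WG"
  shows "\<exists>x p. A = c ((1, x) # p) \<and> x \<in> points G \<and> set p \<subseteq> letters G"
proof -
  obtain a p where "rep A = (1, a) # p" using rep(4)[OF assms] by blast
  then show ?thesis using rep(1,2)[OF assms] by (intro exI[of _ a] exI[of _ p]) auto
qed

text \<open>Two uses of \<open>cls_context\<close> with \<open>l = 1\<close>: first the left factor
  varies and the right one is the context \<open>v\<close>, then the right factor varies with
  context \<open>u\<close>. The joint 1 between the factors satisfies both bounds.\<close>

lemma cls_append:
  assumes L: "L \<noteq> []" "set L \<subseteq> letters G" and L': "L' \<noteq> []" "set L' \<subseteq> letters G" and eq: "c L = c L'"
    and R: "x \<in> points G" "set p \<subseteq> letters G" and R': "y \<in> points G" "set q \<subseteq> letters G"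
    and eq': "c ((1, x) # p) = c ((1, y) # q)"
  shows "c (L @ (1, x) # p) = c (L' @ (1, y) # q)"
proof -
  obtain s a m where M: "L = (s, a) # m" using L(1) by (metis neq_Nil_conv surj_pair)
  obtain s' a' m' where M': "L' = (s', a') # m'" using L'(1) by (metis neq_Nil_conv surj_pair)
  have "c (L @ (1, x) # p) = c (L' @ (1, x) # p)"
    using cls_context[OF eq L L', of 1 1 "[]" "(1, x) # p"] R
      cls_head[of s a "m @ (1, x) # p" 1] cls_head[of s' a' "m' @ (1, x) # p" 1]
    by (auto simp: M M')
  also have "\<dots> = c (L' @ (1, y) # q)"
    using cls_context[OF eq', of 1 1 L' "[]"] R R' L' by simp
  finally show ?thesis .
qed

text \<open>By \<open>cls_append\<close> the union in \<open>class_mul\<close> is over copies of one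
  class. The right factor is displayed with junk joint 1, so that multiplying is literally
  appending.\<close>

lemma mul_cls:
  assumes L: "L \<noteq> []" "set L \<subseteq> letters G" and R: "x \<in> points G" "set p \<subseteq> letters G"
  shows "mul WG (c L) (c ((1, x) # p)) = c (L @ (1, x) # p)"
proof -
  let ?X = "word_space T G" and ?r = "word_rel G E"
  have R1: "set ((1, x) # p) \<subseteq> letters G" "(1, x) # p \<noteq> []" using R by auto
  have mem: "v \<in> topspace ?X \<and> c (list_of v) = c M" if "v \<in> c M" "M \<noteq> []" "set M \<subseteq> letters G" for v M
    using that eq_class_member[of v ?X ?r "word_of M"]
      eq_class_subset[OF word_of_in_word_space[OF that(2,3), of T], of ?r]
    by (auto simp: cls_def)
  have "eq_class ?X ?r (word_mul v w) = c (L @ (1, x) # p)" if "v \<in> c L" "w \<in> c ((1, x) # p)" for v w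
  proof -
    have v: "v \<in> topspace ?X" "c (list_of v) = c L" using mem[OF that(1) L] by auto
    have w: "w \<in> topspace ?X" "c ((1, fst w) # snd w) = c ((1, x) # p)"
      using mem[OF that(2) R1(2,1)] by (auto simp: list_of_def)
    have "word_mul v w = word_of (list_of v @ (1, fst w) # snd w)"
      by (cases v; cases w) (simp add: word_of_def list_of_def)
    moreover have "c (list_of v @ (1, fst w) # snd w) = c (L @ (1, x) # p)"
      using w(1) by (intro cls_append list_of_letters[OF v(1)] L R v w) (auto simp: topspace_word_space)
    ultimately show ?thesis by (simp add: cls_def)
  qed
  moreover have "word_of L \<in> c L" "word_of ((1, x) # p) \<in> c ((1, x) # p)"
    by (simp_all add: cls_def eq_class_self)
  ultimately show ?thesis
    unfolding word_sgp_def class_mul_def by auto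
qed

text \<open>This makes words of words available. The class of a unit is a left unit by the relation
  for the first letter and a right unit by the one for the last letter.\<close>

lemma word_sgp_unital: "unital_semigroup WG (word_units T G E)"
proof
  fix A B assume "A \<in> points WG" "B \<in> points WG"
  then obtain x p y q where A: "A = c ((1, x) # p)" "x \<in> points G" "set p \<subseteq> letters G"
    and B: "B = c ((1, y) # q)" "y \<in> points G" "set q \<subseteq> letters G" using word_cases by blast
  then have "mul WG A B = c (((1, x) # p) @ (1, y) # q)"
    using mul_cls[of "(1, x) # p" y q] by auto
  also have "\<dots> \<in> points WG" using A B by (intro cls_point) auto
  finally show "mul WG A B \<in> points WG" .
  fix C assume "C \<in> points WG"
  then obtain z r where C: "C = c ((1, z) # r)" "z \<in> points G" "set r \<subseteq> letters G"
    using word_cases by blast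
  show "mul WG (mul WG A B) C = mul WG A (mul WG B C)"
    using mul_cls[of "(1, x) # p" y q] mul_cls[of "(1, y) # q" z r]
      mul_cls[of "((1, x) # p) @ (1, y) # q" z r] mul_cls[of "(1, x) # p" y "q @ (1, z) # r"] A B C
    by auto
next
  show "word_units T G E \<subseteq> points WG"
    unfolding word_units_def using unit_point by (auto intro!: cls_point)
next
  fix U A assume "U \<in> word_units T G E" "A \<in> points WG"
  then obtain e x p where U: "e \<in> E" "U = c [(1, e)]" and A: "A = c ((1, x) # p)" "x \<in> points G" "set p \<subseteq> letters G"
    using word_cases[of A] unfolding word_units_def by blast
  show "mul WG U A = A"
    using mul_cls[of "[(1, e)]" x p] cls_unit[of "[]" 1 e 1 x p] U A unit_point[OF U(1)] by auto
  show "mul WG A U = A"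
    using mul_cls[of "(1, x) # p" e "[]"] cls_last[of "(1, x) # p" e 1] U A unit_point[OF U(1)] by auto
qed

section \<open>Evaluation of words\<close>

lemma list_eval_closed: "L \<noteq> [] \<Longrightarrow> set L \<subseteq> letters G \<Longrightarrow> list_eval G L \<in> points G"
proof (induction L rule: rev_induct)
  case (snoc a L)
  then show ?case by (cases "L = []"; cases a) (auto simp: list_eval_def mul_closed)
qed simp

lemma list_eval_snoc: "L \<noteq> [] \<Longrightarrow> list_eval G (L @ [(t, x)]) = mul G (list_eval G L) x"
  by (simp add: list_eval_def)

lemma list_eval_append:
  assumes "L \<noteq> []" "set L \<subseteq> letters G" "M \<noteq> []" "set M \<subseteq> letters G"
  shows "list_eval G (L @ M) = mul G (list_eval G L) (list_eval G M)"
  using assms(3,4)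
proof (induction M rule: rev_induct)
  case (snoc a M)
  obtain t x where a: "a = (t, x)" by (cases a)
  show ?case
  proof (cases "M = []")
    case True
    then show ?thesis using assms by (simp add: a list_eval_snoc)
  next
    case False
    then show ?thesis using snoc assms mul_assoc[of "list_eval G L" "list_eval G M" x]
        list_eval_closed[of L] list_eval_closed[of M] list_eval_snoc[of "L @ M" t x] list_eval_snoc[of M t x]
      by (simp add: a)
  qed
qed simp

lemma list_eval_cls:
  assumes "c L = c L'" "L \<noteq> []" "set L \<subseteq> letters G" "L' \<noteq> []" "set L' \<subseteq> letters G"
  shows "list_eval G L = list_eval G L'"
proof (rule cls_invariant[OF assms])
  have pre: "list_eval G (q @ M) = list_eval G (q @ M')"
    if "list_eval G M = list_eval G M'" "set q \<subseteq> letters G" "M \<noteq> []" "M' \<noteq> []" "set M \<subseteq> letters G" "set M' \<subseteq> letters G"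
    for q M M'
    using that by (cases "q = []") (simp_all add: list_eval_append)
  fix q p :: "(real \<times> 'a) list" and s :: real and x y
  assume *: "set q \<subseteq> letters G" "s \<in> {0..1}" "x \<in> points G" "y \<in> points G" "set p \<subseteq> letters G"
  show "list_eval G (q @ (s, x) # (0, y) # p) = list_eval G (q @ (s, mul G x y) # p)"
    by (rule pre) (use * mul_closed in \<open>auto simp: list_eval_def\<close>)
next
  fix q p :: "(real \<times> 'a) list" and s t :: real and e x
  assume *: "set q \<subseteq> letters G" "s \<in> {0..1}" "e \<in> E" "t \<in> {0..1}" "x \<in> points G" "set p \<subseteq> letters G"
  have "list_eval G ((s, e) # (t, x) # p) = list_eval G ((max s t, x) # p)"
    using * by (simp add: list_eval_def unit_left)
  then show "list_eval G (q @ (s, e) # (t, x) # p) = list_eval G (q @ (max s t, x) # p)"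
    using * unit_point[of e] by (cases "q = []") (simp_all add: list_eval_append max_def)
next
  fix q :: "(real \<times> 'a) list" and t :: real and e assume *: "q \<noteq> []" "set q \<subseteq> letters G" "t \<in> {0..1}" "e \<in> E"
  then show "list_eval G (q @ [(t, e)]) = list_eval G q"
    by (simp add: list_eval_snoc unit_right list_eval_closed)
qed (simp add: list_eval_def)

text \<open>All words in a class have the same value by \<open>list_eval_cls\<close>, so the image
  in the definition of \<open>eps\<close> is a singleton.\<close>

lemma eps_cls:
  assumes L: "L \<noteq> []" "set L \<subseteq> letters G"
  shows "eps G (c L) = list_eval G L"
proof -
  let ?X = "word_space T G" and ?r = "word_rel G E"
  have "word_eval G v = list_eval G L" if "v \<in> c L" for v
  proof -
    have "v \<in> topspace ?X" "c (list_of v) = c L"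
      using that eq_class_member[of v ?X ?r "word_of L"]
        eq_class_subset[OF word_of_in_word_space[OF L, of T], of ?r]
      by (auto simp: cls_def)
    then show ?thesis
      using list_eval_cls[of "list_of v" L] L list_of_letters[of v T G] word_eval_word_of[of G "list_of v"] by simp
  qed
  moreover have "word_of L \<in> c L" by (simp add: cls_def eq_class_self)
  ultimately have "word_eval G ` c L = {list_eval G L}" by (auto intro: rev_image_eqI)
  then show ?thesis by (simp add: eps_def)
qed

lemma eps_closed: "A \<in> points WG \<Longrightarrow> eps G A \<in> points G"
  using rep[of A] eps_cls[of "rep A"] list_eval_closed[of "rep A"] by simp

lemma eps_mul:
  assumes "A \<in> points WG" "B \<in> points WG"
  shows "eps G (mul WG A B) = mul G (eps G A) (eps G B)"
proof -
  obtain x p y q where "A = c ((1, x) # p)" "x \<in> points G" "set p \<subseteq> letters G"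
    and "B = c ((1, y) # q)" "y \<in> points G" "set q \<subseteq> letters G" using word_cases assms by blast
  then show ?thesis
    using mul_cls[of "(1, x) # p" y q] eps_cls[of "(1, x) # p"] eps_cls[of "(1, y) # q"]
      eps_cls[of "((1, x) # p) @ (1, y) # q"] list_eval_append[of "(1, x) # p" "(1, y) # q"]
    by simp
qed

lemma eps_unit: "U \<in> word_units T G E \<Longrightarrow> eps G U \<in> E"
  using eps_cls unit_point by (auto simp: word_units_def)

end

section \<open>Test maps into word spaces\<close>

text \<open>A continuous map from \<open>C\<close> into the product of n copies of the interval
  times \<open>X\<close>, with lists as points. The ordinary product will do, because
  \<open>C\<close> is a test space in all uses into word spaces.\<close>

definition cont_list :: "'c topology \<Rightarrow> 'a topology \<Rightarrow> nat \<Rightarrow> ('c \<Rightarrow> (real \<times> 'a) list) \<Rightarrow> bool" where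
  "cont_list C X n L \<longleftrightarrow> (\<forall>c\<in>topspace C. length (L c) = n) \<and>
     (\<forall>i<n. continuous_map C (prod_topology (top_of_set {0..1}) X) (\<lambda>c. L c ! i))"

lemma cont_list_length: "cont_list C X n L \<Longrightarrow> c \<in> topspace C \<Longrightarrow> length (L c) = n"
  by (simp add: cont_list_def)

lemma cont_list_not_Nil: "cont_list C X n L \<Longrightarrow> 0 < n \<Longrightarrow> c \<in> topspace C \<Longrightarrow> L c \<noteq> []"
  by (auto simp: cont_list_def)

lemma cont_list_set:
  assumes "cont_list C X n L" "c \<in> topspace C"
  shows "set (L c) \<subseteq> {0..1} \<times> topspace X"
proof
  fix z assume "z \<in> set (L c)"
  then obtain i where i: "i < n" "z = L c ! i"
    using cont_list_length[OF assms] by (metis in_set_conv_nth)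
  with assms have "continuous_map C (prod_topology (top_of_set {0..1}) X) (\<lambda>c. L c ! i)"
    by (simp add: cont_list_def)
  then show "z \<in> {0..1} \<times> topspace X"
    using funcset_mem[OF continuous_map_funspace assms(2)] i(2) by fastforce
qed

lemma cont_list_cong:
  assumes "cont_list C X n L" "\<And>c. c \<in> topspace C \<Longrightarrow> L' c = L c"
  shows "cont_list C X n L'"
  unfolding cont_list_def
proof (intro conjI allI impI ballI)
  fix i assume "i < n"
  then have "continuous_map C (prod_topology (top_of_set {0..1}) X) (\<lambda>c. L c ! i)"
    using assms by (simp add: cont_list_def)
  then show "continuous_map C (prod_topology (top_of_set {0..1}) X) (\<lambda>c. L' c ! i)"
    by (rule continuous_map_eq) (simp add: assms(2))
qed (use assms in \<open>auto simp: cont_list_def\<close>)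

lemma cont_list_pullback:
  assumes "cont_list C X n L" "continuous_map D C a"
  shows "cont_list D X n (\<lambda>d. L (a d))"
  unfolding cont_list_def
proof (intro conjI allI impI ballI)
  fix i assume "i < n"
  then have "continuous_map C (prod_topology (top_of_set {0..1}) X) (\<lambda>c. L c ! i)"
    using assms by (simp add: cont_list_def)
  from continuous_map_compose[OF assms(2) this]
  show "continuous_map D (prod_topology (top_of_set {0..1}) X) (\<lambda>d. L (a d) ! i)" by (simp add: o_def)
next
  fix d assume "d \<in> topspace D"
  then have "a d \<in> topspace C" using continuous_map_funspace[OF assms(2)] by auto
  then show "length (L (a d)) = n" using assms(1) by (simp add: cont_list_def)
qed

lemma cont_list_Nil: "cont_list C X 0 (\<lambda>c. [])"
  by (simp add: cont_list_def)

lemma cont_list_append: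
  assumes "cont_list C X n L" "cont_list C X m M"
  shows "cont_list C X (n + m) (\<lambda>c. L c @ M c)"
  unfolding cont_list_def
proof (intro conjI allI impI ballI)
  fix i assume i: "i < n + m"
  let ?Y = "prod_topology (top_of_set {0..1::real}) X"
  show "continuous_map C ?Y (\<lambda>c. (L c @ M c) ! i)"
  proof (cases "i < n")
    case True
    then have "continuous_map C ?Y (\<lambda>c. L c ! i)" using assms by (simp add: cont_list_def)
    then show ?thesis
      by (rule continuous_map_eq) (use True assms in \<open>simp add: cont_list_def nth_append\<close>)
  next
    case False
    then have "continuous_map C ?Y (\<lambda>c. M c ! (i - n))" using assms i by (simp add: cont_list_def)
    then show ?thesis
      by (rule continuous_map_eq) (use False assms in \<open>simp add: cont_list_def nth_append\<close>)
  qed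
qed (use assms in \<open>simp add: cont_list_def\<close>)

lemma cont_list_single:
  assumes "continuous_map C (top_of_set {0..1}) t" "continuous_map C X x"
  shows "cont_list C X 1 (\<lambda>c. [(t c, x c)])"
  using assms by (simp add: cont_list_def continuous_map_pairwise o_def)

lemma cont_list_Cons:
  assumes "continuous_map C (top_of_set {0..1}) t" "continuous_map C X x" "cont_list C X n L"
  shows "cont_list C X (Suc n) (\<lambda>c. (t c, x c) # L c)"
  using cont_list_append[OF cont_list_single[OF assms(1,2)] assms(3)] by simp

lemma cont_list_SucE:
  assumes "cont_list C X (Suc n) L"
  obtains t x M where "continuous_map C (top_of_set {0..1}) t" "continuous_map C X x"
    "cont_list C X n M" "\<And>c. c \<in> topspace C \<Longrightarrow> L c = (t c, x c) # M c"
proof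
  have L0: "continuous_map C (prod_topology (top_of_set {0..1}) X) (\<lambda>c. L c ! 0)"
    using assms by (simp add: cont_list_def)
  from continuous_map_fst_of[OF this] show "continuous_map C (top_of_set {0..1}) (\<lambda>c. fst (L c ! 0))"
    by (simp add: o_def)
  from continuous_map_snd_of[OF L0] show "continuous_map C X (\<lambda>c. snd (L c ! 0))"
    by (simp add: o_def)
  have len: "length (L c) = Suc n" if "c \<in> topspace C" for c
    using assms that by (simp add: cont_list_def)
  show "cont_list C X n (\<lambda>c. tl (L c))"
    unfolding cont_list_def
  proof (intro conjI allI impI ballI)
    fix i assume "i < n"
    then have "continuous_map C (prod_topology (top_of_set {0..1}) X) (\<lambda>c. L c ! Suc i)"
      using assms by (simp add: cont_list_def)
    then show "continuous_map C (prod_topology (top_of_set {0..1}) X) (\<lambda>c. tl (L c) ! i)"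
      by (rule continuous_map_eq) (use len \<open>i < n\<close> in \<open>simp add: nth_tl\<close>)
  qed (simp add: len)
  show "L c = (fst (L c ! 0), snd (L c ! 0)) # tl (L c)" if "c \<in> topspace C" for c
    using len[OF that] by (cases "L c") auto
qed

lemma cont_list_map:
  assumes "cont_list C X n L"
    and "\<And>t x. continuous_map C (top_of_set {0..1}) t \<Longrightarrow> continuous_map C X x \<Longrightarrow>
      continuous_map C (prod_topology (top_of_set {0..1}) Y) (\<lambda>c. f c (t c, x c))"
  shows "cont_list C Y n (\<lambda>c. map (f c) (L c))"
  unfolding cont_list_def
proof (intro conjI allI impI ballI)
  fix i assume i: "i < n"
  then have "continuous_map C (prod_topology (top_of_set {0..1}) X) (\<lambda>c. L c ! i)"
    using assms by (simp add: cont_list_def)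
  then have "continuous_map C (top_of_set {0..1}) (fst \<circ> (\<lambda>c. L c ! i))" "continuous_map C X (snd \<circ> (\<lambda>c. L c ! i))"
    by (rule continuous_map_fst_of, rule continuous_map_snd_of)
  from assms(2)[OF this]
  have "continuous_map C (prod_topology (top_of_set {0..1}) Y) (\<lambda>c. f c (L c ! i))"
    by (simp add: o_def)
  then show "continuous_map C (prod_topology (top_of_set {0..1}) Y) (\<lambda>c. map (f c) (L c) ! i)"
    by (rule continuous_map_eq) (use assms(1) i in \<open>simp add: cont_list_def\<close>)
qed (use assms in \<open>simp add: cont_list_def\<close>)

lemma cont_list_shrink:
  assumes "cont_list C X n L" "continuous_map C (top_of_set {0..1}) l"
  shows "cont_list C X n (\<lambda>c. shrink (l c) (L c))"
proof -
  have "continuous_map C (prod_topology (top_of_set {0..1}) X) (\<lambda>c. (l c * t c, x c))"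
    if "continuous_map C (top_of_set {0..1}) t" "continuous_map C X x" for t x
    using that assms(2)
    by (auto simp: continuous_map_pairwise o_def continuous_map_in_subtopology mult_le_one Pi_iff
        intro!: continuous_map_real_mult)
  then show ?thesis unfolding shrink_def
    using cont_list_map[OF assms(1), of X "\<lambda>c (t, x). (l c * t, x)"] by simp
qed

section \<open>Continuity into and out of word spaces\<close>

lemma continuous_map_word_of:
  fixes T :: "'c itself" and C :: "'c topology"
  assumes C: "compact_space C" "Hausdorff_space C" and L: "cont_list C (space_of G) (Suc n) L"
  shows "continuous_map C (word_space T G) (\<lambda>c. word_of (L c))"
proof -
  obtain t x M where t: "continuous_map C (top_of_set {0..1}) t" and x: "continuous_map C (space_of G) x"
    and M: "cont_list C (space_of G) n M" and LM: "\<And>c. c \<in> topspace C \<Longrightarrow> L c = (t c, x c) # M c"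
    using cont_list_SucE[OF L] by metis
  have len: "length (M c) = n" if "c \<in> topspace C" for c using M that by (simp add: cont_list_def)
  let ?Y = "prod_topology (space_of G)
        (product_topology (\<lambda>_. prod_topology (top_of_set {0..1::real}) (space_of G)) {..<n})"
  let ?f = "\<lambda>(x, p). (x, restrict (nth p) {..<n})"
  have "continuous_map C ?Y (?f \<circ> (\<lambda>c. (x c, M c)))"
    using x M by (auto simp: continuous_map_pairwise o_def continuous_map_componentwise cont_list_def)
  then have "continuous_map C (pullback_topology {w. length (snd w) = n} ?f ?Y) (\<lambda>c. (x c, M c))"
    by (rule continuous_map_pullback') (use len in auto)
  then have "test_map C (word_summand T G n) (\<lambda>c. (x c, M c))"
    unfolding word_summand_def test_map_kify using C by (simp add: test_map_def)
  then have 1: "continuous_map C (word_summand T G n) (\<lambda>c. (x c, M c))" by (simp add: test_map_def)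
  have "continuous_map C (word_space T G) (\<lambda>c. (x c, M c))"
    unfolding continuous_map_def
  proof (intro conjI allI impI)
    show "(\<lambda>c. (x c, M c)) \<in> topspace C \<rightarrow> topspace (word_space T G)"
      using 1 unfolding topspace_word_space continuous_map_def topspace_word_summand by auto
    fix U assume "openin (word_space T G) U"
    then have "openin (word_summand T G n) {w \<in> U. length (snd w) = n}"
      unfolding openin_word_space by blast
    then have "openin C {c \<in> topspace C. (x c, M c) \<in> {w \<in> U. length (snd w) = n}}"
      using 1 unfolding continuous_map_def by blast
    moreover have "{c \<in> topspace C. (x c, M c) \<in> {w \<in> U. length (snd w) = n}} = {c \<in> topspace C. (x c, M c) \<in> U}"
      using len by auto
    ultimately show "openin C {c \<in> topspace C. (x c, M c) \<in> U}" by simp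
  qed
  then show ?thesis
    by (rule continuous_map_eq) (simp add: LM word_of_def)
qed

lemma openin_word_space_slice:
  assumes "openin (word_summand T G n) U"
  shows "openin (word_space T G) U"
  unfolding openin_word_space
proof
  fix m
  have "U \<subseteq> {w. length (snd w) = n}"
    using openin_subset[OF assms] unfolding topspace_word_summand by auto
  then have "{w \<in> U. length (snd w) = m} = (if m = n then U else {})" by auto
  then show "openin (word_summand T G m) {w \<in> U. length (snd w) = m}" using assms by simp
qed

text \<open>The summands are k-ified, and k-openness passes to each of them because a test map into
  a summand is also a test map into the coproduct.\<close>

lemma kspace_word_space:
  fixes T :: "'c itself"
  shows "kspace T (word_space T G)"
  unfolding kspace_def
proof (intro allI impI)
  fix U assume U: "k_open T (word_space T G) U"
  show "openin (word_space T G) U"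
    unfolding openin_word_space
  proof
    fix n
    have "k_open T (word_summand T G n) {w \<in> U. length (snd w) = n}"
      unfolding k_open_def
    proof (intro conjI allI impI)
      show "{w \<in> U. length (snd w) = n} \<subseteq> topspace (word_summand T G n)"
        using U unfolding k_open_def topspace_word_space topspace_word_summand by auto
      fix C :: "'c topology" and h assume h: "test_map C (word_summand T G n) h"
      have hn: "length (snd (h c)) = n" if "c \<in> topspace C" for c
        using h that unfolding test_map_def continuous_map_def topspace_word_summand by auto
      have "test_map C (word_space T G) h"
        unfolding test_map_def continuous_map_def
      proof (intro conjI allI impI)
        show "h \<in> topspace C \<rightarrow> topspace (word_space T G)"
          using h unfolding test_map_def continuous_map_def topspace_word_summand topspace_word_space by auto
        fix V assume "openin (word_space T G) V"
        then have "openin C {c \<in> topspace C. h c \<in> {w \<in> V. length (snd w) = n}}"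
          using h unfolding openin_word_space test_map_def continuous_map_def by blast
        moreover have "{c \<in> topspace C. h c \<in> {w \<in> V. length (snd w) = n}} = {c \<in> topspace C. h c \<in> V}"
          using hn by auto
        ultimately show "openin C {c \<in> topspace C. h c \<in> V}" by simp
      qed (use h in \<open>auto simp: test_map_def\<close>)
      then have "openin C {c \<in> topspace C. h c \<in> U}" using U unfolding k_open_def by blast
      moreover have "{c \<in> topspace C. h c \<in> {w \<in> U. length (snd w) = n}} = {c \<in> topspace C. h c \<in> U}"
        using hn by auto
      ultimately show "openin C {c \<in> topspace C. h c \<in> {w \<in> U. length (snd w) = n}}" by simp
    qed
    then show "openin (word_summand T G n) {w \<in> U. length (snd w) = n}"
      using kspace_kify unfolding word_summand_def kspace_def by blast
  qed
qed

text \<open>A test map into the word space is decomposed into clopen parts of constant length.\<close>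

lemma continuous_map_from_words:
  fixes T :: "'c itself" and C :: "'c topology"
  assumes C: "compact_space C" "Hausdorff_space C" and w: "continuous_map C (word_space T G) w"
    and F: "\<And>(D :: 'c topology) n. compact_space D \<Longrightarrow> Hausdorff_space D \<Longrightarrow> continuous_map D C id \<Longrightarrow>
      cont_list D (space_of G) (Suc n) (\<lambda>c. list_of (w c)) \<Longrightarrow> continuous_map D Y F"
  shows "continuous_map C Y F"
proof -
  define S where "S n = {c \<in> topspace C. length (snd (w c)) = n}" for n
  have wt: "w c \<in> topspace (word_space T G)" if "c \<in> topspace C" for c
    using w that by (auto simp: continuous_map_def)
  have S: "openin C (S n)" for n
  proof -
    have "openin (word_space T G) (topspace (word_summand T G n))"
      by (rule openin_word_space_slice[of T G n]) simp
    then have "openin C {c \<in> topspace C. w c \<in> topspace (word_summand T G n)}"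
      using w by (simp add: continuous_map_def)
    moreover have "{c \<in> topspace C. w c \<in> topspace (word_summand T G n)} = S n"
      using wt unfolding topspace_word_space topspace_word_summand S_def by auto
    ultimately show ?thesis by simp
  qed
  have cover: "topspace C = (\<Union>n. S n)" by (auto simp: S_def)
  have cl: "closedin C (S n)" for n
  proof -
    have "topspace C - S n = (\<Union>m\<in>- {n}. S m)" by (auto simp: S_def)
    then have "openin C (topspace C - S n)" using S by auto
    then show ?thesis by (auto simp: closedin_def S_def)
  qed
  have part: "continuous_map (subtopology C (S n)) Y F" for n
  proof (rule F)
    let ?D = "subtopology C (S n)"
    show D: "compact_space ?D" "Hausdorff_space ?D"
      using C cl[of n] by (simp_all add: closedin_compact_space compact_space_subtopology Hausdorff_space_subtopology)
    show "continuous_map ?D C id" by (simp add: continuous_map_from_subtopology)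
    have top: "topspace ?D = S n" by (auto simp: S_def)
    have "continuous_map ?D (word_summand T G n) w"
      unfolding continuous_map_def
    proof (intro conjI allI impI)
      show "w \<in> topspace ?D \<rightarrow> topspace (word_summand T G n)"
        using wt unfolding topspace_word_space topspace_word_summand by (auto simp: S_def)
      fix U assume "openin (word_summand T G n) U"
      then have "openin (word_space T G) U" by (rule openin_word_space_slice)
      then have "openin ?D {c \<in> topspace ?D. w c \<in> U}"
        using continuous_map_from_subtopology[OF w, of "S n"] by (simp add: continuous_map_def)
      then show "openin ?D {c \<in> topspace ?D. w c \<in> U}" .
    qed
    then have "test_map ?D (word_summand T G n) w" using D by (simp add: test_map_def)
    then have "continuous_map ?D (pullback_topology {w. length (snd w) = n}
      (\<lambda>(x, p). (x, restrict (nth p) {..<n})) (prod_topology (space_of G)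
        (product_topology (\<lambda>_. prod_topology (top_of_set {0..1::real}) (space_of G)) {..<n}))) w"
      (is "continuous_map _ (pullback_topology ?A ?f ?Y) _")
      unfolding word_summand_def test_map_kify by (simp add: test_map_def)
    from continuous_map_compose[OF this continuous_map_pullback[OF continuous_map_id]]
    have fw: "continuous_map ?D ?Y (?f \<circ> w)" by (simp add: id_def o_def)
    have x: "continuous_map ?D (space_of G) (\<lambda>c. fst (w c))"
      using continuous_map_fst_of[OF fw] by (simp add: o_def split_beta)
    have "continuous_map ?D (product_topology (\<lambda>_. prod_topology (top_of_set {0..1::real}) (space_of G)) {..<n})
        (\<lambda>c. restrict (nth (snd (w c))) {..<n})"
      using continuous_map_snd_of[OF fw] by (simp add: o_def split_beta)
    then have "continuous_map ?D (prod_topology (top_of_set {0..1}) (space_of G)) (\<lambda>c. snd (w c) ! i)" if "i < n" for i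
      using that unfolding continuous_map_componentwise by auto
    then have "cont_list ?D (space_of G) n (\<lambda>c. snd (w c))"
      by (simp add: cont_list_def top) (simp add: S_def)
    then show "cont_list ?D (space_of G) (Suc n) (\<lambda>c. list_of (w c))"
      unfolding list_of_def by (intro cont_list_Cons x) auto
  qed
  show ?thesis
    unfolding continuous_map_def
  proof (intro conjI allI impI)
    show "F \<in> topspace C \<rightarrow> topspace Y"
      using part cover by (auto simp: continuous_map_def Pi_iff)
    fix U assume U: "openin Y U"
    have "openin C {c \<in> topspace (subtopology C (S n)). F c \<in> U}" for n
      using part[of n] U S[of n] unfolding continuous_map_def by (blast intro: openin_trans_full)
    then have "openin C (\<Union>n. {c \<in> topspace (subtopology C (S n)). F c \<in> U})" by blast
    moreover have "(\<Union>n. {c \<in> topspace (subtopology C (S n)). F c \<in> U}) = {c \<in> topspace C. F c \<in> U}"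
      by (auto simp: S_def)
    ultimately show "openin C {c \<in> topspace C. F c \<in> U}" by simp
  qed
qed

lemma continuous_map_cls:
  fixes T :: "'c itself" and C :: "'c topology"
  assumes C: "compact_space C" "Hausdorff_space C" and L: "cont_list C (space_of G) (Suc n) L"
  shows "continuous_map C (space_of (word_sgp T G E)) (\<lambda>c. cls T G E (L c))"
  using continuous_map_compose[OF continuous_map_word_of[OF C L]
      quotient_imp_continuous_map[OF quotient_map_eq_class]]
  by (simp add: word_sgp_def cls_def o_def)

text \<open>The continuity criterion for maps out of \<open>WG\<close>: it suffices to treat
  continuous lists of constant length and to know that \<open>\<Phi>\<close> respects classes. It
  joins \<open>continuous_map_from_words\<close> with \<open>test_family_quotient\<close>.\<close>

lemma (in unital_semigroup) test_family_word_sgp: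
  fixes C :: "'c topology"
  assumes inf: "infinite (UNIV :: 'c set)" and C: "compact_space C" "Hausdorff_space C"
    and cont: "\<And>(D :: 'c topology) a L n. compact_space D \<Longrightarrow> Hausdorff_space D \<Longrightarrow> continuous_map D C a \<Longrightarrow>
      cont_list D (space_of G) (Suc n) L \<Longrightarrow> continuous_map D Y (\<lambda>d. \<Phi> (a d) (L d))"
    and inv: "\<And>x L L'. x \<in> topspace C \<Longrightarrow> c L = c L' \<Longrightarrow> L \<noteq> [] \<Longrightarrow> set L \<subseteq> letters G \<Longrightarrow>
      L' \<noteq> [] \<Longrightarrow> set L' \<subseteq> letters G \<Longrightarrow> \<Phi> x L = \<Phi> x L'"
  shows "test_family C (space_of WG) Y (\<lambda>x A. \<Phi> x (rep A))"
proof -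
  have fam: "test_family C (word_space T G) Y (\<lambda>x w. \<Phi> x (list_of w))"
    unfolding test_family_def
  proof (intro allI impI)
    fix D :: "'c topology" and a w
    assume D: "compact_space D" "Hausdorff_space D" and a: "continuous_map D C a"
      and w: "continuous_map D (word_space T G) w"
    show "continuous_map D Y (\<lambda>d. \<Phi> (a d) (list_of (w d)))"
    proof (rule continuous_map_from_words[OF D w])
      fix B :: "'c topology" and n
      assume "compact_space B" "Hausdorff_space B" and i: "continuous_map B D id"
        and "cont_list B (space_of G) (Suc n) (\<lambda>c. list_of (w c))"
      then show "continuous_map B Y (\<lambda>d. \<Phi> (a d) (list_of (w d)))"
        using cont[of B a n "\<lambda>c. list_of (w c)"] continuous_map_compose[OF i a] by simp
    qed
  qed
  have "test_family C (quotient_space (word_space T G) (word_rel G E)) Y (\<lambda>x A. \<Phi> x (rep A))"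
  proof (rule test_family_quotient[OF inf kspace_word_space C fam])
    fix x w assume x: "x \<in> topspace C" and w: "w \<in> topspace (word_space T G)"
    let ?A = "eq_class (word_space T G) (word_rel G E) w"
    have A: "?A \<in> points WG" using w by (simp add: word_sgp_def topspace_quotient_space)
    have "c (list_of w) = ?A" by (simp add: cls_def)
    then show "\<Phi> x (rep ?A) = \<Phi> x (list_of w)"
      using rep[OF A] list_of_letters[OF w] by (intro inv[OF x]) auto
  qed
  then show ?thesis by (simp add: word_sgp_def)
qed

text \<open>The multiplication is continuous on the k-product only, but a map from a test space into
  the product is also continuous into its k-ification.\<close>

lemma continuous_map_mul:
  fixes T :: "'c itself" and C :: "'c topology"
  assumes H: "topological_semigroup T H" and C: "compact_space C" "Hausdorff_space C"
    and x: "continuous_map C (space_of H) x" and y: "continuous_map C (space_of H) y"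
  shows "continuous_map C (space_of H) (\<lambda>c. mul H (x c) (y c))"
proof -
  have "test_map C (prod_topology (space_of H) (space_of H)) (\<lambda>c. (x c, y c))"
    using C x y by (simp add: test_map_def continuous_map_pairwise o_def)
  then have "continuous_map C (kprod T (space_of H) (space_of H)) (\<lambda>c. (x c, y c))"
    unfolding kprod_def by (metis test_map_kify test_map_def)
  from continuous_map_compose[OF this] H show ?thesis
    by (fastforce simp: topological_semigroup_def o_def)
qed

lemma continuous_map_list_eval:
  fixes T :: "'c itself" and C :: "'c topology"
  assumes H: "topological_semigroup T H" and C: "compact_space C" "Hausdorff_space C"
    and L: "cont_list C (space_of H) (Suc n) L"
  shows "continuous_map C (space_of H) (\<lambda>c. list_eval H (L c))"
  using L
proof (induction n arbitrary: L)
  case 0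
  obtain t x M where x: "continuous_map C (space_of H) x"
    and M: "cont_list C (space_of H) 0 M" and L: "\<And>c. c \<in> topspace C \<Longrightarrow> L c = (t c, x c) # M c"
    using cont_list_SucE[OF 0] by metis
  show ?case
    by (rule continuous_map_eq[OF x]) (use M L in \<open>simp add: cont_list_def\<close>)
next
  case (Suc n)
  obtain t x M where t: "continuous_map C (top_of_set {0..1}) t" and x: "continuous_map C (space_of H) x"
    and M: "cont_list C (space_of H) (Suc n) M" and L: "\<And>c. c \<in> topspace C \<Longrightarrow> L c = (t c, x c) # M c"
    using cont_list_SucE[OF Suc.prems] by metis
  obtain s y N where y: "continuous_map C (space_of H) y"
    and N: "cont_list C (space_of H) n N" and MN: "\<And>c. c \<in> topspace C \<Longrightarrow> M c = (s c, y c) # N c"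
    using cont_list_SucE[OF M] by metis
  \<comment> \<open>Evaluation folds from the left, so merging the first two letters leaves the
    value unchanged and shortens the list.\<close>
  have "cont_list C (space_of H) (Suc n) (\<lambda>c. (t c, mul H (x c) (y c)) # N c)"
    by (intro cont_list_Cons t N continuous_map_mul[OF H C x y])
  from Suc.IH[OF this] show ?case
    by (rule continuous_map_eq) (simp add: L MN list_eval_def)
qed

section \<open>Spaces of homomorphisms\<close>

text \<open>For singletons \<open>E\<close> and \<open>F\<close> the inclusion says that the unit
  goes to the unit; for empty sets it says nothing.\<close>

definition unital_homs :: "'a top_sgp \<Rightarrow> 'a set \<Rightarrow> 'b top_sgp \<Rightarrow> 'b set \<Rightarrow> ('a \<Rightarrow> 'b) set" where
  "unital_homs G E H F = {f \<in> sgp_homs G H. f ` E \<subseteq> F}"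

definition hom_space :: "'c itself \<Rightarrow> 'a top_sgp \<Rightarrow> 'a set \<Rightarrow> 'b top_sgp \<Rightarrow> 'b set \<Rightarrow> ('a \<Rightarrow> 'b) topology" where
  "hom_space T G E H F = kify T (subtopology (kfun T (space_of G) (space_of H)) (unital_homs G E H F))"

lemma unital_homs_subset_maps: "unital_homs G E H F \<subseteq> maps (space_of G) (space_of H)"
  by (auto simp: unital_homs_def sgp_homs_def)

lemma topspace_kfun:
  fixes T :: "'c itself"
  shows "topspace (kfun T X Y) = maps X Y"
proof -
  let ?B = "{{f \<in> maps X Y. f ` h ` topspace C \<subseteq> U} | (C :: 'c topology) h U. test_map C X h \<and> openin Y U}"
  have tr: "test_map (discrete_topology ({} :: 'c set)) X (\<lambda>c. undefined)"
    by (simp add: test_map_def compact_space_discrete_topology)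
  have "maps X Y = {f \<in> maps X Y. f ` (\<lambda>c. undefined) ` topspace (discrete_topology ({} :: 'c set)) \<subseteq> {}}"
    by auto
  then have "maps X Y \<in> ?B" using tr openin_empty[of Y] by blast
  then have "\<Union>?B = maps X Y" by blast
  then show ?thesis
    by (simp add: kfun_def compact_open_topology_def topology_generated_by_topspace)
qed

lemma topspace_hom_space: "topspace (hom_space T G E H F) = unital_homs G E H F"
  using unital_homs_subset_maps[of G E H F]
  by (simp add: hom_space_def topspace_kfun Int_absorb1)

lemma kspace_hom_space: "kspace T (hom_space T G E H F)"
  by (simp add: hom_space_def kspace_kify)

text \<open>On a test space both k-ifications disappear, the subspace becomes a pointwise condition,
  and the exponential law \<open>continuous_map_compact_open\<close> remains.\<close>

lemma continuous_map_hom_space: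
  fixes T :: "'c itself" and C :: "'c topology"
  assumes inf: "infinite (UNIV :: 'c set)" and C: "compact_space C" "Hausdorff_space C"
  shows "continuous_map C (hom_space T G E H F) \<phi> \<longleftrightarrow>
    (\<forall>c\<in>topspace C. \<phi> c \<in> unital_homs G E H F) \<and> test_family C (space_of G) (space_of H) \<phi>"
proof -
  have "continuous_map C (hom_space T G E H F) \<phi> \<longleftrightarrow>
      test_map C (subtopology (kfun T (space_of G) (space_of H)) (unital_homs G E H F)) \<phi>"
    unfolding test_map_kify[of C T "subtopology _ _", symmetric] hom_space_def[symmetric]
    using C by (simp add: test_map_def)
  also have "\<dots> \<longleftrightarrow> test_map C (kfun T (space_of G) (space_of H)) \<phi> \<and> (\<forall>c\<in>topspace C. \<phi> c \<in> unital_homs G E H F)"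
    by (auto simp: test_map_def continuous_map_in_subtopology)
  also have "\<dots> \<longleftrightarrow> continuous_map C (compact_open_topology T (space_of G) (space_of H)) \<phi> \<and>
      (\<forall>c\<in>topspace C. \<phi> c \<in> unital_homs G E H F)"
    unfolding kfun_def test_map_kify using C by (simp add: test_map_def)
  finally show ?thesis
    using continuous_map_compact_open[OF inf C, of \<phi> "space_of G" "space_of H" T] unital_homs_subset_maps
    by blast
qed

section \<open>Cutting words\<close>

text \<open>
  A word is cut at its joints t with 1/2 \<le> t. Each block, with its joints stretched from [0,1/2] to
  [0,1], is replaced by its value under h, and the joints at the cuts are stretched from [1/2,1] to
  [0,1]. The joint before the current block b is s.
\<close>

fun cuts :: "((real \<times> 'a) list \<Rightarrow> 'b) \<Rightarrow> real \<Rightarrow> (real \<times> 'a) list \<Rightarrow> (real \<times> 'a) list \<Rightarrow> (real \<times> 'b) list" where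
  "cuts h s b [] = [(s, h b)]"
| "cuts h s b ((t, x) # p) =
     (if 1/2 \<le> t then (s, h b) # cuts h (2 * t - 1) [(1, x)] p else cuts h s (b @ [(2 * t, x)]) p)"

definition cut_word :: "((real \<times> 'a) list \<Rightarrow> 'b) \<Rightarrow> (real \<times> 'a) list \<Rightarrow> (real \<times> 'b) list" where
  "cut_word h L = cuts h 1 [(1, snd (hd L))] (tl L)"

definition retime :: "real \<Rightarrow> (real \<times> 'a) list \<Rightarrow> (real \<times> 'a) list" where
  "retime l = map (\<lambda>(t, x). (min 1 ((2 - l) * t), x))"

lemma retime_simps [simp]:
  "retime l [] = []" "retime l ((t, x) # p) = (min 1 ((2 - l) * t), x) # retime l p"
  "retime l (p @ q) = retime l p @ retime l q"
  by (simp_all add: retime_def)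

lemma retime_eq_Nil [simp]: "retime l L = [] \<longleftrightarrow> L = []"
  by (simp add: retime_def)

lemma set_retime:
  assumes "l \<le> 1" "set p \<subseteq> letters G"
  shows "set (retime l p) \<subseteq> letters G"
proof
  fix z assume "z \<in> set (retime l p)"
  then obtain t x where "(t, x) \<in> set p" "z = (min 1 ((2 - l) * t), x)" by (auto simp: retime_def)
  with assms show "z \<in> letters G" by auto
qed

text \<open>The joint \<open>s\<close> is only handed on to the first output pair, so neither that
  pair's letter nor the rest depends on it. This allows a relation of the target to be applied where
  a cut occurs.\<close>

lemma cut_head: "cuts h s b p = (s, snd (hd (cuts h 1 b p))) # tl (cuts h 1 b p)"
proof (induction p arbitrary: b)
  case (Cons a p)
  obtain t x where "a = (t, x)" by (cases a)
  with Cons.IH[of "b @ [(2 * t, x)]"] show ?case by simp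
qed simp

lemma cut_eq_Nil [simp]: "cuts h s b p \<noteq> []"
  by (subst cut_head) simp

text \<open>Continuity is not part of the locale, being a property of families of maps, nor is
  extensionality. So maps such as \<open>lift_hom\<close> and composites fit without restricting
  them first.\<close>

locale word_hom = src: unital_semigroup T G E + tgt: unital_semigroup T Y F
  for T :: "'c itself" and G :: "'a top_sgp" and E and Y :: "'b top_sgp" and F +
  fixes f :: "'a word set \<Rightarrow> 'b"
  assumes f_closed: "A \<in> points (word_sgp T G E) \<Longrightarrow> f A \<in> points Y"
    and f_mul: "A \<in> points (word_sgp T G E) \<Longrightarrow> B \<in> points (word_sgp T G E) \<Longrightarrow>
      f (mul (word_sgp T G E) A B) = mul Y (f A) (f B)"
    and f_unit: "U \<in> word_units T G E \<Longrightarrow> f U \<in> F"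
begin

abbreviation h :: "(real \<times> 'a) list \<Rightarrow> 'b" where "h b \<equiv> f (src.c b)"

lemma h_closed: "b \<noteq> [] \<Longrightarrow> set b \<subseteq> letters G \<Longrightarrow> h b \<in> points Y"
  by (intro f_closed src.cls_point)

lemma h_append:
  assumes "L \<noteq> []" "set L \<subseteq> letters G" "x \<in> points G" "set p \<subseteq> letters G"
  shows "h (L @ (1, x) # p) = mul Y (h L) (h ((1, x) # p))"
  using assms f_mul[of "src.c L" "src.c ((1, x) # p)"] src.mul_cls[OF assms]
  by (simp add: src.cls_point)

lemma h_unit: "e \<in> E \<Longrightarrow> h [(t, e)] \<in> F"
  using f_unit[of "src.c [(1, e)]"] src.cls_head[of t e "[]" 1] by (simp add: word_units_def)

section \<open>Cutting respects the relations\<close>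

lemma cut_set:
  assumes "s \<in> {0..1}" "b \<noteq> []" "set b \<subseteq> letters G" "set p \<subseteq> letters G"
  shows "set (cuts h s b p) \<subseteq> letters Y"
  using assms
proof (induction p arbitrary: s b)
  case (Cons a p)
  obtain t x where a: "a = (t, x)" by (cases a)
  show ?case
    using Cons.IH[of "2 * t - 1" "[(1, x)]"] Cons.IH[of s "b @ [(2 * t, x)]"] Cons.prems
      h_closed[of b] by (simp add: a)
qed (simp add: h_closed)

lemma cut_word_set: "L \<noteq> [] \<Longrightarrow> set L \<subseteq> letters G \<Longrightarrow> set (cut_word h L) \<subseteq> letters Y"
  unfolding cut_word_def by (rule cut_set) (cases L; auto)+

text \<open>After reading \<open>q\<close>, the state of the cutting is the finished output, the
  pending joint and the pending block, whatever follows. A relation that takes place after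
  \<open>q\<close> then only has to be compared from this state on.\<close>

lemma cut_split:
  assumes "s \<in> {0..1}" "b \<noteq> []" "set b \<subseteq> letters G" "set q \<subseteq> letters G"
  shows "\<exists>out s' b'. set out \<subseteq> letters Y \<and> s' \<in> {0..1} \<and> b' \<noteq> [] \<and> set b' \<subseteq> letters G \<and>
    (\<forall>p. cuts h s b (q @ p) = out @ cuts h s' b' p)"
  using assms
proof (induction q arbitrary: s b)
  case Nil
  then show ?case by (intro exI[of _ "[]"] exI[of _ s] exI[of _ b]) auto
next
  case (Cons a q)
  obtain t x where a: "a = (t, x)" by (cases a)
  show ?case
  proof (cases "1/2 \<le> t")
    case True
    obtain out s' b' where "set out \<subseteq> letters Y" "s' \<in> {0..1}" "b' \<noteq> []" "set b' \<subseteq> letters G"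
      "\<forall>p. cuts h (2 * t - 1) [(1, x)] (q @ p) = out @ cuts h s' b' p"
      using Cons.IH[of "2 * t - 1" "[(1, x)]"] Cons.prems True by (auto simp: a)
    then show ?thesis
      using True Cons.prems h_closed[of b]
      by (intro exI[of _ "(s, h b) # out"] exI[of _ s'] exI[of _ b']) (auto simp: a)
  next
    case False
    then show ?thesis
      using Cons.IH[of s "b @ [(2 * t, x)]"] Cons.prems by (simp add: a)
  qed
qed

lemma cut_word_split:
  assumes "q \<noteq> []" "set q \<subseteq> letters G"
  obtains out s' b' where "set out \<subseteq> letters Y" "s' \<in> {0..1}" "b' \<noteq> []" "set b' \<subseteq> letters G"
    "\<And>p. cut_word h (q @ p) = out @ cuts h s' b' p"
proof -
  obtain s x r where q: "q = (s, x) # r" using assms(1) by (metis neq_Nil_conv surj_pair)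
  show ?thesis
    using cut_split[of 1 "[(1, x)]" r] assms that by (auto simp: q cut_word_def)
qed

text \<open>The hypothesis ranges over all continuations \<open>q\<close> because the block may
  still grow before it is evaluated; equality of the classes of \<open>b\<close> and
  \<open>b'\<close> alone would not carry through the induction.\<close>

lemma cut_block:
  assumes "\<And>q. set q \<subseteq> letters G \<Longrightarrow> src.c (b @ q) = src.c (b' @ q)" "set p \<subseteq> letters G"
  shows "cuts h s b p = cuts h s b' p"
  using assms
proof (induction p arbitrary: b b')
  case Nil
  then show ?case using Nil(1)[of "[]"] by simp
next
  case (Cons a p)
  obtain t x where a: "a = (t, x)" by (cases a)
  show ?case
  proof (cases "1/2 \<le> t")
    case True
    then show ?thesis using Cons.prems(1)[of "[]"] by (simp add: a)
  next
    case False
    have "cuts h s (b @ [(2 * t, x)]) p = cuts h s (b' @ [(2 * t, x)]) p"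
    proof (rule Cons.IH)
      show "src.c ((b @ [(2 * t, x)]) @ q) = src.c ((b' @ [(2 * t, x)]) @ q)" if "set q \<subseteq> letters G" for q
        using Cons.prems(1)[of "(2 * t, x) # q"] Cons.prems(2) that False by (simp add: a)
    qed (use Cons.prems in simp)
    with False show ?thesis by (simp add: a)
  qed
qed

text \<open>A joint 1 inside a block becomes a product under \<open>h\<close>, since
  \<open>f\<close> is a homomorphism. So the first output letter factors as \<open>h b\<close> times
  the letter \<open>y\<close> obtained by starting a new block at that joint. This is the uncut side
  of the gluing at t = 1/2.\<close>

lemma cut_mul:
  assumes "b \<noteq> []" "set b \<subseteq> letters G" "x \<in> points G" "set q \<subseteq> letters G" "set p \<subseteq> letters G"
    and "cuts h s' ((1, x) # q) p = (s', y) # r"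
  shows "cuts h s (b @ (1, x) # q) p = (s, mul Y (h b) y) # r"
  using assms(4-6)
proof (induction p arbitrary: q)
  case Nil
  then show ?case using h_append[OF assms(1-3) Nil(1)] by simp
next
  case (Cons a p)
  obtain t z where a: "a = (t, z)" by (cases a)
  show ?case
  proof (cases "1/2 \<le> t")
    case True
    then show ?thesis using Cons.prems h_append[OF assms(1-3) Cons.prems(1)] by (simp add: a)
  next
    case False
    then show ?thesis using Cons.prems Cons.IH[of "q @ [(2 * t, z)]"] by (simp add: a)
  qed
qed

text \<open>A relation inside a block holds in \<open>WG\<close> and does not change the value of
  the block; a unit that is a block by itself is sent by \<open>h\<close> to a unit of
  \<open>Y\<close> and is removed by a relation of the target.\<close>

lemma cut_word_cls:
  assumes eq: "src.c L = src.c L'" and L: "L \<noteq> []" "set L \<subseteq> letters G" and L': "L' \<noteq> []" "set L' \<subseteq> letters G"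
  shows "tgt.c (cut_word h L) = tgt.c (cut_word h L')"
proof (rule src.cls_invariant[OF eq L L'])
  fix q p :: "(real \<times> 'a) list" and s :: real and x y
  assume *: "set q \<subseteq> letters G" "s \<in> {0..1}" "x \<in> points G" "y \<in> points G" "set p \<subseteq> letters G"
  \<comment> \<open>The joint 0 is never a cut, so relation (1) always stays inside a block, and
    even the output lists agree.\<close>
  have blk: "cuts h s' (b @ [(r, x), (0, y)]) p = cuts h s' (b @ [(r, mul G x y)]) p"
    if "set b \<subseteq> letters G" "r \<in> {0..1}" for s' b r
  proof (rule cut_block[OF _ *(5)])
    fix q assume "set q \<subseteq> letters G"
    then show "src.c ((b @ [(r, x), (0, y)]) @ q) = src.c ((b @ [(r, mul G x y)]) @ q)"
      using src.cls_mul[of b r x y q] that * by simp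
  qed
  have "cut_word h (q @ (s, x) # (0, y) # p) = cut_word h (q @ (s, mul G x y) # p)"
  proof (cases "q = []")
    case True
    then show ?thesis using blk[of "[]" 1 1] by (simp add: cut_word_def)
  next
    case False
    then obtain out s' b where b: "b \<noteq> []" "set b \<subseteq> letters G"
      and split: "\<And>p. cut_word h (q @ p) = out @ cuts h s' b p"
      using cut_word_split[OF False *(1)] by metis
    show ?thesis
      using blk[of b "2 * s" s'] blk[of "[]" 1 "2 * s - 1"] b * by (simp add: split)
  qed
  then show "tgt.c (cut_word h (q @ (s, x) # (0, y) # p)) = tgt.c (cut_word h (q @ (s, mul G x y) # p))"
    by simp
next
  fix q p :: "(real \<times> 'a) list" and s t :: real and e x
  assume *: "set q \<subseteq> letters G" "s \<in> {0..1}" "e \<in> E" "t \<in> {0..1}" "x \<in> points G" "set p \<subseteq> letters G"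
  have e: "e \<in> points G" by (rule src.unit_point[OF *(3)])
  have he: "h [(1, e)] \<in> F" by (rule h_unit[OF *(3)])
  have blk: "cuts h s' (b @ [(r, e), (r', x)]) p = cuts h s' (b @ [(max r r', x)]) p"
    if "set b \<subseteq> letters G" "r \<in> {0..1}" "r' \<in> {0..1}" for s' b r r'
  proof (rule cut_block[OF _ *(6)])
    fix q assume "set q \<subseteq> letters G"
    then show "src.c ((b @ [(r, e), (r', x)]) @ q) = src.c ((b @ [(max r r', x)]) @ q)"
      using src.cls_unit[of b r e r' x q] that * by simp
  qed
  define y r where "y = snd (hd (cuts h 1 [(1, x)] p))" and "r = tl (cuts h 1 [(1, x)] p)"
  have hd: "cuts h s' [(1, x)] p = (s', y) # r" for s' unfolding y_def r_def by (rule cut_head)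
  have yr: "y \<in> points Y" "set r \<subseteq> letters Y"
    using cut_set[of 1 "[(1, x)]" p] * hd[of 1] by auto
  show "tgt.c (cut_word h (q @ (s, e) # (t, x) # p)) = tgt.c (cut_word h (q @ (max s t, x) # p))"
  proof (cases "q = []")
    case True
    show ?thesis
    proof (cases "1/2 \<le> t")
      case True
      then have "max 1 (2 * t - 1) = 1" using * by simp
      then show ?thesis
        using tgt.cls_unit[of "[]" 1 "h [(1, e)]" "2 * t - 1" y r] True \<open>q = []\<close> yr he *
        by (simp add: cut_word_def hd)
    next
      case False
      then have "max 1 (2 * t) = 1" using * by simp
      then show ?thesis using blk[of "[]" 1 "2 * t" 1] \<open>q = []\<close> False * by (simp add: cut_word_def)
    qed
  next
    case False
    then obtain out s' b where out: "set out \<subseteq> letters Y" "s' \<in> {0..1}" and b: "b \<noteq> []" "set b \<subseteq> letters G"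
      and split: "\<And>p. cut_word h (q @ p) = out @ cuts h s' b p"
      using cut_word_split[OF False *(1)] by metis
    have hb: "h b \<in> points Y" by (rule h_closed[OF b])
    \<comment> \<open>No cut: the unit lies inside a block. A cut only at t: it ends a block. A cut
      only at s: it starts a block, whose junk joint 1 absorbs 2t. Two cuts: it is a block of its
      own.\<close>
    consider "s < 1/2" "t < 1/2" | "s < 1/2" "1/2 \<le> t" | "1/2 \<le> s" "t < 1/2" | "1/2 \<le> s" "1/2 \<le> t"
      by linarith
    then show ?thesis
    proof cases
      case 1
      have "max (2 * s) (2 * t) = 2 * max s t" "\<not> 1/2 \<le> max s t" using 1 by (simp_all add: max_def)
      then show ?thesis using 1 blk[of b "2 * s" "2 * t" s'] b * by (simp add: split)
    next
      case 2
      then have "max s t = t" by simp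
      moreover have "h (b @ [(2 * s, e)]) = h b" using src.cls_last[OF b *(3), of "2 * s"] 2 * by simp
      ultimately show ?thesis using 2 by (simp add: split)
    next
      case 3
      then have "max s t = s" "max 1 (2 * t) = 1" by simp_all
      then show ?thesis using 3 blk[of "[]" 1 "2 * t" "2 * s - 1"] * by (simp add: split)
    next
      case 4
      then have m: "max (2 * s - 1) (2 * t - 1) = 2 * max s t - 1" "1/2 \<le> max s t" by (simp_all add: max_def)
      then show ?thesis
        using 4 tgt.cls_unit[of "out @ [(s', h b)]" "2 * s - 1" "h [(1, e)]" "2 * t - 1" y r] out hb yr he *
        by (simp add: split hd)
    qed
  qed
next
  fix q :: "(real \<times> 'a) list" and t :: real and e
  assume *: "q \<noteq> []" "set q \<subseteq> letters G" "t \<in> {0..1}" "e \<in> E"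
  obtain out s' b where out: "set out \<subseteq> letters Y" "s' \<in> {0..1}" and b: "b \<noteq> []" "set b \<subseteq> letters G"
    and split: "\<And>p. cut_word h (q @ p) = out @ cuts h s' b p"
    using cut_word_split[OF *(1,2)] by metis
  have q: "cut_word h q = out @ [(s', h b)]" using split[of "[]"] by simp
  show "tgt.c (cut_word h (q @ [(t, e)])) = tgt.c (cut_word h q)"
  proof (cases "1/2 \<le> t")
    case True
    then show ?thesis
      using tgt.cls_last[of "out @ [(s', h b)]" "h [(1, e)]" "2 * t - 1"] out h_closed[OF b] h_unit[OF *(4)] *
      by (simp add: split q)
  next
    case False
    then show ?thesis using src.cls_last[OF b *(4), of "2 * t"] * by (simp add: split q)
  qed
qed (simp add: cut_word_def)

text \<open>A cut contributes the product of \<open>h b\<close> with the value of the rest. As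
  \<open>f\<close> is a homomorphism, this is \<open>h\<close> of the blocks joined by the joint 1,
  and 1 = min 1 (2t) at a cut. Uncut joints are doubled in both descriptions.\<close>

lemma list_eval_cut:
  assumes "s \<in> {0..1}" "b \<noteq> []" "set b \<subseteq> letters G" "set p \<subseteq> letters G"
  shows "list_eval Y (cuts h s b p) = h (b @ retime 0 p)"
  using assms
proof (induction p arbitrary: s b)
  case (Cons a p)
  obtain t x where a: "a = (t, x)" by (cases a)
  show ?case
  proof (cases "1/2 \<le> t")
    case True
    have "list_eval Y ([(s, h b)] @ cuts h (2 * t - 1) [(1, x)] p) =
        mul Y (list_eval Y [(s, h b)]) (list_eval Y (cuts h (2 * t - 1) [(1, x)] p))"
      by (rule tgt.list_eval_append)
        (use Cons.prems True h_closed[of b] cut_set[of "2 * t - 1" "[(1, x)]" p] in \<open>auto simp: a\<close>)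
    also have "\<dots> = mul Y (h b) (h ((1, x) # retime 0 p))"
      using Cons.IH[of "2 * t - 1" "[(1, x)]"] Cons.prems True by (simp add: a)
    also have "\<dots> = h (b @ (1, x) # retime 0 p)"
      using h_append[of b x "retime 0 p"] Cons.prems set_retime[of 0 p G] by (simp add: a)
    finally show ?thesis using True by (simp add: a)
  next
    case False
    then show ?thesis using Cons.IH[of s "b @ [(2 * t, x)]"] Cons.prems by (simp add: a)
  qed
qed simp

lemma list_eval_cut_word:
  assumes "L \<noteq> []" "set L \<subseteq> letters G"
  shows "list_eval Y (cut_word h L) = h (retime 0 L)"
proof -
  obtain s x p where L: "L = (s, x) # p" using assms(1) by (metis neq_Nil_conv surj_pair)
  show ?thesis
    using list_eval_cut[of 1 "[(1, x)]" p] assms src.cls_head[of 1 x "retime 0 p" "min 1 (2 * s)"]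
    by (simp add: L cut_word_def)
qed

text \<open>The joint 1 is always a cut, and its outer joint 2 * 1 - 1 is again 1. This is why the
  lift preserves products.\<close>

lemma cut_word_append:
  assumes "L \<noteq> []" "set L \<subseteq> letters G"
  shows "cut_word h (L @ (1, x) # p) = cut_word h L @ cuts h 1 [(1, x)] p"
proof -
  obtain out s' b where "\<And>p. cut_word h (L @ p) = out @ cuts h s' b p"
    using cut_word_split[OF assms] by metis
  from this[of "(1, x) # p"] this[of "[]"] show ?thesis by simp
qed

end

definition lift_hom :: "'c itself \<Rightarrow> 'a top_sgp \<Rightarrow> 'a set \<Rightarrow> 'b top_sgp \<Rightarrow> 'b set \<Rightarrow>
    ('a word set \<Rightarrow> 'b) \<Rightarrow> 'a word set \<Rightarrow> 'b word set" where
  "lift_hom T G E Y F f A = cls T Y F (cut_word (\<lambda>b. f (cls T G E b)) (rep A))"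

context word_hom
begin

lemma lift_hom_cls:
  assumes "L \<noteq> []" "set L \<subseteq> letters G"
  shows "lift_hom T G E Y F f (src.c L) = tgt.c (cut_word h L)"
proof -
  have A: "src.c L \<in> points src.WG" by (rule src.cls_point[OF assms])
  show ?thesis unfolding lift_hom_def
    by (rule cut_word_cls[OF src.rep(2)[OF A] src.rep(3,1)[OF A] assms])
qed

lemma lift_hom_hom: "word_hom T G E (word_sgp T Y F) (word_units T Y F) (lift_hom T G E Y F f)"
proof (intro word_hom.intro word_hom_axioms.intro src.unital_semigroup_axioms tgt.word_sgp_unital)
  fix A assume A: "A \<in> points src.WG"
  then obtain x p where xp: "A = src.c ((1, x) # p)" "x \<in> points G" "set p \<subseteq> letters G"
    using src.word_cases by blast
  have M: "(1, x) # p \<noteq> []" "set ((1, x) # p) \<subseteq> letters G" using xp by auto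
  have cA: "lift_hom T G E Y F f A = tgt.c (cut_word h ((1, x) # p))"
    unfolding xp(1) by (rule lift_hom_cls[OF M])
  show "lift_hom T G E Y F f A \<in> points tgt.WG"
    unfolding cA by (rule tgt.cls_point) (simp add: cut_word_def, rule cut_word_set[OF M])
  fix B assume B: "B \<in> points src.WG"
  then obtain y q where yq: "B = src.c ((1, y) # q)" "y \<in> points G" "set q \<subseteq> letters G"
    using src.word_cases by blast
  have N: "(1, y) # q \<noteq> []" "set ((1, y) # q) \<subseteq> letters G" using yq by auto
  obtain z r where zr: "cuts h 1 [(1, y)] q = (1, z) # r" using cut_head by blast
  have zr': "z \<in> points Y" "set r \<subseteq> letters Y" using cut_set[of 1 "[(1, y)]" q] N zr by auto
  have "lift_hom T G E Y F f (mul src.WG A B) = lift_hom T G E Y F f (src.c (((1, x) # p) @ (1, y) # q))"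
    unfolding xp(1) yq(1) using src.mul_cls[OF M yq(2,3)] by simp
  also have "\<dots> = tgt.c (cut_word h (((1, x) # p) @ (1, y) # q))"
    by (rule lift_hom_cls) (use M N in auto)
  also have "\<dots> = tgt.c (cut_word h ((1, x) # p) @ (1, z) # r)"
    unfolding cut_word_append[OF M] zr ..
  also have "\<dots> = mul tgt.WG (tgt.c (cut_word h ((1, x) # p))) (tgt.c ((1, z) # r))"
    by (rule tgt.mul_cls[symmetric]) (use cut_word_set[OF M] zr' in \<open>auto simp: cut_word_def\<close>)
  also have "tgt.c ((1, z) # r) = lift_hom T G E Y F f B"
    unfolding yq(1) lift_hom_cls[OF N] by (simp add: cut_word_def zr)
  finally show "lift_hom T G E Y F f (mul src.WG A B) = mul tgt.WG (lift_hom T G E Y F f A) (lift_hom T G E Y F f B)"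
    unfolding cA .
next
  fix U assume "U \<in> word_units T G E"
  then obtain e where e: "e \<in> E" "U = src.c [(1, e)]" by (auto simp: word_units_def)
  then show "lift_hom T G E Y F f U \<in> word_units T Y F"
    using lift_hom_cls[of "[(1, e)]"] src.unit_point[OF e(1)] h_unit[OF e(1)]
    by (simp add: cut_word_def word_units_def)
qed

end

text \<open>Induction over the unread letters \<open>p\<close>, where \<open>u\<close> is the
  finished output, \<open>s\<close> the pending joint and \<open>b\<close> the pending block. All of
  these vary in the induction, since the next letter either extends \<open>b\<close> or moves the
  value of \<open>b\<close> into \<open>u\<close>.\<close>

lemma continuous_map_cut:
  fixes T :: "'c itself" and C :: "'c topology"
  assumes C: "compact_space C" "Hausdorff_space C"
    and f: "\<And>x. x \<in> topspace C \<Longrightarrow> word_hom T G E Y F (f x)"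
    and h: "\<And>L n. cont_list C (space_of G) (Suc n) L \<Longrightarrow> continuous_map C (space_of Y) (\<lambda>x. f x (cls T G E (L x)))"
    and u: "cont_list C (space_of Y) m u" and s: "continuous_map C (top_of_set {0..1}) s"
    and b: "cont_list C (space_of G) (Suc k) b" and p: "cont_list C (space_of G) n p"
  shows "continuous_map C (space_of (word_sgp T Y F))
    (\<lambda>x. cls T Y F (u x @ cuts (\<lambda>b. f x (cls T G E b)) (s x) (b x) (p x)))"
  using p u s b
proof (induction n arbitrary: m u s k b p)
  case 0
  have "cont_list C (space_of Y) (m + 1) (\<lambda>x. u x @ [(s x, f x (cls T G E (b x)))])"
    by (intro cont_list_append cont_list_single 0(2,3) h[OF 0(4)])
  then have "cont_list C (space_of Y) (m + 1) (\<lambda>x. u x @ cuts (\<lambda>b. f x (cls T G E b)) (s x) (b x) (p x))"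
    by (rule cont_list_cong) (use 0(1) in \<open>auto simp: cont_list_def\<close>)
  then have "cont_list C (space_of Y) (Suc m) (\<lambda>x. u x @ cuts (\<lambda>b. f x (cls T G E b)) (s x) (b x) (p x))"
    by simp
  then show ?case by (rule continuous_map_cls[OF C])
next
  case (Suc n)
  obtain t y M where t: "continuous_map C (top_of_set {0..1}) t" and y: "continuous_map C (space_of G) y"
    and M: "cont_list C (space_of G) n M" and p: "\<And>x. x \<in> topspace C \<Longrightarrow> p x = (t x, y x) # M x"
    using cont_list_SucE[OF Suc.prems(1)] by metis
  have t': "continuous_map C euclideanreal t" and t01: "\<And>x. x \<in> topspace C \<Longrightarrow> t x \<in> {0..1}"
    using t by (auto simp: continuous_map_in_subtopology)
  \<comment> \<open>Clamping defines both branches on all of \<open>C\<close>: the minimum is 2t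
    where t is at most 1/2, and the maximum is 2t - 1 where t is at least 1/2.\<close>
  have up: "continuous_map C (top_of_set {0..1}) (\<lambda>x. min 1 (2 * t x))"
    using t' t01 by (auto simp: continuous_map_in_subtopology intro!: continuous_intros)
  have down: "continuous_map C (top_of_set {0..1}) (\<lambda>x. max 0 (2 * t x - 1))"
    using t' t01 by (auto simp: continuous_map_in_subtopology intro!: continuous_intros)
  have one: "continuous_map C (top_of_set {0..1}) (\<lambda>x. 1 :: real)" by simp
  let ?h = "\<lambda>x b. f x (cls T G E b)"
  let ?F1 = "\<lambda>x. cls T Y F (u x @ cuts (?h x) (s x) (b x @ [(min 1 (2 * t x), y x)]) (M x))"
  let ?F2 = "\<lambda>x. cls T Y F ((u x @ [(s x, ?h x (b x))]) @ cuts (?h x) (max 0 (2 * t x - 1)) [(1, y x)] (M x))"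
  have "cont_list C (space_of G) (Suc k + 1) (\<lambda>x. b x @ [(min 1 (2 * t x), y x)])"
    by (intro cont_list_append cont_list_single Suc.prems up y)
  then have F1: "continuous_map C (space_of (word_sgp T Y F)) ?F1"
    using Suc.IH[OF M Suc.prems(2,3), of "Suc k"] by simp
  have "cont_list C (space_of Y) (m + 1) (\<lambda>x. u x @ [(s x, ?h x (b x))])"
    by (intro cont_list_append cont_list_single Suc.prems h[OF Suc.prems(4)])
  moreover have "cont_list C (space_of G) (Suc 0) (\<lambda>x. [(1, y x)])"
    using cont_list_single[OF one y] by simp
  ultimately have F2: "continuous_map C (space_of (word_sgp T Y F)) ?F2"
    by (rule Suc.IH[OF M _ down])
  have agree: "?F2 x = ?F1 x" if x: "x \<in> topspace C" and tx: "1/2 = t x" for x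
  proof -
    interpret word_hom T G E Y F "f x" by (rule f[OF x])
    note valid = cont_list_set[OF _ x] cont_list_not_Nil[OF _ _ x]
    have b: "set (b x) \<subseteq> letters G" "b x \<noteq> []" and u: "set (u x) \<subseteq> letters Y" and Mx: "set (M x) \<subseteq> letters G"
      using valid Suc.prems M by blast+
    have yx: "y x \<in> points G" and sx: "s x \<in> {0..1}"
      using funcset_mem[OF continuous_map_funspace x] y Suc.prems(3) by fastforce+
    obtain z r where zr: "cuts h 0 [(1, y x)] (M x) = (0, z) # r" using cut_head by blast
    have zr': "z \<in> points Y" "set r \<subseteq> letters Y" using cut_set[of 0 "[(1, y x)]" "M x"] yx Mx zr by auto
    \<comment> \<open>Without the cut, \<open>cut_mul\<close> produces one letter that is a product;
      with the cut, the two factors are separated by the joint 0, so relation (1) identifies the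
      results.\<close>
    have "cuts h (s x) (b x @ [(1, y x)]) (M x) = (s x, mul Y (h (b x)) z) # r"
      by (rule cut_mul[OF b(2,1) yx _ Mx zr]) simp
    then show ?thesis
      using tgt.cls_mul[OF u sx h_closed[OF b(2,1)] zr'] tx zr by (simp flip: tx)
  qed
  have "continuous_map C (space_of (word_sgp T Y F)) (\<lambda>x. if 1/2 \<le> t x then ?F2 x else ?F1 x)"
  proof (rule continuous_map_cases_le)
    show "continuous_map (subtopology C {x \<in> topspace C. 1/2 \<le> t x}) (space_of (word_sgp T Y F)) ?F2"
      by (rule continuous_map_from_subtopology[OF F2])
    show "continuous_map (subtopology C {x \<in> topspace C. t x \<le> 1/2}) (space_of (word_sgp T Y F)) ?F1"
      by (rule continuous_map_from_subtopology[OF F1])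
  qed (use t' agree in auto)
  then show ?case
    by (rule continuous_map_eq) (use p in \<open>auto simp: max_def min_def\<close>)
qed

lemma test_family_lift_hom:
  fixes T :: "'c itself" and C :: "'c topology"
  assumes inf: "infinite (UNIV :: 'c set)"
    and G: "unital_semigroup G E"
    and C: "compact_space C" "Hausdorff_space C"
    and f: "\<And>x. x \<in> topspace C \<Longrightarrow> word_hom T G E Y F (f x)"
    and fam: "test_family C (space_of (word_sgp T G E)) (space_of Y) f"
  shows "test_family C (space_of (word_sgp T G E)) (space_of (word_sgp T Y F)) (\<lambda>x. lift_hom T G E Y F (f x))"
proof -
  interpret src: unital_semigroup T G E by (rule G)
  let ?\<Phi> = "\<lambda>x L. cls T Y F (cut_word (\<lambda>b. f x (cls T G E b)) L)"
  have "test_family C (space_of src.WG) (space_of (word_sgp T Y F)) (\<lambda>x A. ?\<Phi> x (rep A))"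
  proof (rule src.test_family_word_sgp[OF inf C])
    fix D :: "'c topology" and a L n
    assume D: "compact_space D" "Hausdorff_space D" and a: "continuous_map D C a"
      and L: "cont_list D (space_of G) (Suc n) L"
    obtain t y M where y: "continuous_map D (space_of G) y"
      and M: "cont_list D (space_of G) n M" and LM: "\<And>x. x \<in> topspace D \<Longrightarrow> L x = (t x, y x) # M x"
      using cont_list_SucE[OF L] by metis
    have one: "continuous_map D (top_of_set {0..1}) (\<lambda>x. 1 :: real)" by simp
    have "continuous_map D (space_of (word_sgp T Y F))
      (\<lambda>d. cls T Y F ([] @ cuts (\<lambda>b. f (a d) (cls T G E b)) 1 [(1, y d)] (M d)))"
    proof (rule continuous_map_cut[OF D _ _ cont_list_Nil one _ M])
      show "word_hom T G E Y F (f (a d))" if "d \<in> topspace D" for d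
        using f[of "a d"] funcset_mem[OF continuous_map_funspace[OF a] that] by simp
      show "cont_list D (space_of G) (Suc 0) (\<lambda>d. [(1, y d)])"
        using cont_list_single[OF one y] by simp
      fix N k assume "cont_list D (space_of G) (Suc k) N"
      then show "continuous_map D (space_of Y) (\<lambda>d. f (a d) (cls T G E (N d)))"
        by (intro test_familyD[OF fam D a] continuous_map_cls[OF D])
    qed
    then show "continuous_map D (space_of (word_sgp T Y F)) (\<lambda>d. ?\<Phi> (a d) (L d))"
      by (rule continuous_map_eq) (simp add: LM cut_word_def)
  next
    fix x L L' assume x: "x \<in> topspace C" and LL: "src.c L = src.c L'" "L \<noteq> []" "set L \<subseteq> letters G"
      "L' \<noteq> []" "set L' \<subseteq> letters G"
    interpret word_hom T G E Y F "f x" by (rule f[OF x])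
    show "?\<Phi> x L = ?\<Phi> x L'" by (rule cut_word_cls[OF LL])
  qed
  then show ?thesis unfolding lift_hom_def .
qed

section \<open>Retiming and flattening\<close>

context unital_semigroup
begin

text \<open>The map t \<mapsto> min 1 ((2 - l) t) fixes 0, as relation (1) requires, and is
  monotone, so it commutes with the maximum in relation (2).\<close>

lemma cls_retime:
  assumes l: "l \<in> {0..1}"
    and eq: "c L = c L'" and L: "L \<noteq> []" "set L \<subseteq> letters G" and L': "L' \<noteq> []" "set L' \<subseteq> letters G"
  shows "c (retime l L) = c (retime l L')"
proof (rule cls_invariant[OF eq L L'])
  note set = set_retime[of l _ G]
  fix q p :: "(real \<times> 'a) list" and s :: real and x y
  assume *: "set q \<subseteq> letters G" "s \<in> {0..1}" "x \<in> points G" "y \<in> points G" "set p \<subseteq> letters G"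
  show "c (retime l (q @ (s, x) # (0, y) # p)) = c (retime l (q @ (s, mul G x y) # p))"
    using cls_mul[of "retime l q" "min 1 ((2 - l) * s)" x y "retime l p"] * l set by simp
next
  note set = set_retime[of l _ G]
  fix q p :: "(real \<times> 'a) list" and s t :: real and e x
  assume *: "set q \<subseteq> letters G" "s \<in> {0..1}" "e \<in> E" "t \<in> {0..1}" "x \<in> points G" "set p \<subseteq> letters G"
  have "(2 - l) * max s t = max ((2 - l) * s) ((2 - l) * t)"
    using l by (simp add: max_mult_distrib_left)
  then have "max (min 1 ((2 - l) * s)) (min 1 ((2 - l) * t)) = min 1 ((2 - l) * max s t)" by simp
  then show "c (retime l (q @ (s, e) # (t, x) # p)) = c (retime l (q @ (max s t, x) # p))"
    using cls_unit[of "retime l q" "min 1 ((2 - l) * s)" e "min 1 ((2 - l) * t)" x "retime l p"] * l set by simp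
next
  fix q :: "(real \<times> 'a) list" and t :: real and e
  assume *: "q \<noteq> []" "set q \<subseteq> letters G" "t \<in> {0..1}" "e \<in> E"
  then show "c (retime l (q @ [(t, e)])) = c (retime l q)"
    using cls_last[of "retime l q" e "min 1 ((2 - l) * t)"] l set_retime[of l q G] by simp
next
  fix s s' :: real and x :: 'a and p :: "(real \<times> 'a) list"
  show "c (retime l ((s, x) # p)) = c (retime l ((s', x) # p))"
    by simp (rule cls_head)
qed

end

definition retime_class :: "'c itself \<Rightarrow> 'a top_sgp \<Rightarrow> 'a set \<Rightarrow> real \<Rightarrow> 'a word set \<Rightarrow> 'a word set" where
  "retime_class T G E l A = cls T G E (retime l (rep A))"

text \<open>
  Flattening of words in words. The inner joints are multiplied by l and an outer joint s becomes
  max s l, so for l = 0 every inner word is collapsed to its value, and for l = 1 the inner words are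
  multiplied.
\<close>

definition flat :: "real \<Rightarrow> (real \<times> 'a word set) list \<Rightarrow> (real \<times> 'a) list" where
  "flat l R = concat (map (\<lambda>(s, A). (max s l, snd (hd (rep A))) # shrink l (tl (rep A))) R)"

definition flatten :: "'c itself \<Rightarrow> 'a top_sgp \<Rightarrow> 'a set \<Rightarrow> real \<Rightarrow> 'a word set word set \<Rightarrow> 'a word set" where
  "flatten T G E l B = cls T G E (flat l (rep B))"

lemma flat_simps [simp]:
  "flat l [] = []"
  "flat l ((s, A) # R) = (max s l, snd (hd (rep A))) # shrink l (tl (rep A)) @ flat l R"
  "flat l (Q @ R) = flat l Q @ flat l R"
  by (simp_all add: flat_def)

lemma flat_eq_Nil [simp]: "flat l R = [] \<longleftrightarrow> R = []"
  by (cases R) auto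

text \<open>The bound that \<open>cls_context\<close> asks of the joint following an inner word; it
  is the purpose of the maximum in \<open>flat\<close>.\<close>

lemma le_hd_flat: "flat l R \<noteq> [] \<Longrightarrow> l \<le> fst (hd (flat l R))"
  by (cases R) auto

context unital_semigroup
begin

section \<open>Retiming on classes\<close>

lemma retime_class_cls:
  assumes l: "l \<in> {0..1}" and L: "L \<noteq> []" "set L \<subseteq> letters G"
  shows "retime_class T G E l (c L) = c (retime l L)"
proof -
  have A: "c L \<in> points WG" by (rule cls_point[OF L])
  show ?thesis unfolding retime_class_def by (rule cls_retime[OF l rep(2,3,1)[OF A] L])
qed

lemma retime_class_closed:
  assumes l: "l \<in> {0..1}" and A: "A \<in> points WG"
  shows "retime_class T G E l A \<in> points WG"
  unfolding retime_class_def using rep[OF A] set_retime[of l "rep A" G] l by (intro cls_point) auto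

lemma retime_class_mul:
  assumes l: "l \<in> {0..1}" and A: "A \<in> points WG" and B: "B \<in> points WG"
  shows "retime_class T G E l (mul WG A B) = mul WG (retime_class T G E l A) (retime_class T G E l B)"
proof -
  obtain x p where xp: "A = c ((1, x) # p)" "x \<in> points G" "set p \<subseteq> letters G" using word_cases[OF A] by blast
  obtain y q where yq: "B = c ((1, y) # q)" "y \<in> points G" "set q \<subseteq> letters G" using word_cases[OF B] by blast
  have "retime_class T G E l (mul WG A B) = c (retime l (((1, x) # p) @ (1, y) # q))"
    unfolding xp(1) yq(1) using mul_cls[of "(1, x) # p" y q] xp yq by (simp add: retime_class_cls[OF l])
  also have "\<dots> = c (((1, x) # retime l p) @ (1, y) # retime l q)" using l by simp
  also have "\<dots> = mul WG (c ((1, x) # retime l p)) (c ((1, y) # retime l q))"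
    using l xp yq set_retime[of l p G] set_retime[of l q G] by (intro mul_cls[symmetric]) auto
  finally show ?thesis
    unfolding xp(1) yq(1) using l xp yq retime_class_cls[OF l, of "(1, x) # p"] retime_class_cls[OF l, of "(1, y) # q"]
    by simp
qed

lemma retime_class_unit:
  assumes l: "l \<in> {0..1}" and U: "U \<in> word_units T G E"
  shows "retime_class T G E l U = U"
proof -
  obtain e where e: "e \<in> E" "U = c [(1, e)]" using U by (auto simp: word_units_def)
  then show ?thesis using l unit_point[OF e(1)] retime_class_cls[OF l, of "[(1, e)]"] by simp
qed

lemma retime_class_1:
  assumes A: "A \<in> points WG"
  shows "retime_class T G E 1 A = A"
proof -
  have "retime 1 L = L" if "set L \<subseteq> letters G" for L
    using that by (induction L) (auto simp: min_def)
  then show ?thesis unfolding retime_class_def using rep(1,2)[OF A] by simp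
qed

section \<open>Flattening on classes\<close>

lemma set_flat:
  assumes "l \<in> {0..1}" "set R \<subseteq> letters WG"
  shows "set (flat l R) \<subseteq> letters G"
  using assms(2)
proof (induction R)
  case (Cons a R)
  obtain s A where a: "a = (s, A)" by (cases a)
  with Cons.prems have A: "A \<in> points WG" by auto
  have "snd (hd (rep A)) \<in> points G" "set (tl (rep A)) \<subseteq> letters G"
    using rep(1)[OF A] by (subst (asm) rep(4)[OF A]; auto)+
  then show ?case using Cons a assms(1) set_shrink[of l "tl (rep A)" G] by auto
qed simp

text \<open>\<open>flat\<close> uses the chosen representative of an inner class; by
  \<open>cls_context\<close> any other representative \<open>M\<close> gives the same class.\<close>

lemma flat_block:
  assumes l: "l \<in> {0..1}" and u: "set u \<subseteq> letters G" and s: "s \<in> {0..1}"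
    and M: "M \<noteq> []" "set M \<subseteq> letters G" and R: "set R \<subseteq> letters WG"
  shows "c (u @ flat l ((s, c M) # R)) = c (u @ (max s l, snd (hd M)) # shrink l (tl M) @ flat l R)"
proof -
  have A: "c M \<in> points WG" by (rule cls_point[OF M])
  show ?thesis
    using cls_context[OF rep(2,3,1)[OF A] M, of l "max s l" u "flat l R"] l s u set_flat[OF l R] le_hd_flat[of l R]
    by simp
qed

lemma cls_flat:
  assumes l: "l \<in> {0..1}" and eq: "cls T WG (word_units T G E) L = cls T WG (word_units T G E) L'"
    and L: "L \<noteq> []" "set L \<subseteq> letters WG" and L': "L' \<noteq> []" "set L' \<subseteq> letters WG"
  shows "c (flat l L) = c (flat l L')"
proof -
  interpret W: unital_semigroup T WG "word_units T G E" by (rule word_sgp_unital)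
  have l': "0 \<le> l" "l \<le> 1" using l by auto
  show ?thesis
  proof (rule W.cls_invariant[OF eq L L'])
    fix q p :: "(real \<times> 'a word set) list" and s :: real and A B
    assume *: "set q \<subseteq> letters WG" "s \<in> {0..1}" "A \<in> points WG" "B \<in> points WG" "set p \<subseteq> letters WG"
    obtain b r where B: "rep B = (1, b) # r" using rep(4)[OF *(4)] by blast
    then have br: "b \<in> points G" "set r \<subseteq> letters G" using rep(1)[OF *(4)] by auto
    \<comment> \<open>An outer joint 0 becomes max 0 l = l. The product of the inner words has the
      joint 1 at the same place, and shrinking turns this into l too.\<close>
    have "mul WG A B = c (rep A @ (1, b) # r)"
      using mul_cls[OF rep(3,1)[OF *(3)] br] rep(2)[OF *(3)] rep(2)[OF *(4)] by (simp add: B)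
    then have "c (flat l q @ flat l ((s, mul WG A B) # p)) =
        c (flat l q @ (max s l, snd (hd (rep A @ (1, b) # r))) # shrink l (tl (rep A @ (1, b) # r)) @ flat l p)"
      using flat_block[OF l set_flat[OF l *(1)] *(2), of "rep A @ (1, b) # r" p] * rep(1)[OF *(3)] br by simp
    then show "c (flat l (q @ (s, A) # (0, B) # p)) = c (flat l (q @ (s, mul WG A B) # p))"
      using rep(3)[OF *(3)] l' by (simp add: B)
  next
    fix q p :: "(real \<times> 'a word set) list" and s t :: real and U A
    assume *: "set q \<subseteq> letters WG" "s \<in> {0..1}" "U \<in> word_units T G E" "t \<in> {0..1}" "A \<in> points WG"
      "set p \<subseteq> letters WG"
    obtain e where e: "e \<in> E" "U = c [(1, e)]" using *(3) by (auto simp: word_units_def)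
    obtain a r where A: "rep A = (1, a) # r" using rep(4)[OF *(5)] by blast
    then have ar: "a \<in> points G" "set r \<subseteq> letters G" using rep(1)[OF *(5)] by auto
    have "c (flat l q @ flat l ((s, U) # (t, A) # p)) =
        c (flat l q @ (max s l, e) # (max t l, a) # shrink l r @ flat l p)"
      using flat_block[OF l set_flat[OF l *(1)] *(2), of "[(1, e)]" "(t, A) # p"] * unit_point[OF e(1)]
      by (simp add: A e(2))
    \<comment> \<open>The unit is now a letter of the flattened word and merges the two enlarged
      outer joints; taking the maximum with l commutes with this.\<close>
    also have "\<dots> = c (flat l q @ (max (max s l) (max t l), a) # shrink l r @ flat l p)"
      by (rule cls_unit) (use * l' e ar set_flat[OF l] set_shrink[of l r G] in \<open>auto simp: max_def\<close>)
    also have "max (max s l) (max t l) = max (max s t) l" by simp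
    finally show "c (flat l (q @ (s, U) # (t, A) # p)) = c (flat l (q @ (max s t, A) # p))"
      by (simp add: A)
  next
    fix q :: "(real \<times> 'a word set) list" and t :: real and U
    assume *: "q \<noteq> []" "set q \<subseteq> letters WG" "t \<in> {0..1}" "U \<in> word_units T G E"
    obtain e where e: "e \<in> E" "U = c [(1, e)]" using *(4) by (auto simp: word_units_def)
    have "c (flat l q @ flat l [(t, U)]) = c (flat l q @ [(max t l, e)])"
      using flat_block[OF l set_flat[OF l *(2)] *(3), of "[(1, e)]" "[]"] unit_point[OF e(1)] by (simp add: e(2))
    also have "\<dots> = c (flat l q)"
      by (rule cls_last) (use * l' e set_flat[OF l *(2)] in auto)
    finally show "c (flat l (q @ [(t, U)])) = c (flat l q)" by simp
  next
    fix s s' :: real and A and p :: "(real \<times> 'a word set) list"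
    show "c (flat l ((s, A) # p)) = c (flat l ((s', A) # p))" by simp (rule cls_head)
  qed
qed

lemma flatten_cls:
  assumes l: "l \<in> {0..1}" and L: "L \<noteq> []" "set L \<subseteq> letters WG"
  shows "flatten T G E l (cls T WG (word_units T G E) L) = c (flat l L)"
proof -
  interpret W: unital_semigroup T WG "word_units T G E" by (rule word_sgp_unital)
  have A: "W.c L \<in> points W.WG" by (rule W.cls_point[OF L])
  show ?thesis unfolding flatten_def by (rule cls_flat[OF l W.rep(2,3,1)[OF A] L])
qed

lemma flatten_closed:
  assumes l: "l \<in> {0..1}" and A: "A \<in> points (word_sgp T WG (word_units T G E))"
  shows "flatten T G E l A \<in> points WG"
proof -
  interpret W: unital_semigroup T WG "word_units T G E" by (rule word_sgp_unital)
  show ?thesis unfolding flatten_def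
    using W.rep(1,3)[OF A] set_flat[OF l] by (intro cls_point) auto
qed

lemma flatten_mul:
  assumes l: "l \<in> {0..1}" and A: "A \<in> points (word_sgp T WG (word_units T G E))"
    and B: "B \<in> points (word_sgp T WG (word_units T G E))"
  shows "flatten T G E l (mul (word_sgp T WG (word_units T G E)) A B) =
    mul WG (flatten T G E l A) (flatten T G E l B)"
proof -
  interpret W: unital_semigroup T WG "word_units T G E" by (rule word_sgp_unital)
  obtain X p where Xp: "A = W.c ((1, X) # p)" "X \<in> points WG" "set p \<subseteq> letters WG"
    using W.word_cases[OF A] by blast
  obtain Y q where Yq: "B = W.c ((1, Y) # q)" "Y \<in> points WG" "set q \<subseteq> letters WG"
    using W.word_cases[OF B] by blast
  have M: "(1, X) # p \<noteq> []" "set ((1, X) # p) \<subseteq> letters WG" and N: "(1, Y) # q \<noteq> []" "set ((1, Y) # q) \<subseteq> letters WG"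
    using Xp Yq by auto
  obtain y r where y: "flat l ((1, Y) # q) = (1, y) # r" using l by simp
  then have yr: "y \<in> points G" "set r \<subseteq> letters G" using set_flat[OF l N(2)] by auto
  have "flatten T G E l (mul W.WG A B) = c (flat l (((1, X) # p) @ (1, Y) # q))"
    unfolding Xp(1) Yq(1) W.mul_cls[OF M Yq(2,3)] by (rule flatten_cls[OF l]) (use M N in auto)
  also have "\<dots> = c (flat l ((1, X) # p) @ (1, y) # r)" using y by simp
  also have "\<dots> = mul WG (c (flat l ((1, X) # p))) (c ((1, y) # r))"
    by (rule mul_cls[symmetric]) (use set_flat[OF l M(2)] yr in auto)
  also have "\<dots> = mul WG (flatten T G E l A) (flatten T G E l B)"
    unfolding Xp(1) Yq(1) flatten_cls[OF l M] flatten_cls[OF l N] y ..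
  finally show ?thesis .
qed

lemma flatten_unit:
  assumes l: "l \<in> {0..1}" and U: "U \<in> word_units T WG (word_units T G E)"
  shows "flatten T G E l U \<in> word_units T G E"
proof -
  obtain V e where V: "U = cls T WG (word_units T G E) [(1, V)]" "V = c [(1, e)]" "e \<in> E"
    using U by (auto simp: word_units_def)
  have "flatten T G E l U = c (flat l [(1, V)])"
    unfolding V(1) by (rule flatten_cls[OF l]) (use V unit_point cls_point[of "[(1, e)]"] in auto)
  also have "\<dots> = c [(1, e)]"
    using flat_block[OF l, of "[]" 1 "[(1, e)]" "[]"] V unit_point l by simp
  finally show ?thesis using V by (simp add: word_units_def)
qed

text \<open>All joints of \<open>m\<close> have become 0, so relation (1) multiplies its letters
  into \<open>x\<close> one after the other.\<close>

lemma cls_shrink_0: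
  assumes "set u \<subseteq> letters G" "s \<in> {0..1}" "x \<in> points G" "set m \<subseteq> letters G" "set v \<subseteq> letters G"
  shows "c (u @ (s, x) # shrink 0 m @ v) = c (u @ (s, list_eval G ((1, x) # m)) # v)"
  using assms(3,4)
proof (induction m arbitrary: x)
  case (Cons a m)
  obtain t y where a: "a = (t, y)" by (cases a)
  have "c (u @ (s, x) # (0, y) # shrink 0 m @ v) = c (u @ (s, mul G x y) # shrink 0 m @ v)"
    by (rule cls_mul) (use assms Cons.prems set_shrink[of 0 m G] in \<open>auto simp: a\<close>)
  then show ?case
    using Cons.IH[of "mul G x y"] Cons.prems mul_closed by (simp add: a list_eval_def)
qed simp

text \<open>The prefix \<open>u\<close> collects the letters already evaluated; the outer joints are
  unchanged because max s 0 = s.\<close>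

lemma cls_flat_0:
  assumes "set u \<subseteq> letters G" "set R \<subseteq> letters WG"
  shows "c (u @ flat 0 R) = c (u @ map (\<lambda>(s, A). (s, eps G A)) R)"
  using assms
proof (induction R arbitrary: u)
  case (Cons a R)
  obtain s A where a: "a = (s, A)" by (cases a)
  have s: "s \<in> {0..1}" and A: "A \<in> points WG" and R: "set R \<subseteq> letters WG" using Cons.prems a by auto
  obtain b r where B: "rep A = (1, b) # r" using rep(4)[OF A] by blast
  then have br: "b \<in> points G" "set r \<subseteq> letters G" using rep(1)[OF A] by auto
  have e: "list_eval G ((1, b) # r) = eps G A" using eps_cls[OF rep(3,1)[OF A]] rep(2)[OF A] by (simp add: B)
  have "max s 0 = s" using s by simp
  then have "c (u @ flat 0 (a # R)) = c (u @ (s, b) # shrink 0 r @ flat 0 R)"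
    by (simp add: a B)
  also have "\<dots> = c (u @ (s, eps G A) # flat 0 R)"
    using cls_shrink_0[OF Cons.prems(1) s br, of "flat 0 R"] set_flat[OF _ R, of 0] e by simp
  also have "\<dots> = c ((u @ [(s, eps G A)]) @ map (\<lambda>(s, A). (s, eps G A)) R)"
    using Cons.IH[of "u @ [(s, eps G A)]"] Cons.prems R s eps_closed[OF A] by simp
  finally show ?case by (simp add: a)
qed simp

text \<open>Every outer joint becomes max s 1 = 1, the joint of the multiplication, and the inner
  joints keep their lengths.\<close>

lemma cls_flat_1:
  assumes "R \<noteq> []" "set R \<subseteq> letters WG"
  shows "c (flat 1 R) = list_eval WG R"
  using assms
proof (induction R rule: rev_induct)
  case (snoc a R)
  obtain s A where a: "a = (s, A)" by (cases a)
  have s: "s \<in> {0..1}" and A: "A \<in> points WG" and R: "set R \<subseteq> letters WG" using snoc.prems a by auto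
  obtain b r where B: "rep A = (1, b) # r" using rep(4)[OF A] by blast
  then have br: "b \<in> points G" "set r \<subseteq> letters G" using rep(1)[OF A] by auto
  have fa: "flat 1 [a] = (1, b) # r" using s by (simp add: a B max_def)
  interpret W: unital_semigroup T WG "word_units T G E" by (rule word_sgp_unital)
  show ?case
  proof (cases "R = []")
    case True
    then show ?thesis using fa rep(2)[OF A] by (simp add: a B)
  next
    case False
    have "c (flat 1 (R @ [a])) = mul WG (c (flat 1 R)) (c ((1, b) # r))"
      unfolding flat_simps(3) fa by (rule mul_cls[symmetric]) (use False set_flat[OF _ R, of 1] br in auto)
    then show ?thesis
      using snoc.IH[OF False R] W.list_eval_snoc[OF False, of s A] rep(2)[OF A] by (simp add: a B)
  qed
qed simp

end

section \<open>Continuity of retiming and flattening\<close>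

lemma cont_list_retime:
  assumes L: "cont_list C X n L" and l: "continuous_map C (top_of_set {0..1}) l"
  shows "cont_list C X n (\<lambda>x. retime (l x) (L x))"
proof -
  have "continuous_map C (prod_topology (top_of_set {0..1}) X) (\<lambda>x. (min 1 ((2 - l x) * t x), y x))"
    if t: "continuous_map C (top_of_set {0..1}) t" and y: "continuous_map C X y" for t y
  proof -
    have "continuous_map C (top_of_set {0..1}) (\<lambda>x. min 1 ((2 - l x) * t x))"
      using l t by (auto simp: continuous_map_in_subtopology Pi_iff intro!: continuous_intros)
    with y show ?thesis by (simp add: continuous_map_pairwise o_def)
  qed
  then show ?thesis unfolding retime_def
    using cont_list_map[OF L, of X "\<lambda>x (t, y). (min 1 ((2 - l x) * t), y)"] by simp
qed

lemma (in unital_semigroup) test_family_retime_class: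
  fixes C :: "'c topology"
  assumes inf: "infinite (UNIV :: 'c set)" and C: "compact_space C" "Hausdorff_space C"
    and l: "continuous_map C (top_of_set {0..1}) l"
  shows "test_family C (space_of WG) (space_of WG) (\<lambda>x. retime_class T G E (l x))"
proof -
  have l01: "l x \<in> {0..1}" if "x \<in> topspace C" for x
    using funcset_mem[OF continuous_map_funspace[OF l] that] by simp
  have "test_family C (space_of WG) (space_of WG) (\<lambda>x A. c (retime (l x) (rep A)))"
  proof (rule test_family_word_sgp[OF inf C])
    fix D :: "'c topology" and a L n
    assume D: "compact_space D" "Hausdorff_space D" and a: "continuous_map D C a"
      and L: "cont_list D (space_of G) (Suc n) L"
    have "cont_list D (space_of G) (Suc n) (\<lambda>d. retime (l (a d)) (L d))"
      by (rule cont_list_retime[OF L]) (use continuous_map_compose[OF a l] in \<open>simp add: o_def\<close>)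
    then show "continuous_map D (space_of WG) (\<lambda>d. c (retime (l (a d)) (L d)))"
      by (rule continuous_map_cls[OF D])
  qed (use cls_retime l01 in blast)
  then show ?thesis by (simp add: retime_class_def[abs_def])
qed

text \<open>The entries of \<open>R\<close> are classes, and \<open>rep\<close> is not a continuous
  choice. So the first entry is replaced by an arbitrary continuous list over a further test space
  \<open>D\<close>; its flattened form joins the prefix \<open>u\<close>, the induction hypothesis
  handles the rest, and \<open>test_family_word_sgp\<close> returns to classes. Hence the parameter
  space varies in the induction.\<close>

lemma (in unital_semigroup) continuous_map_flat:
  fixes C :: "'c topology"
  assumes inf: "infinite (UNIV :: 'c set)" and C: "compact_space C" "Hausdorff_space C"
    and l: "continuous_map C (top_of_set {0..1}) l"
    and u: "cont_list C (space_of G) m u" and R: "cont_list C (space_of WG) n R" and mn: "0 < m + n"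
  shows "continuous_map C (space_of WG) (\<lambda>x. c (u x @ flat (l x) (R x)))"
  using C l u R mn
proof (induction n arbitrary: C l m u R)
  case 0
  obtain k where k: "m = Suc k" using 0 by (cases m) auto
  have "continuous_map C (space_of WG) (\<lambda>x. c (u x))"
    by (rule continuous_map_cls[OF 0(1,2)]) (use 0(4) k in simp)
  then show ?case
    by (rule continuous_map_eq) (use 0(5) in \<open>simp add: cont_list_def\<close>)
next
  case (Suc n)
  note C = Suc.prems(1,2) and l = Suc.prems(3) and u = Suc.prems(4) and R = Suc.prems(5)
  obtain s A M where s: "continuous_map C (top_of_set {0..1}) s" and A: "continuous_map C (space_of WG) A"
    and M: "cont_list C (space_of WG) n M" and RM: "\<And>x. x \<in> topspace C \<Longrightarrow> R x = (s x, A x) # M x"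
    using cont_list_SucE[OF R] by metis
  have l01: "l x \<in> {0..1}" and s01: "s x \<in> {0..1}" if "x \<in> topspace C" for x
    using funcset_mem[OF continuous_map_funspace that] l s by fastforce+
  have ms: "continuous_map C (top_of_set {0..1}) (\<lambda>x. max (s x) (l x))"
    using l s by (auto simp: continuous_map_in_subtopology Pi_iff intro!: continuous_intros)
  let ?\<Phi> = "\<lambda>x L. c (u x @ (max (s x) (l x), snd (hd L)) # shrink (l x) (tl L) @ flat (l x) (M x))"
  have fam: "test_family C (space_of WG) (space_of WG) (\<lambda>x A. ?\<Phi> x (rep A))"
  proof (rule test_family_word_sgp[OF inf C])
    fix D :: "'c topology" and a L k
    assume D: "compact_space D" "Hausdorff_space D" and a: "continuous_map D C a"
      and L: "cont_list D (space_of G) (Suc k) L"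
    obtain t y N where y: "continuous_map D (space_of G) y" and N: "cont_list D (space_of G) k N"
      and LN: "\<And>x. x \<in> topspace D \<Longrightarrow> L x = (t x, y x) # N x"
      using cont_list_SucE[OF L] by metis
    have la: "continuous_map D (top_of_set {0..1}) (\<lambda>d. l (a d))"
      using continuous_map_compose[OF a l] by (simp add: o_def)
    have msa: "continuous_map D (top_of_set {0..1}) (\<lambda>d. max (s (a d)) (l (a d)))"
      using continuous_map_compose[OF a ms] by (simp add: o_def)
    have "cont_list D (space_of G) (m + Suc k)
        (\<lambda>d. u (a d) @ (max (s (a d)) (l (a d)), y d) # shrink (l (a d)) (N d))"
      by (intro cont_list_append cont_list_Cons cont_list_shrink cont_list_pullback[OF u a] msa y N la)
    \<comment> \<open>The induction hypothesis is used over \<open>D\<close>, with the data on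
      \<open>C\<close> pulled back along \<open>a\<close>.\<close>
    from Suc.IH[OF D la this cont_list_pullback[OF M a]]
    have "continuous_map D (space_of WG)
        (\<lambda>d. c ((u (a d) @ (max (s (a d)) (l (a d)), y d) # shrink (l (a d)) (N d)) @ flat (l (a d)) (M (a d))))"
      by simp
    then show "continuous_map D (space_of WG) (\<lambda>d. ?\<Phi> (a d) (L d))"
      by (rule continuous_map_eq) (simp add: LN)
  next
    fix x L L' assume x: "x \<in> topspace C" and LL: "c L = c L'" "L \<noteq> []" "set L \<subseteq> letters G"
      "L' \<noteq> []" "set L' \<subseteq> letters G"
    show "?\<Phi> x L = ?\<Phi> x L'"
      using l01[OF x] s01[OF x] cont_list_set[OF u x] set_flat[OF l01[OF x] cont_list_set[OF M x]] le_hd_flat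
      by (intro cls_context LL) auto
  qed
  have "continuous_map C (space_of WG) (\<lambda>x. ?\<Phi> x (rep (A x)))"
    using test_familyD[OF fam C continuous_map_id A] by simp
  then show ?case by (rule continuous_map_eq) (simp add: RM)
qed

lemma (in unital_semigroup) test_family_flatten:
  fixes C :: "'c topology"
  assumes inf: "infinite (UNIV :: 'c set)" and C: "compact_space C" "Hausdorff_space C"
    and l: "continuous_map C (top_of_set {0..1}) l"
  shows "test_family C (space_of (word_sgp T WG (word_units T G E))) (space_of WG) (\<lambda>x. flatten T G E (l x))"
proof -
  interpret W: unital_semigroup T WG "word_units T G E" by (rule word_sgp_unital)
  have l01: "l x \<in> {0..1}" if "x \<in> topspace C" for x
    using funcset_mem[OF continuous_map_funspace[OF l] that] by simp
  have "test_family C (space_of W.WG) (space_of WG) (\<lambda>x A. c (flat (l x) (rep A)))"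
  proof (rule W.test_family_word_sgp[OF inf C])
    fix D :: "'c topology" and a L n
    assume D: "compact_space D" "Hausdorff_space D" and a: "continuous_map D C a"
      and L: "cont_list D (space_of WG) (Suc n) L"
    have la: "continuous_map D (top_of_set {0..1}) (\<lambda>d. l (a d))"
      using continuous_map_compose[OF a l] by (simp add: o_def)
    show "continuous_map D (space_of WG) (\<lambda>d. c (flat (l (a d)) (L d)))"
      using continuous_map_flat[OF inf D la cont_list_Nil L] by simp
  qed (use cls_flat l01 in blast)
  then show ?thesis by (simp add: flatten_def[abs_def])
qed

lemma (in unital_semigroup) test_family_eps:
  fixes C :: "'c topology"
  assumes inf: "infinite (UNIV :: 'c set)" and G: "topological_semigroup T G"
    and C: "compact_space C" "Hausdorff_space C"
  shows "test_family C (space_of WG) (space_of G) (\<lambda>x. eps G)"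
proof -
  have fam: "test_family C (space_of WG) (space_of G) (\<lambda>x A. list_eval G (rep A))"
    by (rule test_family_word_sgp[OF inf C, where \<Phi> = "\<lambda>x. list_eval G"])
      (use continuous_map_list_eval[OF G] list_eval_cls in blast)+
  show ?thesis
    unfolding test_family_def
  proof (intro allI impI)
    fix D :: "'c topology" and a p
    assume D: "compact_space D" "Hausdorff_space D" and a: "continuous_map D C a"
      and p: "continuous_map D (space_of WG) p"
    show "continuous_map D (space_of G) (\<lambda>d. eps G (p d))"
    proof (rule continuous_map_eq[OF test_familyD[OF fam D a p]])
      fix d assume "d \<in> topspace D"
      then have P: "p d \<in> points WG" using funcset_mem[OF continuous_map_funspace[OF p]] by blast
      show "list_eval G (rep (p d)) = eps G (p d)"
        using eps_cls[OF rep(3,1)[OF P]] rep(2)[OF P] by simp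
    qed
  qed
qed

section \<open>Homotopies of homomorphisms\<close>

lemma continuous_map_test_family_member:
  fixes T :: "'c itself" and C :: "'c topology"
  assumes X: "kspace T X" and fam: "test_family C X Y \<phi>" and x: "x \<in> topspace C"
  shows "continuous_map X Y (\<phi> x)"
proof (rule continuous_map_from_kspace[OF X])
  fix D :: "'c topology" and p assume "test_map D X p"
  then show "continuous_map D Y (\<lambda>d. \<phi> x (p d))"
    using test_familyD[OF fam, of D "\<lambda>_. x" p] x by (simp add: test_map_def)
qed

lemma test_family_compose:
  fixes C :: "'c topology"
  assumes "test_family C X Y \<phi>" "test_family C Y Z \<psi>"
  shows "test_family C X Z (\<lambda>x y. \<psi> x (\<phi> x y))"
  unfolding test_family_def using test_familyD[OF assms(1)] test_familyD[OF assms(2)] by blast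

lemma test_family_cong:
  fixes C :: "'c topology"
  assumes "test_family C X Y \<phi>" and "\<And>x y. x \<in> topspace C \<Longrightarrow> y \<in> topspace X \<Longrightarrow> \<psi> x y = \<phi> x y"
  shows "test_family C X Y \<psi>"
  unfolding test_family_def
proof (intro allI impI)
  fix D :: "'c topology" and a p
  assume D: "compact_space D" "Hausdorff_space D" and a: "continuous_map D C a" and p: "continuous_map D X p"
  show "continuous_map D Y (\<lambda>d. \<psi> (a d) (p d))"
  proof (rule continuous_map_eq[OF test_familyD[OF assms(1) D a p]])
    fix d assume d: "d \<in> topspace D"
    show "\<phi> (a d) (p d) = \<psi> (a d) (p d)"
      by (rule assms(2)[OF funcset_mem[OF continuous_map_funspace[OF a] d]
            funcset_mem[OF continuous_map_funspace[OF p] d], symmetric])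
  qed
qed

lemma test_map_prodD:
  assumes "test_map C (prod_topology X Y) z"
  shows "compact_space C" "Hausdorff_space C"
    "continuous_map C X (\<lambda>x. fst (z x))" "continuous_map C Y (\<lambda>x. snd (z x))"
proof -
  have z: "continuous_map C (prod_topology X Y) z" and "compact_space C" "Hausdorff_space C"
    using assms by (simp_all add: test_map_def)
  then show "compact_space C" "Hausdorff_space C" by simp_all
  show "continuous_map C X (\<lambda>x. fst (z x))" using continuous_map_fst_of[OF z] by (simp add: o_def)
  show "continuous_map C Y (\<lambda>x. snd (z x))" using continuous_map_snd_of[OF z] by (simp add: o_def)
qed

lemma kspace_word_sgp: "kspace T (space_of (word_sgp T G E))"
  unfolding word_sgp_def top_sgp.select_convs by (rule kspace_quotient_space[OF kspace_word_space])

section \<open>Homomorphisms out of the semigroup of classes\<close>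

lemma unital_homs_word_sgp_iff:
  assumes G: "unital_semigroup G E" and Y: "unital_semigroup Y F"
  shows "f \<in> unital_homs (word_sgp T G E) (word_units T G E) Y F \<longleftrightarrow>
    f \<in> extensional (points (word_sgp T G E)) \<and> continuous_map (space_of (word_sgp T G E)) (space_of Y) f \<and>
    word_hom T G E Y F f"
proof -
  have "f A \<in> points Y" if "continuous_map (space_of (word_sgp T G E)) (space_of Y) f" "A \<in> points (word_sgp T G E)" for A
    using funcset_mem[OF continuous_map_funspace[OF that(1)] that(2)] .
  then show ?thesis
    using G Y unfolding unital_homs_def sgp_homs_def maps_def word_hom_def word_hom_axioms_def by blast
qed

lemma word_hom_cong:
  assumes f: "word_hom T G E Y F f" and eq: "\<And>A. A \<in> points (word_sgp T G E) \<Longrightarrow> g A = f A"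
  shows "word_hom T G E Y F g"
proof -
  interpret word_hom T G E Y F f by (rule f)
  interpret W: unital_semigroup T src.WG "word_units T G E" by (rule src.word_sgp_unital)
  show ?thesis
    by unfold_locales (simp_all add: eq f_closed f_mul f_unit W.mul_closed W.unit_point)
qed

lemma word_hom_compose:
  assumes f: "word_hom T G E Y F f" and Z: "unital_semigroup Z K"
    and closed: "\<And>y. y \<in> points Y \<Longrightarrow> k y \<in> points Z"
    and mul: "\<And>x y. x \<in> points Y \<Longrightarrow> y \<in> points Y \<Longrightarrow> k (mul Y x y) = mul Z (k x) (k y)"
    and unit: "\<And>u. u \<in> F \<Longrightarrow> k u \<in> K"
  shows "word_hom T G E Z K (\<lambda>A. k (f A))"
proof -
  interpret word_hom T G E Y F f by (rule f)
  show ?thesis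
    using Z by (intro word_hom.intro word_hom_axioms.intro src.unital_semigroup_axioms)
      (simp_all add: closed mul unit f_closed f_mul f_unit)
qed

lemma word_hom_retime_class:
  assumes f: "word_hom T G E Y F f" and l: "l \<in> {0..1}"
  shows "word_hom T G E Y F (\<lambda>A. f (retime_class T G E l A))"
proof -
  interpret word_hom T G E Y F f by (rule f)
  show ?thesis
    by unfold_locales (simp_all add: f_closed f_mul f_unit src.retime_class_closed[OF l]
        src.retime_class_mul[OF l] src.retime_class_unit[OF l])
qed

text \<open>The common form of the continuity proofs for the composition with \<open>eps\<close>,
  for the lift and for the homotopies. The restriction supplies the extensionality required of
  points of function spaces.\<close>

lemma continuous_map_into_hom_space:
  fixes T :: "'c itself" and X :: "'x topology"
  assumes inf: "infinite (UNIV :: 'c set)" and X: "kspace T X"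
    and G: "unital_semigroup G E" and Y: "unital_semigroup Y F"
    and hom: "\<And>x. x \<in> topspace X \<Longrightarrow> word_hom T G E Y F (\<Phi> x)"
    and fam: "\<And>(C :: 'c topology) h. test_map C X h \<Longrightarrow>
      test_family C (space_of (word_sgp T G E)) (space_of Y) (\<lambda>x. \<Phi> (h x))"
  shows "continuous_map X (hom_space T (word_sgp T G E) (word_units T G E) Y F)
    (\<lambda>x. restrict (\<Phi> x) (points (word_sgp T G E)))"
proof (rule continuous_map_from_kspace[OF X])
  let ?P = "points (word_sgp T G E)"
  fix C :: "'c topology" and h assume h: "test_map C X h"
  then have C: "compact_space C" "Hausdorff_space C" "continuous_map C X h" by (simp_all add: test_map_def)
  have fam': "test_family C (space_of (word_sgp T G E)) (space_of Y) (\<lambda>x. restrict (\<Phi> (h x)) ?P)"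
    by (rule test_family_cong[OF fam[OF h]]) simp
  have "restrict (\<Phi> (h x)) ?P \<in> unital_homs (word_sgp T G E) (word_units T G E) Y F" if x: "x \<in> topspace C" for x
  proof -
    have "word_hom T G E Y F (\<Phi> (h x))"
      by (rule hom) (use funcset_mem[OF continuous_map_funspace[OF C(3)] x] in simp)
    then have "word_hom T G E Y F (restrict (\<Phi> (h x)) ?P)" by (rule word_hom_cong) simp
    then show ?thesis
      unfolding unital_homs_word_sgp_iff[OF G Y]
      using continuous_map_test_family_member[OF kspace_word_sgp fam' x] by simp
  qed
  then show "continuous_map C (hom_space T (word_sgp T G E) (word_units T G E) Y F)
      (\<lambda>x. restrict (\<Phi> (h x)) ?P)"
    unfolding continuous_map_hom_space[OF inf C(1,2)] using fam' by blast
qed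

text \<open>The places of the cuts depend on the joints alone, so cutting is natural in the values
  given to the blocks.\<close>

lemma (in word_hom) cut_word_map:
  assumes L: "L \<noteq> []" "set L \<subseteq> letters G"
    and g: "\<And>A. A \<in> points (word_sgp T G E) \<Longrightarrow> g A = k (f A)"
  shows "cut_word (\<lambda>b. g (src.c b)) L = map (\<lambda>(s, y). (s, k y)) (cut_word h L)"
proof -
  have "cuts (\<lambda>b. g (src.c b)) s b p = map (\<lambda>(s, y). (s, k y)) (cuts h s b p)"
    if "b \<noteq> []" "set b \<subseteq> letters G" "set p \<subseteq> letters G" for s b p
    using that
  proof (induction p arbitrary: s b)
    case (Cons a p)
    obtain t x where "a = (t, x)" by (cases a)
    then show ?case using Cons.IH[of "[(1, x)]"] Cons.IH[of "b @ [(2 * t, x)]"] Cons.prems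
      by (simp add: g src.cls_point)
  qed (simp add: g src.cls_point)
  then show ?thesis using L unfolding cut_word_def by (cases L) auto
qed

lemma (in word_hom) eps_lift_hom:
  assumes A: "A \<in> points (word_sgp T G E)"
  shows "eps Y (lift_hom T G E Y F f A) = f (retime_class T G E 0 A)"
proof -
  note L = src.rep[OF A]
  have "eps Y (tgt.c (cut_word h (rep A))) = h (retime 0 (rep A))"
    using tgt.eps_cls[of "cut_word h (rep A)"] list_eval_cut_word[OF L(3,1)] cut_word_set[OF L(3,1)]
    by (simp add: cut_word_def)
  then show ?thesis unfolding lift_hom_def retime_class_def .
qed

lemma flatten_lift_hom_0:
  assumes H: "unital_semigroup H F" and g: "word_hom T G E (word_sgp T H F) (word_units T H F) g"
    and f: "word_hom T G E H F f" "\<And>A. A \<in> points (word_sgp T G E) \<Longrightarrow> f A = eps H (g A)"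
    and A: "A \<in> points (word_sgp T G E)"
  shows "flatten T H F 0 (lift_hom T G E (word_sgp T H F) (word_units T H F) g A) = lift_hom T G E H F f A"
proof -
  interpret H: unital_semigroup T H F by (rule H)
  interpret g: word_hom T G E H.WG "word_units T H F" g by (rule g)
  note L = g.src.rep[OF A]
  let ?R = "cut_word g.h (rep A)"
  have R: "?R \<noteq> []" "set ?R \<subseteq> letters H.WG"
    using g.cut_word_set[OF L(3,1)] by (simp_all add: cut_word_def)
  have "flatten T H F 0 (lift_hom T G E H.WG (word_units T H F) g A) = H.c (flat 0 ?R)"
    unfolding lift_hom_def using H.flatten_cls[OF _ R, of 0] by simp
  also have "\<dots> = H.c (map (\<lambda>(s, A). (s, eps H A)) ?R)"
    using H.cls_flat_0[of "[]" ?R] R by simp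
  also have "\<dots> = lift_hom T G E H F f A"
    unfolding lift_hom_def using g.cut_word_map[of "rep A" f "eps H"] L(1,3) f(2) by simp
  finally show ?thesis .
qed

text \<open>For \<open>l = 1\<close> flattening is evaluation in the semigroup of classes over
  \<open>H\<close>, so this is \<open>list_eval_cut_word\<close> with that semigroup as the
  target.\<close>

lemma flatten_lift_hom_1:
  assumes H: "unital_semigroup H F" and g: "word_hom T G E (word_sgp T H F) (word_units T H F) g"
    and A: "A \<in> points (word_sgp T G E)"
  shows "flatten T H F 1 (lift_hom T G E (word_sgp T H F) (word_units T H F) g A) = g (retime_class T G E 0 A)"
proof -
  interpret H: unital_semigroup T H F by (rule H)
  interpret g: word_hom T G E H.WG "word_units T H F" g by (rule g)
  note L = g.src.rep[OF A]
  let ?R = "cut_word g.h (rep A)"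
  have R: "?R \<noteq> []" "set ?R \<subseteq> letters H.WG"
    using g.cut_word_set[OF L(3,1)] by (simp_all add: cut_word_def)
  have "flatten T H F 1 (lift_hom T G E H.WG (word_units T H F) g A) = H.c (flat 1 ?R)"
    unfolding lift_hom_def using H.flatten_cls[OF _ R, of 1] by simp
  also have "\<dots> = list_eval H.WG ?R" by (rule H.cls_flat_1[OF R])
  also have "\<dots> = g (retime_class T G E 0 A)"
    unfolding retime_class_def by (rule g.list_eval_cut_word[OF L(3,1)])
  finally show ?thesis .
qed

section \<open>The homotopies and the equivalence\<close>

lemma infinite_if_continuum: "(UNIV :: real set) \<lesssim> (UNIV :: 'c set) \<Longrightarrow> infinite (UNIV :: 'c set)"
  using infinite_UNIV_char_0[where 'a = real] lepoll_trans by (auto simp: infinite_le_lepoll)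

lemma kspace_prod_interval:
  fixes T :: "'c itself"
  assumes "(UNIV :: real set) \<lesssim> (UNIV :: 'c set)" and "kspace T X"
  shows "kspace T (prod_topology (top_of_set {0..1::real}) X)"
proof (rule kspace_prod_compact[OF infinite_if_continuum[OF assms(1)] _ _ _ assms(2)])
  show "topspace (top_of_set {0..1::real}) \<lesssim> (UNIV :: 'c set)"
    using lepoll_trans[OF subset_imp_lepoll assms(1)] by simp
qed (simp_all add: compact_space_subtopology Hausdorff_space_subtopology)

text \<open>The target is arbitrary because this homotopy closes both composites: once with the
  values in \<open>H\<close>, once with the values in the classes over \<open>H\<close>.\<close>

lemma retiming_homotopic_id:
  fixes T :: "'c itself"
  assumes card: "(UNIV :: real set) \<lesssim> (UNIV :: 'c set)"
    and G: "unital_semigroup G E" and Y: "unital_semigroup Y K"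
    and R_def: "R = hom_space T (word_sgp T G E) (word_units T G E) Y K"
  shows "homotopic_with (\<lambda>_. True) R R
    (\<lambda>f. restrict (\<lambda>A. f (retime_class T G E 0 A)) (points (word_sgp T G E))) id"
proof -
  interpret G: unital_semigroup T G E by (rule G)
  note inf = infinite_if_continuum[OF card]
  let ?I = "top_of_set {0..1::real}"
  let ?r = "\<lambda>f. restrict f (points G.WG)"
  let ?K = "\<lambda>z. ?r (\<lambda>A. snd z (retime_class T G E (fst z) A))"
  have R: "f \<in> topspace R \<longleftrightarrow> f \<in> extensional (points G.WG) \<and>
      continuous_map (space_of G.WG) (space_of Y) f \<and> word_hom T G E Y K f" for f
    unfolding R_def topspace_hom_space by (rule unital_homs_word_sgp_iff[OF G Y])
  have kR: "kspace T (prod_topology ?I R)"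
    using kspace_prod_interval[OF card kspace_hom_space] unfolding R_def .
  have "continuous_map (prod_topology ?I R) (hom_space T G.WG (word_units T G E) Y K) ?K"
  proof (rule continuous_map_into_hom_space[OF inf kR G Y])
    fix z assume z: "z \<in> topspace (prod_topology ?I R)"
    then have "snd z \<in> topspace R" "fst z \<in> {0..1}" by auto
    then show "word_hom T G E Y K (\<lambda>A. snd z (retime_class T G E (fst z) A))"
      using R word_hom_retime_class by blast
  next
    fix C :: "'c topology" and z assume z: "test_map C (prod_topology ?I R) z"
    note zz = test_map_prodD[OF z]
    have "test_family C (space_of G.WG) (space_of Y) (\<lambda>x. snd (z x))"
      using zz(4) continuous_map_hom_space[OF inf zz(1,2)] unfolding R_def by blast
    then show "test_family C (space_of G.WG) (space_of Y) (\<lambda>x A. snd (z x) (retime_class T G E (fst (z x)) A))"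
      by (rule test_family_compose[OF G.test_family_retime_class[OF inf zz(1-3)]])
  qed
  then have cont: "continuous_map (prod_topology ?I R) R ?K" unfolding R_def .
  \<comment> \<open>The last stage is determined on the points of \<open>WG\<close> only;
    extensionality of \<open>f\<close> gives equality of functions.\<close>
  have finish: "?r (\<lambda>A. f (retime_class T G E 1 A)) = f" if "f \<in> topspace R" for f
    using that R by (intro extensionalityI[of _ "points G.WG"]) (auto simp: G.retime_class_1)
  show ?thesis
    by (subst homotopic_with, simp) (intro exI[of _ ?K] conjI cont, simp_all add: finish)
qed

theorem homotopy_equivalence_eps:
  fixes T :: "'c itself" and G :: "'g top_sgp" and H :: "'h top_sgp"
  assumes card: "(UNIV :: real set) \<lesssim> (UNIV :: 'c set)"
    and G: "unital_semigroup G E" and H: "unital_semigroup H F" and tH: "topological_semigroup T H"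
  shows "homotopy_equivalence_map
    (hom_space T (word_sgp T G E) (word_units T G E) (word_sgp T H F) (word_units T H F))
    (hom_space T (word_sgp T G E) (word_units T G E) H F)
    (postcomp (space_of (word_sgp T G E)) (eps H))"
proof -
  interpret G: unital_semigroup T G E by (rule G)
  interpret H: unital_semigroup T H F by (rule H)
  interpret W: unital_semigroup T H.WG "word_units T H F" by (rule H.word_sgp_unital)
  note inf = infinite_if_continuum[OF card]
  let ?I = "top_of_set {0..1::real}"
  define P where "P = hom_space T G.WG (word_units T G E) H.WG (word_units T H F)"
  define Q where "Q = hom_space T G.WG (word_units T G E) H F"
  have kP: "kspace T P" and kQ: "kspace T Q" by (simp_all add: P_def Q_def kspace_hom_space)
  have P: "g \<in> topspace P \<longleftrightarrow> g \<in> extensional (points G.WG) \<and>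
      continuous_map (space_of G.WG) (space_of H.WG) g \<and> word_hom T G E H.WG (word_units T H F) g" for g
    unfolding P_def topspace_hom_space by (rule unital_homs_word_sgp_iff[OF G H.word_sgp_unital])
  have Q: "f \<in> topspace Q \<longleftrightarrow> f \<in> extensional (points G.WG) \<and>
      continuous_map (space_of G.WG) (space_of H) f \<and> word_hom T G E H F f" for f
    unfolding Q_def topspace_hom_space by (rule unital_homs_word_sgp_iff[OF G H])
  have famP: "test_family C (space_of G.WG) (space_of H.WG) g"
    if "compact_space C" "Hausdorff_space C" "continuous_map C P g" for C :: "'c topology" and g
    using that continuous_map_hom_space[OF inf that(1,2)] unfolding P_def by blast
  have famQ: "test_family C (space_of G.WG) (space_of H) f"
    if "compact_space C" "Hausdorff_space C" "continuous_map C Q f" for C :: "'c topology" and f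
    using that continuous_map_hom_space[OF inf that(1,2)] unfolding Q_def by blast
  have homP: "word_hom T G E H.WG (word_units T H F) (g x)"
    if "continuous_map C P g" "x \<in> topspace C" for C :: "'c topology" and g x
    using funcset_mem[OF continuous_map_funspace[OF that(1)] that(2)] P by blast
  have homQ: "word_hom T G E H F (f x)"
    if "continuous_map C Q f" "x \<in> topspace C" for C :: "'c topology" and f x
    using funcset_mem[OF continuous_map_funspace[OF that(1)] that(2)] Q by blast
  have eps_hom: "word_hom T G E H F (\<lambda>A. eps H (g A))" if "word_hom T G E H.WG (word_units T H F) g" for g
    by (rule word_hom_compose[OF that H]) (auto intro: H.eps_closed H.eps_mul H.eps_unit)

  let ?r = "\<lambda>f. restrict f (points G.WG)"
  define e where "e = postcomp (space_of G.WG) (eps H)"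
  have e: "e g = ?r (\<lambda>A. eps H (g A))" for g
    by (simp add: e_def postcomp_def compose_def)
  define \<gamma> where "\<gamma> f = ?r (lift_hom T G E H F f)" for f

  have cont_e: "continuous_map P Q e"
    unfolding e Q_def
  proof (rule continuous_map_into_hom_space[OF inf kP G H])
    fix C :: "'c topology" and g assume "test_map C P g"
    then have C: "compact_space C" "Hausdorff_space C" "continuous_map C P g" by (simp_all add: test_map_def)
    show "test_family C (space_of G.WG) (space_of H) (\<lambda>x A. eps H (g x A))"
      by (rule test_family_compose[OF famP[OF C] H.test_family_eps[OF inf tH C(1,2)]])
  qed (use P eps_hom in blast)

  have cont_\<gamma>: "continuous_map Q P \<gamma>"
    unfolding \<gamma>_def P_def
  proof (rule continuous_map_into_hom_space[OF inf kQ G H.word_sgp_unital])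
    show "word_hom T G E H.WG (word_units T H F) (lift_hom T G E H F f)" if "f \<in> topspace Q" for f
      using that Q word_hom.lift_hom_hom by blast
    fix C :: "'c topology" and f assume "test_map C Q f"
    then have C: "compact_space C" "Hausdorff_space C" "continuous_map C Q f" by (simp_all add: test_map_def)
    show "test_family C (space_of G.WG) (space_of H.WG) (\<lambda>x. lift_hom T G E H F (f x))"
      by (rule test_family_lift_hom[OF inf G C(1,2) homQ[OF C(3)] famQ[OF C]])
  qed

  have flattening: "homotopic_with (\<lambda>_. True) P P (\<gamma> \<circ> e) (\<lambda>g. ?r (\<lambda>A. g (retime_class T G E 0 A)))"
  proof -
    let ?k = "\<lambda>g. lift_hom T G E H.WG (word_units T H F) g"
    let ?K = "\<lambda>z. ?r (\<lambda>A. flatten T H F (fst z) (?k (snd z) A))"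
    have "continuous_map (prod_topology ?I P) (hom_space T G.WG (word_units T G E) H.WG (word_units T H F)) ?K"
    proof (rule continuous_map_into_hom_space[OF inf kspace_prod_interval[OF card kP] G H.word_sgp_unital])
      fix z assume "z \<in> topspace (prod_topology ?I P)"
      then have "snd z \<in> topspace P" and l: "fst z \<in> {0..1}" by auto
      then have g: "word_hom T G E H.WG (word_units T H F) (snd z)" using P by blast
      show "word_hom T G E H.WG (word_units T H F) (\<lambda>A. flatten T H F (fst z) (?k (snd z) A))"
        by (rule word_hom_compose[OF word_hom.lift_hom_hom[OF g] H.word_sgp_unital
              H.flatten_closed[OF l] H.flatten_mul[OF l] H.flatten_unit[OF l]])
    next
      fix C :: "'c topology" and z assume z: "test_map C (prod_topology ?I P) z"
      note zz = test_map_prodD[OF z]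
      show "test_family C (space_of G.WG) (space_of H.WG) (\<lambda>x A. flatten T H F (fst (z x)) (?k (snd (z x)) A))"
        by (rule test_family_compose[OF test_family_lift_hom[OF inf G zz(1,2) homP[OF zz(4)] famP[OF zz(1,2,4)]]
              H.test_family_flatten[OF inf zz(1-3)]])
    qed
    then have cont: "continuous_map (prod_topology ?I P) P ?K" unfolding P_def .
    have start: "?r (\<lambda>A. flatten T H F 0 (?k g A)) = (\<gamma> \<circ> e) g" if g: "g \<in> topspace P" for g
    proof -
      have gh: "word_hom T G E H.WG (word_units T H F) g" using g P by blast
      \<comment> \<open>\<open>e g\<close> is the restriction of the composite, so it agrees with
        \<open>eps H (g A)\<close> on points only; this is the form in which
        \<open>flatten_lift_hom_0\<close> takes its hypothesis.\<close>
      have eh: "word_hom T G E H F (e g)" unfolding e by (rule word_hom_cong[OF eps_hom[OF gh]]) simp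
      show ?thesis
        unfolding \<gamma>_def comp_def
        by (rule restrict_ext) (rule flatten_lift_hom_0[OF H gh eh], simp_all add: e)
    qed
    have finish: "?r (\<lambda>A. flatten T H F 1 (?k g A)) = ?r (\<lambda>A. g (retime_class T G E 0 A))"
      if g: "g \<in> topspace P" for g
    proof -
      have gh: "word_hom T G E H.WG (word_units T H F) g" using g P by blast
      show ?thesis by (rule restrict_ext) (rule flatten_lift_hom_1[OF H gh])
    qed
    show ?thesis
      by (subst homotopic_with, simp)
        (intro exI[of _ ?K] conjI cont ballI; simp only: fst_conv snd_conv start finish)
  qed

  have "homotopic_with (\<lambda>_. True) P P (\<gamma> \<circ> e) id"
    by (rule homotopic_with_trans[OF flattening retiming_homotopic_id[OF card G H.word_sgp_unital P_def]])
  moreover have "homotopic_with (\<lambda>_. True) Q Q (e \<circ> \<gamma>) id"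
  proof (rule homotopic_with_eq[OF retiming_homotopic_id[OF card G H Q_def]])
    fix f assume "f \<in> topspace Q"
    then have f: "word_hom T G E H F f" using Q by blast
    show "(e \<circ> \<gamma>) f = ?r (\<lambda>A. f (retime_class T G E 0 A))"
      unfolding \<gamma>_def comp_def e by (rule restrict_ext) (simp add: word_hom.eps_lift_hom[OF f])
  qed auto
  ultimately show ?thesis
    unfolding homotopy_equivalence_map_def P_def[symmetric] Q_def[symmetric] e_def[symmetric]
    using cont_e cont_\<gamma> by blast
qed

section \<open>Monoids and semigroups\<close>

text \<open>The general theorem speaks of \<open>top_sgp\<close> records with a separate set of
  units, so a monoid enters as its semigroup together with the singleton of its unit.\<close>

definition sgp_of :: "'a top_mon \<Rightarrow> 'a top_sgp" where
  "sgp_of M = \<lparr>space_of = space_of M, mul = mul M\<rparr>"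

lemma sgp_of_simps [simp]: "space_of (sgp_of M) = space_of M" "mul (sgp_of M) = mul M"
  by (simp_all add: sgp_of_def)

lemma unital_semigroup_if_topological_semigroup:
  assumes "topological_semigroup T G" "E \<subseteq> points G"
    and "\<And>e x. e \<in> E \<Longrightarrow> x \<in> points G \<Longrightarrow> mul G e x = x \<and> mul G x e = x"
  shows "unital_semigroup G E"
proof -
  have "mul G x y \<in> points G" if "x \<in> points G" "y \<in> points G" for x y
  proof -
    have "(x, y) \<in> topspace (kprod T (space_of G) (space_of G))" using that by (simp add: kprod_def)
    moreover have "continuous_map (kprod T (space_of G) (space_of G)) (space_of G) (\<lambda>(x, y). mul G x y)"
      using assms(1) by (simp add: topological_semigroup_def)
    ultimately show ?thesis using funcset_mem[OF continuous_map_funspace] by fastforce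
  qed
  then show ?thesis using assms by unfold_locales (auto simp: topological_semigroup_def)
qed

lemma rel1_sgp_of: "rel1 (sgp_of M) = rel1 M"
  by (intro ext) (simp add: rel1.simps)

lemma rel2_eq_unit_rel: "rel2 M = unit_rel {unit_of M}"
  by (intro ext) (simp add: rel2.simps unit_rel.simps)

lemma word_rel_sgp_of: "word_rel (sgp_of M) {unit_of M} = (\<lambda>v w. rel1 M v w \<or> rel2 M v w)"
  by (intro ext) (simp add: word_rel_def rel1_sgp_of rel2_eq_unit_rel)

lemma word_space_sgp_of: "word_space T (sgp_of M) = word_space T M"
  by (simp add: word_space_def word_summand_def)

lemma sgp_of_W: "sgp_of (W T M) = word_sgp T (sgp_of M) {unit_of M}"
  by (simp add: sgp_of_def[of "W T M"] W_def word_sgp_def word_rel_sgp_of word_space_sgp_of Let_def)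

lemma unit_of_W: "{unit_of (W T M)} = word_units T (sgp_of M) {unit_of M}"
  by (simp add: W_def word_units_def cls_def word_of_def word_rel_sgp_of word_space_sgp_of Let_def)

lemma Mon_eq_hom_space: "Mon T M N = hom_space T (sgp_of M) {unit_of M} (sgp_of N) {unit_of N}"
proof -
  have "mon_homs M N = unital_homs (sgp_of M) {unit_of M} (sgp_of N) {unit_of N}"
    by (auto simp: mon_homs_def unital_homs_def sgp_homs_def)
  then show ?thesis by (simp add: Mon_def hom_space_def)
qed

lemma Wbar_eq_word_sgp: "Wbar T G = word_sgp T G {}"
proof -
  have "word_rel G {} = rel1 G"
    by (intro ext) (simp add: word_rel_def unit_rel.simps)
  then show ?thesis by (simp add: Wbar_def word_sgp_def)
qed

lemma Sgp_eq_hom_space: "Sgp T G H = hom_space T G {} H {}"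
  by (simp add: Sgp_def hom_space_def unital_homs_def)

lemma eps_sgp_of: "eps (sgp_of M) = eps M"
  by (intro ext) (simp add: eps_def word_eval_def[abs_def])

lemma unital_semigroup_sgp_of:
  assumes "topological_monoid T M"
  shows "unital_semigroup (sgp_of M) {unit_of M}" "topological_semigroup T (sgp_of M)"
proof -
  show "topological_semigroup T (sgp_of M)"
    using assms by (simp add: topological_monoid_def topological_semigroup_def)
  then show "unital_semigroup (sgp_of M) {unit_of M}"
    by (rule unital_semigroup_if_topological_semigroup) (use assms in \<open>auto simp: topological_monoid_def\<close>)
qed

theorem proposition1p5:
  fixes T :: "'c itself"
    and M :: "'m top_mon" and N :: "'n top_mon"
    and G :: "'g top_sgp" and H :: "'h top_sgp"
  assumes "(UNIV :: real set) \<lesssim> (UNIV :: 'c set)"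
    and "topological_monoid T M" and "topological_monoid T N"
    and "well_pointed T M"
    and "topological_semigroup T G" and "topological_semigroup T H"
  shows "homotopy_equivalence_map (Mon T (W T M) (W T N)) (Mon T (W T M) N)
           (postcomp (space_of (W T M)) (eps N)) \<and>
         homotopy_equivalence_map (Sgp T (Wbar T G) (Wbar T H)) (Sgp T (Wbar T G) H)
           (postcomp (space_of (Wbar T G)) (eps H))"
proof
  \<comment> \<open>This brings the source of \<open>postcomp\<close> into the form to which
    \<open>sgp_of_W\<close> applies.\<close>
  have "space_of (W T M) = space_of (sgp_of (W T M))" by simp
  then show "homotopy_equivalence_map (Mon T (W T M) (W T N)) (Mon T (W T M) N)
      (postcomp (space_of (W T M)) (eps N))"
    unfolding Mon_eq_hom_space unit_of_W sgp_of_W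
    using homotopy_equivalence_eps[OF assms(1) unital_semigroup_sgp_of(1)[OF assms(2)] unital_semigroup_sgp_of[OF assms(3)]]
    by (simp add: eps_sgp_of)
  have "unital_semigroup G {}" "unital_semigroup H {}"
    using assms(5,6) by (auto intro: unital_semigroup_if_topological_semigroup)
  from homotopy_equivalence_eps[OF assms(1) this assms(6)]
  show "homotopy_equivalence_map (Sgp T (Wbar T G) (Wbar T H)) (Sgp T (Wbar T G) H)
      (postcomp (space_of (Wbar T G)) (eps H))"
    by (simp add: Wbar_eq_word_sgp Sgp_eq_hom_space word_units_def)
qed

end
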